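(* Let $b,c$ be positive integers with $bc\le 4$, and let $\mathcal{B}$ be the canonical basis of $\mathcal{A}(b,c)$. For every $\alpha=(a_1,a_2)\in Q=\mathbb{Z}^2$ there is a unique element $x[\alpha]\in\mathcal{B}$ of the form $$x[\alpha]=\frac{N_\alpha(y_1,y_2)}{y_1^{a_1}y_2^{a_2}},$$ where $N_\alpha$ is a polynomial (with integer coefficients) with constant term $1$. The correspondence $\alpha\mapsto x[\alpha]$ is a bijection between $Q$ and $\mathcal{B}$.
   Context: Let $\mathcal{F}=\mathbb{Q}(y_1,y_2)$ be the field of rational functions in two commuting independent variables. For positive integers $b,c$ define $y_m\in\mathcal{F}$ for all $m\in\mathbb{Z}$ recursively by $y_{m-1}y_{m+1}=y_m^b+1$ for $m$ odd and $y_{m-1}y_{m+1}=y_m^c+1$ for $m$ even. The cluster algebra $\mathcal{A}(b,c)$ is the subring of $\mathcal{F}$ generated by all $y_m$, $m\in\mathbb{Z}$. It is known (Laurent phenomenon) that for each $m\in\mathbb{Z}$ every element of $\mathcal{A}(b,c)$ is uniquely a Laurent polynomial with integer coefficients in $y_m$ and $y_{m+1}$. A non-zero element $y\in\mathcal{A}(b,c)$ is called positive if for every $m\in\mathbb{Z}$ all the (non-zero) coefficients in the expansion of $y$ as a Laurent polynomial in $y_m$ and $y_{m+1}$ are positive. When $bc\le 4$, the canonical basis $\mathcal{B}$ is the unique $\mathbb{Z}$-basis of $\mathcal{A}(b,c)$ such that the set of positive elements consists precisely of the positive integer linear combinations of elements of $\mathcal{B}$ (its existence and uniqueness for $bc\le4$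 is a theorem of the same paper; $\mathcal{B}$ is the set of positive elements that cannot be written as a sum of two positive elements). *)

theory Defs
  imports
    "HOL-Computational_Algebra.Computational_Algebra"
    "HOL-Library.Poly_Mapping"
begin

text \<open>
  The field \<open>\<rat>(y1, y2)\<close> is the fraction field of \<open>\<rat>[y1][y2]\<close>: in the type
  \<open>rat poly poly\<close> the inner variable is \<open>y1\<close> and the outer one is \<open>y2\<close>.
\<close>

type_synonym ratfun2 = "rat poly poly fract"

definition Y1 :: ratfun2 where
  "Y1 = to_fract [:[:0, 1:]:]"

definition Y2 :: ratfun2 where
  "Y2 = to_fract [:0, 1:]"

definition exch_exp :: "nat \<Rightarrow> nat \<Rightarrow> int \<Rightarrow> nat" where
  "exch_exp b c m = (if odd m then b else c)"

text \<open>
  The exchange relation solved for \<open>y (m + 1)\<close> when \<open>m + 1 > 2\<close>, and for \<open>y (m - 1)\<close> when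
  \<open>m - 1 < 1\<close>. No division by zero occurs; see \<open>cluster_var_exchange\<close> for the relation itself.
\<close>

function cluster_var :: "nat \<Rightarrow> nat \<Rightarrow> int \<Rightarrow> ratfun2" where
  "cluster_var b c m =
    (if m = 1 then Y1
     else if m = 2 then Y2
     else if m > 2 then
       (cluster_var b c (m - 1) ^ exch_exp b c (m - 1) + 1) / cluster_var b c (m - 2)
     else
       (cluster_var b c (m + 1) ^ exch_exp b c (m + 1) + 1) / cluster_var b c (m + 2))"
  by pat_completeness auto
termination
  by (relation "measure (\<lambda>(b, c, m). nat \<bar>2 * m - 3\<bar>)") auto

declare cluster_var.simps [simp del]

text \<open>A set of fractions that is closed under the exchange step and does not contain 0.\<close>

definition pos_at_one :: "ratfun2 \<Rightarrow> bool" where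
  "pos_at_one x \<longleftrightarrow>
    (\<exists>p q. x = Fract p q \<and> poly (poly p 1) 1 > 0 \<and> poly (poly q 1) 1 > 0)"

lemma pos_at_oneI:
  "x = Fract p q \<Longrightarrow> poly (poly p 1) 1 > 0 \<Longrightarrow> poly (poly q 1) 1 > 0 \<Longrightarrow> pos_at_one x"
  unfolding pos_at_one_def by blast

lemma pos_at_one_nonzero: "pos_at_one x \<Longrightarrow> x \<noteq> 0"
proof -
  assume "pos_at_one x"
  then obtain p q where *: "x = Fract p q" "poly (poly p 1) 1 > 0" "poly (poly q 1) 1 > 0"
    unfolding pos_at_one_def by blast
  then have "p \<noteq> 0" "q \<noteq> 0" by auto
  with * show "x \<noteq> 0" by (simp add: Zero_fract_def eq_fract)
qed

lemma pos_at_one_1: "pos_at_one 1"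
  by (rule pos_at_oneI[of _ 1 1]) (auto simp: One_fract_def)

lemma pos_at_one_mult:
  assumes "pos_at_one x" "pos_at_one y"
  shows "pos_at_one (x * y)"
proof -
  from assms obtain p q r s where
    "x = Fract p q" "poly (poly p 1) 1 > 0" "poly (poly q 1) 1 > 0"
    "y = Fract r s" "poly (poly r 1) 1 > 0" "poly (poly s 1) 1 > 0"
    unfolding pos_at_one_def by blast
  then show ?thesis
    by (intro pos_at_oneI[of _ "p * r" "q * s"]) auto
qed

lemma pos_at_one_add:
  assumes "pos_at_one x" "pos_at_one y"
  shows "pos_at_one (x + y)"
proof -
  from assms obtain p q r s where
    *: "x = Fract p q" "poly (poly p 1) 1 > 0" "poly (poly q 1) 1 > 0"
    "y = Fract r s" "poly (poly r 1) 1 > 0" "poly (poly s 1) 1 > 0"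
    unfolding pos_at_one_def by blast
  then have "q \<noteq> 0" "s \<noteq> 0" by auto
  with * show ?thesis
    by (intro pos_at_oneI[of _ "p * s + r * q" "q * s"]) (auto intro: add_pos_pos)
qed

lemma pos_at_one_divide:
  assumes "pos_at_one x" "pos_at_one y"
  shows "pos_at_one (x / y)"
proof -
  from assms(2) obtain r s where
    "y = Fract r s" "poly (poly r 1) 1 > 0" "poly (poly s 1) 1 > 0"
    unfolding pos_at_one_def by blast
  then have "pos_at_one (inverse y)"
    by (intro pos_at_oneI[of _ s r]) auto
  with assms(1) show ?thesis
    by (simp add: divide_inverse pos_at_one_mult)
qed

lemma pos_at_one_power: "pos_at_one x \<Longrightarrow> pos_at_one (x ^ n)"
  by (induction n) (auto simp: pos_at_one_1 pos_at_one_mult)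

lemma pos_at_one_cluster_var: "pos_at_one (cluster_var b c m)"
proof (induction b c m rule: cluster_var.induct)
  case (1 b c m)
  have "pos_at_one Y1" "pos_at_one Y2"
    unfolding Y1_def Y2_def to_fract_def by (auto intro: pos_at_oneI)
  with 1 show ?case
    by (subst cluster_var.simps)
       (auto intro!: pos_at_one_divide pos_at_one_add pos_at_one_power pos_at_one_1)
qed

lemma cluster_var_exchange:
  "cluster_var b c (m - 1) * cluster_var b c (m + 1) =
     (if odd m then cluster_var b c m ^ b + 1 else cluster_var b c m ^ c + 1)"
proof -
  have nz: "cluster_var b c k \<noteq> 0" for k
    using pos_at_one_cluster_var pos_at_one_nonzero by blast
  show ?thesis
  proof (cases "m + 1 > 2")
    case True
    then have "cluster_var b c (m + 1) =
        (cluster_var b c m ^ exch_exp b c m + 1) / cluster_var b c (m - 1)"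
      by (subst cluster_var.simps) (simp add: algebra_simps)
    then show ?thesis using nz[of "m - 1"] by (simp add: exch_exp_def)
  next
    case False
    then have "cluster_var b c (m - 1) =
        (cluster_var b c m ^ exch_exp b c m + 1) / cluster_var b c (m + 1)"
      by (subst cluster_var.simps) (simp add: algebra_simps)
    then show ?thesis using nz[of "m + 1"] by (simp add: exch_exp_def)
  qed
qed

lemma cluster_var_1 [simp]: "cluster_var b c 1 = Y1"
  by (subst cluster_var.simps) simp

lemma cluster_var_2 [simp]: "cluster_var b c 2 = Y2"
  by (subst cluster_var.simps) simp

inductive_set subring_generated :: "'a::ring_1 set \<Rightarrow> 'a set" for X where
  gen: "x \<in> X \<Longrightarrow> x \<in> subring_generated X"
| one: "1 \<in> subring_generated X"
| diff: "x \<in> subring_generated X \<Longrightarrow> y \<in> subring_generated X \<Longrightarrow> x - y \<in> subring_generated X"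
| mult: "x \<in> subring_generated X \<Longrightarrow> y \<in> subring_generated X \<Longrightarrow> x * y \<in> subring_generated X"

definition cluster_algebra :: "nat \<Rightarrow> nat \<Rightarrow> ratfun2 set" where
  "cluster_algebra b c = subring_generated (range (cluster_var b c))"

text \<open>
  An integer Laurent polynomial in two variables is a finitely supported map sending an exponent
  pair \<open>(i, j)\<close> to the coefficient of the monomial \<open>u^i v^j\<close>.
\<close>

definition laurent_eval :: "(int \<times> int \<Rightarrow>\<^sub>0 int) \<Rightarrow> ratfun2 \<Rightarrow> ratfun2 \<Rightarrow> ratfun2" where
  "laurent_eval f u v =
    (\<Sum>(i, j)\<in>Poly_Mapping.keys f.
       of_int (Poly_Mapping.lookup f (i, j)) * u powi i * v powi j)"

text \<open>
  The expansion of an element in \<open>y m\<close> and \<open>y (m + 1)\<close> is unique, since these two elements are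
  algebraically independent; the existential quantifier over \<open>f\<close> thus picks out that expansion.
  By definition \<open>keys f\<close> consists of the exponents with non-zero coefficient.
\<close>

definition positive :: "nat \<Rightarrow> nat \<Rightarrow> ratfun2 \<Rightarrow> bool" where
  "positive b c x \<longleftrightarrow>
     x \<in> cluster_algebra b c \<and> x \<noteq> 0 \<and>
     (\<forall>m. \<exists>f. x = laurent_eval f (cluster_var b c m) (cluster_var b c (m + 1)) \<and>
       (\<forall>k\<in>Poly_Mapping.keys f. Poly_Mapping.lookup f k > 0))"

abbreviation int_scale :: "int \<Rightarrow> ratfun2 \<Rightarrow> ratfun2" where
  "int_scale k x \<equiv> of_int k * x"

interpretation int_module: module int_scale
  by unfold_locales (simp_all add: algebra_simps)

definition is_int_basis :: "ratfun2 set \<Rightarrow> ratfun2 set \<Rightarrow> bool" where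
  "is_int_basis B A \<longleftrightarrow> int_module.independent B \<and> int_module.span B = A"

text \<open>
  The index set \<open>S\<close> is required to be non-empty because the empty combination 0 is not positive.
\<close>

definition pos_combinations :: "ratfun2 set \<Rightarrow> ratfun2 set" where
  "pos_combinations B =
    {\<Sum>x\<in>S. int_scale (k x) x | S k. finite S \<and> S \<noteq> {} \<and> S \<subseteq> B \<and> (\<forall>x\<in>S. k x > 0)}"

definition is_canonical_basis :: "nat \<Rightarrow> nat \<Rightarrow> ratfun2 set \<Rightarrow> bool" where
  "is_canonical_basis b c B \<longleftrightarrow>
     is_int_basis B (cluster_algebra b c) \<and> {x. positive b c x} = pos_combinations B"

definition canonical_basis :: "nat \<Rightarrow> nat \<Rightarrow> ratfun2 set" where
  "canonical_basis b c = (THE B. is_canonical_basis b c B)"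

text \<open>The value \<open>N(u, v)\<close>, where again the inner variable of \<open>N\<close> is the first one.\<close>

definition eval2 :: "int poly poly \<Rightarrow> ratfun2 \<Rightarrow> ratfun2 \<Rightarrow> ratfun2" where
  "eval2 N u v = poly (map_poly (\<lambda>p. poly (map_poly of_int p) u) N) v"

definition has_denominator :: "int \<times> int \<Rightarrow> ratfun2 \<Rightarrow> bool" where
  "has_denominator \<alpha> x \<longleftrightarrow>
     (\<exists>N :: int poly poly. coeff (coeff N 0) 0 = 1 \<and>
        x = eval2 N Y1 Y2 / (Y1 powi fst \<alpha> * Y2 powi snd \<alpha>))"

definition canonical_elem :: "nat \<Rightarrow> nat \<Rightarrow> int \<times> int \<Rightarrow> ratfun2" where
  "canonical_elem b c \<alpha> = (THE x. x \<in> canonical_basis b c \<and> has_denominator \<alpha> x)"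

end

theory Submission
  imports Defs
begin

text \<open>
  The basis can be written down: it consists of the cluster monomials \<open>y m ^ p * y (m + 1) ^ q\<close> and,
  if \<open>b * c = 4\<close>, of the elements \<open>cheb z n\<close> with \<open>n \<ge> 1\<close>, where \<open>z\<close> is an element of the cluster
  algebra that is the same rational expression in every cluster (up to exchanging \<open>b\<close> and \<open>c\<close>). The
  proof establishes four properties of this set \<open>B\<close>.

  \<^bold>\<open>Positivity.\<close> Every element of \<open>B\<close> has non-negative coefficients in every cluster. In finite type
  the sequence of cluster variables is periodic (\<open>exchange_seq_period\<close>), so finitely many expansions
  suffice. In affine type the variables, or every second one of them, satisfy a linear recurrence
  with coefficient \<open>z\<close>, and they are entries of powers of a \<open>2 \<times> 2\<close> matrix of determinant \<open>1\<close> and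
  trace \<open>z\<close> whose entries have non-negative coefficients (\<open>linear_recurrence_pos\<close>). The elements
  \<open>cheb z n\<close> are the traces of these powers.

  \<^bold>\<open>Denominators.\<close> For each \<open>\<alpha> \<in> \<int>\<^sup>2\<close> some element of \<open>B\<close> has denominator \<open>\<alpha>\<close> and numerator
  with constant term \<open>1\<close>. If a coordinate of \<open>\<alpha>\<close> is not positive this is a monomial in two
  consecutive ones of \<open>y 0, \<dots>, y 3\<close>; otherwise the denominators of the cluster variables cut the
  positive quadrant into cones, with only the ray of \<open>z\<close> left over in affine type
  (\<open>denominators_surjective\<close>).

  \<^bold>\<open>Spanning.\<close> The standard monomials, those in \<open>y 0, \<dots>, y 3\<close> without factors \<open>y 0 * y 2\<close> and
  \<open>y 1 * y 3\<close>, span the cluster algebra and realise each denominator once. Any family with one element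
  for each denominator that agrees with them outside the positive quadrant is related to them by a
  unitriangular transformation, hence spans as well (\<open>pointed_family_spans\<close>).

  \<^bold>\<open>Recovering coefficients.\<close> For each element of \<open>B\<close> and each finite subset there is a cluster and a
  Laurent monomial that has coefficient \<open>1\<close> in this element and \<open>0\<close> in the other ones
  (\<open>dual_monomial\<close>). That a monomial does not occur is shown by evaluation: an expansion with
  non-negative coefficients is at least as large as each of its terms, whereas setting one cluster
  variable to \<open>1/2\<close> and a neighbour to \<open>1\<close> makes all other variables at least \<open>1\<close>
  (\<open>half_specialization\<close>). It follows that \<open>B\<close> is linearly independent and that the coefficients of a
  positive element with respect to \<open>B\<close> are positive.

  These properties say that \<open>B\<close> is a canonical basis, and a basis is determined by the set of its
  positive combinations (\<open>positive_basis_subset\<close>). Choosing one element of \<open>B\<close> for each denominator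
  gives a subset that still spans; since \<open>B\<close> is independent, the subset is all of \<open>B\<close>. This is why
  distinct elements of \<open>B\<close> have distinct denominators.
\<close>

section \<open>Exchange sequences\<close>

text \<open>
  Everything is proved for arbitrary sequences in a field that satisfy the exchange relations. Such
  sequences can be shifted and reflected, which turns any cluster into the pair \<open>(Y 1, Y 2)\<close> at the
  price of possibly swapping \<open>b\<close> and \<open>c\<close>. The numerical values of the cluster variables at a point
  form another instance.
\<close>

definition exchange_seq :: "nat \<Rightarrow> nat \<Rightarrow> (int \<Rightarrow> 'a::field) \<Rightarrow> bool" where
  "exchange_seq b c Y \<longleftrightarrow>
    (\<forall>m. Y m \<noteq> 0 \<and> Y (m - 1) * Y (m + 1) = Y m ^ exch_exp b c m + 1)"

lemma exchange_seq_nonzero: "exchange_seq b c Y \<Longrightarrow> Y m \<noteq> 0"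
  by (simp add: exchange_seq_def)

lemma exchange_seq_rel:
  "exchange_seq b c Y \<Longrightarrow> Y (m - 1) * Y (m + 1) = Y m ^ exch_exp b c m + 1"
  by (simp add: exchange_seq_def)

lemma exchange_seq_next:
  "exchange_seq b c Y \<Longrightarrow> Y (m + 1) = (Y m ^ exch_exp b c m + 1) / Y (m - 1)"
  using exchange_seq_rel[of b c Y m] exchange_seq_nonzero[of b c Y "m - 1"]
  by (simp add: field_simps)

lemma exchange_seq_prev:
  "exchange_seq b c Y \<Longrightarrow> Y (m - 1) = (Y m ^ exch_exp b c m + 1) / Y (m + 1)"
  using exchange_seq_rel[of b c Y m] exchange_seq_nonzero[of b c Y "m + 1"]
  by (simp add: field_simps)

lemma exchange_seq_cluster_var: "exchange_seq b c (cluster_var b c)"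
  unfolding exchange_seq_def
  using cluster_var_exchange[of b c] pos_at_one_cluster_var[THEN pos_at_one_nonzero]
  by (auto simp: exch_exp_def)

lemma exchange_seq_shift:
  assumes "exchange_seq b c Y"
  shows "exchange_seq (exch_exp b c (k + 1)) (exch_exp b c k) (\<lambda>m. Y (m + k))"
  unfolding exchange_seq_def
proof (intro allI conjI)
  fix m
  show "Y (m + k) \<noteq> 0" using assms by (rule exchange_seq_nonzero)
  show "Y (m - 1 + k) * Y (m + 1 + k) =
      Y (m + k) ^ exch_exp (exch_exp b c (k + 1)) (exch_exp b c k) m + 1"
    using exchange_seq_rel[OF assms, of "m + k"]
    by (auto simp: exch_exp_def algebra_simps)
qed

lemma exchange_seq_reflect:
  assumes "exchange_seq b c Y"
  shows "exchange_seq c b (\<lambda>m. Y (3 - m))"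
  unfolding exchange_seq_def
proof (intro allI conjI)
  fix m
  show "Y (3 - m) \<noteq> 0" using assms by (rule exchange_seq_nonzero)
  have "Y (3 - m - 1) * Y (3 - m + 1) = Y (3 - m) ^ exch_exp b c (3 - m) + 1"
    using exchange_seq_rel[OF assms] .
  moreover have "3 - (m - 1) = 3 - m + 1" "3 - (m + 1) = 3 - m - 1" by auto
  ultimately show "Y (3 - (m - 1)) * Y (3 - (m + 1)) = Y (3 - m) ^ exch_exp c b m + 1"
    by (auto simp: exch_exp_def algebra_simps)
qed

lemma exch_exp_pos: "b > 0 \<Longrightarrow> c > 0 \<Longrightarrow> exch_exp b c m > 0"
  by (simp add: exch_exp_def)

lemma exch_exp_shift_mult: "exch_exp b c (k - 1) * exch_exp b c k = b * c"
  by (auto simp: exch_exp_def)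

lemma exchange_seq_near:
  assumes "exchange_seq b c Y"
  shows "Y 3 = (Y 2 ^ c + 1) / Y 1" "Y 4 = (Y 3 ^ b + 1) / Y 2" "Y 5 = (Y 4 ^ c + 1) / Y 3"
    "Y 6 = (Y 5 ^ b + 1) / Y 4"
    "Y 0 = (Y 1 ^ b + 1) / Y 2" "Y (-1) = (Y 0 ^ c + 1) / Y 1" "Y (-2) = (Y (-1) ^ b + 1) / Y 0"
  using exchange_seq_next[OF assms, of 2] exchange_seq_next[OF assms, of 3]
    exchange_seq_next[OF assms, of 4] exchange_seq_next[OF assms, of 5]
    exchange_seq_prev[OF assms, of 1] exchange_seq_prev[OF assms, of 0]
    exchange_seq_prev[OF assms, of "-1"]
  by (simp_all add: exch_exp_def)

section \<open>Periodicity in finite type\<close>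

text \<open>
  The period is \<open>h + 2\<close>, where \<open>h\<close> is the Coxeter number \<open>3\<close>, \<open>4\<close> or \<open>6\<close> of the root system of
  type \<open>A2\<close>, \<open>B2\<close> or \<open>G2\<close>.
\<close>

definition finite_period :: "nat \<Rightarrow> nat \<Rightarrow> int" where
  "finite_period b c = (if b * c = 1 then 5 else if b * c = 2 then 6 else 8)"

lemma finite_period_swap: "finite_period c b = finite_period b c"
  by (simp add: finite_period_def mult.commute)

text \<open>
  The only denominator in \<open>Y 5\<close> that is not obviously a monomial is \<open>Y 3\<close>, that is, the factor
  \<open>V = v ^ 3 + 1\<close>; writing everything in \<open>u\<close> and \<open>V\<close> shows that it cancels.
\<close>

lemma near_values_G2:
  fixes Y :: "int \<Rightarrow> 'a::field"
  assumes Y: "exchange_seq 1 3 Y" 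
  shows "Y 5 = ((Y 2 ^ 3 + 1)^2 + 3 * (Y 2 ^ 3 + 1) * Y 1 + 3 * Y 1 ^ 2 + Y 1 ^ 3) / (Y 1 ^ 2 * Y 2 ^ 3)"
    and "Y (-2) = ((Y 1 + 1)^2 + Y 2 ^ 3) / (Y 1 * Y 2 ^ 2)"
    and "Y 6 = Y (-2)"
proof -
  define u v where "u = Y 1" and "v = Y 2"
  define V where "V = v ^ 3 + 1"
  note near = exchange_seq_near[OF Y, folded u_def v_def]
  have nz: "u \<noteq> 0" "v \<noteq> 0" "Y 3 \<noteq> 0" "Y 4 \<noteq> 0" "Y 0 \<noteq> 0"
    using Y by (auto simp: u_def v_def exchange_seq_nonzero)
  have y3: "Y 3 = V / u" and y4: "Y 4 = (V + u) / (u * v)" and y0: "Y 0 = (u + 1) / v"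
    using near nz by (simp_all add: V_def field_simps)
  have Vnz: "V \<noteq> 0" "V + u \<noteq> 0" "u + 1 \<noteq> 0" using y3 y4 y0 nz by auto
  have v3: "v ^ 3 = V - 1" by (simp add: V_def)
  have "(V + u) ^ 3 + u ^ 3 * v ^ 3 = V * (V\<^sup>2 + 3 * V * u + 3 * u\<^sup>2 + u ^ 3)"
    unfolding v3 by algebra
  moreover have "Y 4 ^ 3 + 1 = ((V + u) ^ 3 + u ^ 3 * v ^ 3) / (u ^ 3 * v ^ 3)"
    unfolding y4 using nz by (simp add: field_simps)
  ultimately have "Y 5 = V * (V\<^sup>2 + 3 * V * u + 3 * u\<^sup>2 + u ^ 3) / (u ^ 3 * v ^ 3) / (V / u)"
    using near(3) y3 by simp
  also have "\<dots> = (V\<^sup>2 + 3 * V * u + 3 * u\<^sup>2 + u ^ 3) / (u ^ 2 * v ^ 3)"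
    using nz Vnz by (simp add: power2_eq_square power3_eq_cube)
  finally have y5: "Y 5 = (V\<^sup>2 + 3 * V * u + 3 * u\<^sup>2 + u ^ 3) / (u ^ 2 * v ^ 3)" .
  have "Y 5 + 1 = (V + u) * (V + 2 * u + u\<^sup>2) / (u ^ 2 * v ^ 3)"
  proof -
    have "V\<^sup>2 + 3 * V * u + 3 * u\<^sup>2 + u ^ 3 + u\<^sup>2 * v ^ 3 = (V + u) * (V + 2 * u + u\<^sup>2)"
      unfolding v3 by algebra
    moreover have "Y 5 + 1 = (V\<^sup>2 + 3 * V * u + 3 * u\<^sup>2 + u ^ 3 + u\<^sup>2 * v ^ 3) / (u ^ 2 * v ^ 3)"
      unfolding y5 using nz by (simp add: field_simps)
    ultimately show ?thesis by simp
  qed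
  then have "Y 6 = (V + u) * (V + 2 * u + u\<^sup>2) / (u ^ 2 * v ^ 3) / ((V + u) / (u * v))"
    using near(4) y4 by simp
  also have "\<dots> = (V + 2 * u + u\<^sup>2) / (u * v ^ 2)"
    using nz Vnz by (simp add: power2_eq_square power3_eq_cube)
  also have "V + 2 * u + u\<^sup>2 = (u + 1)\<^sup>2 + v ^ 3" unfolding v3 by algebra
  finally have y6: "Y 6 = ((u + 1)\<^sup>2 + v ^ 3) / (u * v ^ 2)" .
  have ym1: "Y (-1) = ((u + 1) ^ 3 + v ^ 3) / (u * v ^ 3)"
    using near(6) nz unfolding y0 by (simp add: field_simps)
  have "Y (-1) + 1 = (u + 1) * ((u + 1)\<^sup>2 + v ^ 3) / (u * v ^ 3)"
  proof -
    have "(u + 1) ^ 3 + v ^ 3 + u * v ^ 3 = (u + 1) * ((u + 1)\<^sup>2 + v ^ 3)" by algebra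
    moreover have "Y (-1) + 1 = ((u + 1) ^ 3 + v ^ 3 + u * v ^ 3) / (u * v ^ 3)"
      unfolding ym1 using nz by (simp add: field_simps)
    ultimately show ?thesis by simp
  qed
  then have "Y (-2) = (u + 1) * ((u + 1)\<^sup>2 + v ^ 3) / (u * v ^ 3) / ((u + 1) / v)"
    using near(7) y0 by simp
  also have "\<dots> = ((u + 1)\<^sup>2 + v ^ 3) / (u * v ^ 2)"
    using nz Vnz by (simp add: power2_eq_square power3_eq_cube)
  finally have ym2: "Y (-2) = ((u + 1)\<^sup>2 + v ^ 3) / (u * v ^ 2)" .
  show "Y 6 = Y (-2)" using y6 ym2 by simp
  show "Y (-2) = ((Y 1 + 1)^2 + Y 2 ^ 3) / (Y 1 * Y 2 ^ 2)" using ym2 by (simp add: u_def v_def)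
  show "Y 5 = ((Y 2 ^ 3 + 1)^2 + 3 * (Y 2 ^ 3 + 1) * Y 1 + 3 * Y 1 ^ 2 + Y 1 ^ 3) / (Y 1 ^ 2 * Y 2 ^ 3)"
    using y5 by (simp add: u_def v_def V_def)
qed

lemma period_A2:
  fixes Y :: "int \<Rightarrow> 'a::field"
  assumes Y: "exchange_seq 1 1 Y"
  shows "Y 5 = Y 0"
proof -
  define u v where "u = Y 1" and "v = Y 2"
  note near = exchange_seq_near[OF Y, folded u_def v_def]
  have nz: "u \<noteq> 0" "v \<noteq> 0" "Y 3 \<noteq> 0"
    using Y by (auto simp: u_def v_def exchange_seq_nonzero)
  have y3: "Y 3 = (v + 1) / u" and y4: "Y 4 = (v + 1 + u) / (u * v)" and y0: "Y 0 = (u + 1) / v"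
    using near nz by (simp_all add: field_simps)
  have vnz: "v + 1 \<noteq> 0" using y3 nz by auto
  have "Y 4 + 1 = (v + 1) * (u + 1) / (u * v)" unfolding y4 using nz by (simp add: field_simps)
  then have "Y 5 = (v + 1) * (u + 1) / (u * v) / ((v + 1) / u)" using near(3) y3 by simp
  also have "\<dots> = (u + 1) / v" using nz vnz by simp
  finally show ?thesis using y0 by simp
qed

lemma period_B2:
  fixes Y :: "int \<Rightarrow> 'a::field"
  assumes Y: "exchange_seq 1 2 Y"
  shows "Y 4 = Y (-2)"
proof -
  define u v where "u = Y 1" and "v = Y 2"
  note near = exchange_seq_near[OF Y, folded u_def v_def]
  have nz: "u \<noteq> 0" "v \<noteq> 0" "Y 0 \<noteq> 0"
    using Y by (auto simp: u_def v_def exchange_seq_nonzero)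
  have y4: "Y 4 = (v ^ 2 + 1 + u) / (u * v)" and y0: "Y 0 = (u + 1) / v"
    using near nz by (simp_all add: field_simps)
  have unz: "u + 1 \<noteq> 0" using y0 nz by auto
  have ym1: "Y (-1) = ((u + 1) ^ 2 + v ^ 2) / (u * v ^ 2)"
    using near(6) nz unfolding y0 by (simp add: field_simps)
  have "(u + 1) ^ 2 + v ^ 2 + u * v ^ 2 = (u + 1) * (v ^ 2 + 1 + u)" by algebra
  moreover have "Y (-1) + 1 = ((u + 1) ^ 2 + v ^ 2 + u * v ^ 2) / (u * v ^ 2)"
    unfolding ym1 using nz by (simp add: field_simps)
  ultimately have "Y (-2) = (u + 1) * (v ^ 2 + 1 + u) / (u * v ^ 2) / ((u + 1) / v)"
    using near(7) y0 by simp
  also have "\<dots> = (v ^ 2 + 1 + u) / (u * v)" using nz unz by (simp add: power2_eq_square)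
  finally show ?thesis using y4 by simp
qed

text \<open>
  For \<open>b = 1\<close> the odd terms are determined by their even neighbours, so a period of the even
  terms is a period of the whole sequence.
\<close>

lemma exchange_seq_period_one:
  fixes Y :: "int \<Rightarrow> 'a::field"
  assumes Y: "exchange_seq 1 c Y" and c: "c \<in> {1, 2, 3}"
  shows "Y (m + finite_period 1 c) = Y m"
proof (cases "c = 1")
  case True
  have "exchange_seq 1 1 (\<lambda>j. Y (j + m))"
    using exchange_seq_shift[OF Y, of m] True by (simp add: exch_exp_def)
  from period_A2[OF this] show ?thesis using True by (simp add: finite_period_def add.commute)
next
  case False
  define N where "N = finite_period 1 c"
  have N: "even N" using False c by (auto simp: N_def finite_period_def)
  have ev: "Y (k + N) = Y k" if "even k" for k
  proof -
    have sh: "exchange_seq 1 c (\<lambda>j. Y (j + (k + 2)))"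
      using exchange_seq_shift[OF Y, of "k + 2"] that by (simp add: exch_exp_def)
    from False c consider "c = 2" | "c = 3" by auto
    then show ?thesis
    proof cases
      case 1
      then show ?thesis using period_B2[of "\<lambda>j. Y (j + (k + 2))"] sh
        by (simp add: N_def finite_period_def add.commute)
    next
      case 2
      then show ?thesis using near_values_G2(3)[of "\<lambda>j. Y (j + (k + 2))"] sh
        by (simp add: N_def finite_period_def add.commute)
    qed
  qed
  show ?thesis
  proof (cases "even m")
    case True
    then show ?thesis using ev by (simp add: N_def)
  next
    case odd: False
    have rel: "Y k + 1 = Y (k - 1) * Y (k + 1)" if "odd k" for k
      using exchange_seq_rel[OF Y, of k] that by (simp add: exch_exp_def)
    have "Y (m + N) + 1 = Y (m - 1 + N) * Y (m + 1 + N)"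
      using rel[of "m + N"] odd N by (simp add: algebra_simps)
    also have "\<dots> = Y m + 1" using rel[of m] ev odd by simp
    finally show ?thesis by (simp add: N_def)
  qed
qed

lemma finite_type_cases:
  fixes b c :: nat
  assumes "b > 0" "c > 0" "b * c < 4"
  obtains "b = 1" "c \<in> {1, 2, 3}" | "c = 1" "b \<in> {1, 2, 3}"
proof -
  have "b = 1 \<or> c = 1"
  proof (rule ccontr)
    assume "\<not> ?thesis"
    with assms(1,2) have "2 * 2 \<le> b * c" by (intro mult_le_mono) auto
    with assms(3) show False by simp
  qed
  then show thesis
  proof
    assume "b = 1"
    with assms have "c = 1 \<or> c = 2 \<or> c = 3" by auto
    with \<open>b = 1\<close> that(1) show thesis by auto
  next
    assume "c = 1"
    with assms have "b = 1 \<or> b = 2 \<or> b = 3" by auto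
    with \<open>c = 1\<close> that(2) show thesis by auto
  qed
qed

lemma affine_type_cases:
  fixes b c :: nat
  assumes "b * c = 4"
  obtains "b = 2" "c = 2" | "b = 1" "c = 4" | "b = 4" "c = 1"
proof -
  have "b \<le> 4" by (rule dvd_imp_le) (use assms in \<open>auto simp: dvd_def intro: exI[of _ c]\<close>)
  then have "b = 0 \<or> b = 1 \<or> b = 2 \<or> b = 3 \<or> b = 4" by auto
  moreover have "b \<noteq> 3"
  proof
    assume "b = 3"
    with assms have "3 * c = 4" by simp
    then show False by presburger
  qed
  ultimately show thesis using assms that by auto
qed

lemma exchange_type_cases:
  fixes b c :: nat
  assumes "b > 0" "c > 0" "b * c \<le> 4"
  obtains "b = 1" "c \<in> {1, 2, 3, 4}" | "c = 1" "b \<in> {1, 2, 3, 4}" | "b = 2" "c = 2"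
proof (cases "b * c = 4")
  case True
  then show thesis by (cases rule: affine_type_cases) (use that in auto)
next
  case False
  with assms(3) have "b * c < 4" by simp
  with assms(1,2) show thesis by (cases rule: finite_type_cases) (use that in auto)
qed

theorem exchange_seq_period:
  fixes Y :: "int \<Rightarrow> 'a::field"
  assumes Y: "exchange_seq b c Y" and "b > 0" "c > 0" "b * c < 4"
  shows "Y (m + finite_period b c) = Y m"
  using assms(2-4)
proof (cases rule: finite_type_cases)
  case 1
  then show ?thesis using exchange_seq_period_one Y by auto
next
  case 2
  define N where "N = finite_period b c"
  have N: "finite_period 1 b = N" using 2 finite_period_swap[of 1 b] by (simp add: N_def)
  have "exchange_seq 1 b (\<lambda>m. Y (3 - m))" using exchange_seq_reflect[OF Y] 2 by simp
  from exchange_seq_period_one[OF this 2(2), of "3 - m - N", unfolded N]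
  show ?thesis by (simp add: N_def)
qed

lemma exchange_seq_period_multiple:
  fixes Y :: "int \<Rightarrow> 'a::field"
  assumes "exchange_seq b c Y" "b > 0" "c > 0" "b * c < 4"
  shows "Y (m + k * finite_period b c) = Y m"
proof -
  have up: "Y (m + int n * finite_period b c) = Y m" for n m
  proof (induction n)
    case (Suc n)
    have "m + int (Suc n) * finite_period b c = (m + int n * finite_period b c) + finite_period b c"
      by (simp add: algebra_simps)
    then show ?case using exchange_seq_period[OF assms, of "m + int n * finite_period b c"] Suc
      by (simp only:)
  qed simp
  show ?thesis
  proof (cases "k \<ge> 0")
    case True
    then show ?thesis using up[of m "nat k"] by simp
  next
    case False
    then show ?thesis using up[of "m + k * finite_period b c" "nat (- k)"] by simp
  qed
qed

section \<open>Positive numerical exchange sequences\<close>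

text \<open>
  A two-sided sequence with prescribed terms at two consecutive positions consists of one such run
  to the right and, with \<open>b\<close> and \<open>c\<close> exchanged, one to the left. Positivity of the initial values
  rules out divisions by zero.
\<close>

fun exchange_run :: "nat \<Rightarrow> nat \<Rightarrow> 'a::field \<Rightarrow> 'a \<Rightarrow> nat \<Rightarrow> 'a" where
  "exchange_run b c u v 0 = u"
| "exchange_run b c u v (Suc 0) = v"
| "exchange_run b c u v (Suc (Suc n)) =
     (exchange_run b c u v (Suc n) ^ exch_exp b c (int n) + 1) / exchange_run b c u v n"

lemma exchange_run_pos:
  fixes u v :: "'a::linordered_field"
  assumes "u > 0" "v > 0"
  shows "exchange_run b c u v n > 0"
  using assms
proof (induction b c u v n rule: exchange_run.induct)
  case (3 b c u v n)
  then show ?case by (auto intro!: divide_pos_pos add_pos_pos)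
qed auto

lemma exchange_seq_exists_at_one:
  fixes u v :: "'a::linordered_field"
  assumes "u > 0" "v > 0"
  shows "\<exists>s. exchange_seq b c s \<and> (\<forall>m. s m > 0) \<and> s 1 = u \<and> s 2 = v"
proof -
  define s where "s m = (if m \<ge> 1 then exchange_run b c u v (nat (m - 1))
    else exchange_run c b v u (nat (2 - m)))" for m
  have pos: "s m > 0" for m using assms by (simp add: s_def exchange_run_pos)
  have up: "s (int n + 1) = exchange_run b c u v n" for n by (simp add: s_def)
  have down: "s (2 - int n) = exchange_run c b v u n" for n
  proof (cases "n < 2")
    case True
    then have "n = 0 \<or> n = 1" by auto
    then show ?thesis by (auto simp: s_def numeral_2_eq_2)
  qed (auto simp: s_def)
  have nz: "s m \<noteq> 0" for m using pos[of m] by simp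
  have "s (m - 1) * s (m + 1) = s m ^ exch_exp b c m + 1" for m
  proof (cases "m \<ge> 2")
    case True
    then obtain n where n: "m = int n + 2" by (metis zle_iff_zadd add.commute)
    have "s (m + 1) = (s m ^ exch_exp b c (int n) + 1) / s (m - 1)"
      using up[of "Suc (Suc n)"] up[of "Suc n"] up[of n] by (simp add: n algebra_simps)
    then show ?thesis using nz[of "m - 1"] by (simp add: n exch_exp_def)
  next
    case False
    then have "m = 1 - int (nat (1 - m))" by simp
    then obtain n where n: "m = 1 - int n" ..
    have "s (m - 1) = (s m ^ exch_exp c b (int n) + 1) / s (m + 1)"
      using down[of "Suc (Suc n)"] down[of "Suc n"] down[of n] by (simp add: n algebra_simps)
    then show ?thesis using nz[of "m + 1"] by (simp add: n exch_exp_def)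
  qed
  then have "exchange_seq b c s" using nz by (simp add: exchange_seq_def)
  moreover have "s 1 = u" "s 2 = v" using up[of 0] down[of 0] by simp_all
  ultimately show ?thesis using pos by blast
qed

lemma exchange_seq_exists:
  fixes u v :: "'a::linordered_field"
  assumes "u > 0" "v > 0"
  obtains s where "exchange_seq b c s" "\<And>m. s m > 0" "s k = u" "s (k + 1) = v"
proof -
  obtain s :: "int \<Rightarrow> 'a" where s: "exchange_seq (exch_exp b c k) (exch_exp b c (k - 1)) s"
    "\<And>m. s m > 0" "s 1 = u" "s 2 = v"
    using exchange_seq_exists_at_one[OF assms] by blast
  have "exchange_seq b c (\<lambda>m. s (m + (1 - k)))"
    using exchange_seq_shift[OF s(1), of "1 - k"] by (auto simp: exch_exp_def split: if_splits)
  then show thesis by (rule that) (use s in auto)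
qed

text \<open>
  In affine type the inequality \<open>s m ^ 2 \<ge> s (m - 1) ^ e\<close> with the exchange exponent of
  \<open>m - 1\<close> propagates to the right because the product of consecutive exponents is 4.
\<close>

lemma affine_growth:
  fixes s :: "int \<Rightarrow> 'a::linordered_field"
  assumes s: "exchange_seq b c s" "\<And>m. s m > 0" and bc: "b * c = 4"
    and start: "s k \<ge> 1" "s k ^ 2 \<ge> s (k - 1) ^ exch_exp b c (k - 1)" and "k \<le> m"
  shows "s m \<ge> 1 \<and> s m ^ 2 \<ge> s (m - 1) ^ exch_exp b c (m - 1)"
  using \<open>k \<le> m\<close>
proof (induction m rule: int_ge_induct)
  case base
  then show ?case using start by simp
next
  case (step m)
  define e f where "e = exch_exp b c m" and "f = exch_exp b c (m - 1)"
  have ef: "e * f = 4" "f * e = 4" using exch_exp_shift_mult[of b c m] bc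
    by (simp_all add: e_def f_def mult.commute)
  have f': "exch_exp b c (m + 1) = f" by (simp add: exch_exp_def f_def)
  have f0: "f > 0" using ef by (cases f) auto
  have p: "s m > 0" "s (m - 1) > 0" "s (m + 1) > 0" using s(2) by auto
  have le1: "1 \<le> s m" and le2: "s (m - 1) ^ f \<le> s m ^ 2" using step.IH by (auto simp: f_def)
  have "s (m - 1) * s (m + 1) \<ge> s m ^ e"
    using exchange_seq_rel[OF s(1), of m] by (simp add: e_def)
  then have "(s m ^ e) ^ f \<le> (s (m - 1) * s (m + 1)) ^ f"
    by (rule power_mono) (use p in simp)
  then have "s m ^ 4 \<le> s (m - 1) ^ f * s (m + 1) ^ f"
    by (simp add: power_mult[symmetric] ef power_mult_distrib)
  also have "\<dots> \<le> s m ^ 2 * s (m + 1) ^ f"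
    using le2 p by (intro mult_right_mono) auto
  finally have "s m ^ 2 * s m ^ 2 \<le> s m ^ 2 * s (m + 1) ^ f"
    by (simp add: power_add[symmetric])
  then have le3: "s m ^ 2 \<le> s (m + 1) ^ f"
    by (rule mult_left_le_imp_le) (use p in simp)
  have ge1: "1 \<le> s (m + 1)"
  proof (rule ccontr)
    assume "\<not> ?thesis"
    then have "s (m + 1) ^ f < 1" using p f0 by (simp add: power_less_one_iff)
    moreover have "1 \<le> s m ^ 2" using le1 by simp
    ultimately show False using le3 by simp
  qed
  have "(s m ^ 2) ^ e \<le> (s (m + 1) ^ f) ^ e" using le3 p by (intro power_mono) auto
  then have "(s m ^ e) ^ 2 \<le> (s (m + 1) ^ 2) ^ 2"
    by (simp add: power_mult[symmetric] ef mult.commute)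
  then have "s m ^ e \<le> s (m + 1) ^ 2" by (rule power2_le_imp_le) (use p in simp)
  then show ?case using ge1 by (simp add: e_def)
qed

text \<open>
  In finite type these seven terms and \<open>s 1\<close> cover a full period; in affine type \<open>s 0\<close> and \<open>s 2\<close>
  are the terms from which the sequence grows to the left and to the right.
\<close>

lemma half_specialization_near:
  fixes s :: "int \<Rightarrow> rat"
  assumes s: "exchange_seq b c s" "\<And>m. s m > 0" and s12: "s 1 = 1 / 2" "s 2 = 1"
    and bc: "b > 0" "c > 0"
  shows "s 0 \<ge> 1" "s (-1) \<ge> 1" "s (-2) \<ge> 1" "s 2 \<ge> 1" "s 3 \<ge> 1" "s 4 \<ge> 1" "s 5 \<ge> 1"
proof -
  note near = exchange_seq_near[OF s(1)]
  have "(1 / 2 :: rat) ^ b \<le> (1 / 2) ^ 1" using bc by (intro power_decreasing) auto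
  then have s0: "1 \<le> s 0" "s 0 \<le> 3 / 2" using near(5) s12 by (simp_all add: s12)
  have s3: "s 3 = 4" using near(1) s12 by simp
  have "(4::rat) ^ 1 \<le> 4 ^ b" using bc by (intro power_increasing) auto
  then have s4: "s 4 \<ge> 5" using near(2) s12 s3 by simp
  then have "s 4 ^ 1 \<le> s 4 ^ c" using bc by (intro power_increasing) auto
  then have s5: "s 5 \<ge> 1" using near(3) s3 s4 by simp
  have "1 \<le> s 0 ^ c" using s0 by simp
  then have sm1: "s (-1) \<ge> 4" using near(6) s12 by simp
  then have "s (-1) ^ 1 \<le> s (-1) ^ b" using bc by (intro power_increasing) auto
  then have "s 0 \<le> s (-1) ^ b + 1" using s0 sm1 by simp
  then have "s (-2) \<ge> 1" unfolding near(7) using s(2)[of 0] by (simp add: le_divide_eq)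
  then show "s 0 \<ge> 1" "s (-1) \<ge> 1" "s (-2) \<ge> 1" "s 2 \<ge> 1" "s 3 \<ge> 1" "s 4 \<ge> 1" "s 5 \<ge> 1"
    using s0 s3 s4 s5 sm1 s12 by simp_all
qed

lemma half_specialization_at_one:
  fixes s :: "int \<Rightarrow> rat"
  assumes s: "exchange_seq b c s" "\<And>m. s m > 0" and s12: "s 1 = 1 / 2" "s 2 = 1"
    and bc: "b > 0" "c > 0" "b * c \<le> 4"
  shows "s m \<ge> 1 \<or> (b * c < 4 \<and> (\<exists>k. m = 1 + k * finite_period b c)) \<or> m = 1"
proof (cases "b * c = 4")
  case True
  show ?thesis
  proof (cases "m \<ge> 2")
    case m: True
    have "s 2 ^ 2 \<ge> s (2 - 1) ^ exch_exp b c (2 - 1)"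
      by (simp add: s12 power_le_one)
    then show ?thesis using affine_growth[OF s True _ _ m] s12 by simp
  next
    case m: False
    have r: "exchange_seq c b (\<lambda>m. s (3 - m))" using exchange_seq_reflect[OF s(1)] .
    have bnd: "1 \<le> s 0" using half_specialization_near[OF s s12 bc(1,2)] by simp
    have "s (3 - 3) ^ 2 \<ge> s (3 - (3 - 1)) ^ exch_exp c b (3 - 1)"
    proof -
      have "s 1 ^ exch_exp c b 2 \<le> 1" by (simp add: s12 power_le_one)
      also have "1 \<le> s 0 ^ 2" using bnd by simp
      finally show ?thesis by simp
    qed
    then have "s (3 - k) \<ge> 1" if "3 \<le> k" for k
      using affine_growth[OF r _ _ _ _ that] s(2) True bnd by (simp add: mult.commute)
    from this[of "3 - m"] m show ?thesis by (cases "m = 1") auto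
  qed
next
  case False
  with bc have bc4: "b * c < 4" by simp
  define N where "N = finite_period b c"
  have N: "N = 5 \<or> N = 6 \<or> N = 8" by (simp add: N_def finite_period_def)
  define r where "r = (m + 2) mod N - 2"
  have m: "m = r + ((m + 2) div N) * N" by (simp add: r_def minus_mod_eq_div_mult [symmetric])
  have sm: "s m = s r" using exchange_seq_period_multiple[OF s(1) bc(1,2) bc4, of r "(m + 2) div N"] m
    by (simp add: N_def)
  have "-2 \<le> r" "r \<le> 5" using N by (auto simp: r_def)
  then have "r = -2 \<or> r = -1 \<or> r = 0 \<or> r = 1 \<or> r = 2 \<or> r = 3 \<or> r = 4 \<or> r = 5" by auto
  then have "s r \<ge> 1 \<or> r = 1" using half_specialization_near[OF s s12 bc(1,2)] by auto
  then show ?thesis using sm m bc4 by (auto simp: N_def)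
qed

text \<open>
  The point at which cluster monomials are told apart: only monomials involving the variable in
  position \<open>k\<close> have a value below \<open>1\<close>. The claim is phrased through \<open>Y m \<noteq> Y k\<close> and not through
  \<open>m \<noteq> k\<close> because in finite type the same variable recurs.
\<close>

theorem half_specialization:
  assumes bc: "b > 0" "c > 0" "b * c \<le> 4"
  obtains s :: "int \<Rightarrow> rat" where "exchange_seq b c s" "\<And>m. s m > 0" "s k = 1 / 2" "s (k + 1) = 1"
    "\<And>(Y :: int \<Rightarrow> 'a::field) m. exchange_seq b c Y \<Longrightarrow> Y m \<noteq> Y k \<Longrightarrow> s m \<ge> 1"
proof -
  define b' c' where "b' = exch_exp b c k" and "c' = exch_exp b c (k - 1)"
  have bc': "b' > 0" "c' > 0" "b' * c' = b * c"
    using bc exch_exp_shift_mult[of b c k] by (auto simp: b'_def c'_def exch_exp_def)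
  obtain s :: "int \<Rightarrow> rat" where s: "exchange_seq b c s" "\<And>m. s m > 0" "s k = 1 / 2" "s (k + 1) = 1"
    using exchange_seq_exists[of "1 / 2 :: rat" 1 b c k] half_gt_zero[OF zero_less_one] zero_less_one
    by metis
  have sh: "exchange_seq b' c' (\<lambda>m. s (m + (k - 1)))"
    using exchange_seq_shift[OF s(1), of "k - 1"] by (simp add: b'_def c'_def)
  have "s m \<ge> 1" if Y: "exchange_seq b c Y" "Y m \<noteq> Y k" for Y :: "int \<Rightarrow> 'a" and m
  proof -
    have "finite_period b' c' = finite_period b c" by (simp add: finite_period_def bc')
    then have "s m \<ge> 1 \<or> (b * c < 4 \<and> (\<exists>j. m = k + j * finite_period b c)) \<or> m = k"
      using half_specialization_at_one[OF sh, of "m - k + 1"] s bc bc' by (simp add: algebra_simps)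
    then show ?thesis
      using exchange_seq_period_multiple[OF Y(1) bc(1,2)] Y(2) by auto
  qed
  with s that show thesis by blast
qed

section \<open>Laurent polynomials with non-negative coefficients\<close>

text \<open>
  Adding one monomial at a time makes membership provable by closure properties, without any
  bookkeeping of coefficients.
\<close>

inductive_set pos_laurent :: "'a::field \<Rightarrow> 'a \<Rightarrow> 'a set" for u v where
  zero: "0 \<in> pos_laurent u v"
| add_monomial: "x \<in> pos_laurent u v \<Longrightarrow> x + u powi i * v powi j \<in> pos_laurent u v"

lemma pos_laurent_monomial:
  fixes u v :: "'a::field"
  shows "u powi i * v powi j \<in> pos_laurent u v"
  using pos_laurent.add_monomial[OF pos_laurent.zero, of u i v j] by simp

lemma pos_laurent_add:
  assumes "x \<in> pos_laurent u v" "y \<in> pos_laurent u v"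
  shows "x + y \<in> pos_laurent u v"
  using assms(2)
proof induction
  case (add_monomial y i j)
  then show ?case using pos_laurent.add_monomial[of "x + y" u v i j] by (simp add: add.assoc)
qed (use assms(1) in simp)

lemma pos_laurent_sym: "pos_laurent u v = pos_laurent v u"
proof -
  have "x \<in> pos_laurent v u" if "x \<in> pos_laurent u v" for u v x :: 'a
    using that
  proof induction
    case (add_monomial x i j)
    then show ?case using pos_laurent.add_monomial[of x v u j i] by (simp add: mult.commute)
  qed (rule pos_laurent.zero)
  then show ?thesis by blast
qed

lemma pos_laurent_1: "1 \<in> pos_laurent u v"
  using pos_laurent_monomial[of u 0 v 0] by simp

lemma pos_laurent_numeral: "numeral k \<in> pos_laurent u v"
proof -
  have "of_nat n \<in> pos_laurent u v" for n
    by (induction n) (auto intro: pos_laurent.zero pos_laurent_add pos_laurent_1)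
  from this[of "numeral k"] show ?thesis by simp
qed

lemma pos_laurent_vars: "u \<in> pos_laurent u v" "v \<in> pos_laurent u v"
  using pos_laurent_monomial[of u 1 v 0] pos_laurent_monomial[of u 0 v 1] by simp_all

lemma pos_laurent_mult:
  assumes uv: "u \<noteq> 0" "v \<noteq> 0" and "x \<in> pos_laurent u v" "y \<in> pos_laurent u v"
  shows "x * y \<in> pos_laurent u v"
proof -
  have mono: "x * (u powi i * v powi j) \<in> pos_laurent u v" if "x \<in> pos_laurent u v" for x i j
    using that
  proof induction
    case (add_monomial x k l)
    have "(x + u powi k * v powi l) * (u powi i * v powi j) =
        x * (u powi i * v powi j) + u powi (k + i) * v powi (l + j)"
      using uv by (simp add: power_int_add algebra_simps)
    then show ?case using add_monomial.IH pos_laurent.add_monomial by metis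
  qed (simp add: pos_laurent.zero)
  show ?thesis using assms(4)
  proof induction
    case (add_monomial y k l)
    then show ?case using mono[OF assms(3), of k l] by (simp add: ring_distribs pos_laurent_add)
  qed (simp add: pos_laurent.zero)
qed

lemma pos_laurent_power:
  assumes "u \<noteq> 0" "v \<noteq> 0" "x \<in> pos_laurent u v"
  shows "x ^ n \<in> pos_laurent u v"
  by (induction n) (use assms in \<open>auto intro: pos_laurent_1 pos_laurent_mult\<close>)

definition laurent_units :: "'a::field \<Rightarrow> 'a \<Rightarrow> 'a set" where
  "laurent_units u v = {y. 1 / y \<in> pos_laurent u v}"

lemma pos_laurent_divide:
  assumes "u \<noteq> 0" "v \<noteq> 0" "x \<in> pos_laurent u v" "y \<in> laurent_units u v"
  shows "x / y \<in> pos_laurent u v"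
  using pos_laurent_mult[of u v x "1 / y"] assms by (simp add: laurent_units_def)

lemma laurent_units_vars: "u \<in> laurent_units u v" "v \<in> laurent_units u v"
  using pos_laurent_monomial[of u "-1" v 0] pos_laurent_monomial[of u 0 v "-1"]
  by (simp_all add: laurent_units_def power_int_minus divide_inverse)

lemma laurent_units_mult:
  assumes "u \<noteq> 0" "v \<noteq> 0" "x \<in> laurent_units u v" "y \<in> laurent_units u v"
  shows "x * y \<in> laurent_units u v"
  using pos_laurent_mult[of u v "1 / x" "1 / y"] assms by (simp add: laurent_units_def)

lemma laurent_units_power:
  assumes "u \<noteq> 0" "v \<noteq> 0" "x \<in> laurent_units u v"
  shows "x ^ n \<in> laurent_units u v"
  using pos_laurent_power[of u v "1 / x" n] assms by (simp add: laurent_units_def power_one_over)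

lemmas pos_laurent_intros = pos_laurent_1 pos_laurent_numeral pos_laurent_vars pos_laurent_add
  pos_laurent_mult pos_laurent_power pos_laurent_divide
  laurent_units_vars laurent_units_mult laurent_units_power

text \<open>
  Membership of \<open>x - m\<close> expresses that the monomial \<open>m\<close> occurs in \<open>x\<close>. The two rules below track
  one such term through products and sums.
\<close>

lemma pos_laurent_term_mult:
  assumes uv: "u \<noteq> 0" "v \<noteq> 0" and "x - m \<in> pos_laurent u v" "y - k \<in> pos_laurent u v"
    and "m \<in> pos_laurent u v" "k \<in> pos_laurent u v"
  shows "x * y - m * k \<in> pos_laurent u v"
proof -
  have "x * y - m * k = (x - m) * (y - k) + m * (y - k) + k * (x - m)" by algebra
  then show ?thesis using assms by (simp add: pos_laurent_intros)
qed

lemma pos_laurent_term_add: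
  assumes "x - m \<in> pos_laurent u v" "y \<in> pos_laurent u v"
  shows "x + y - m \<in> pos_laurent u v"
proof -
  have "x + y - m = (x - m) + y" by simp
  then show ?thesis using pos_laurent_add[OF assms] by (simp only:)
qed

section \<open>The invariant of an affine exchange sequence\<close>

text \<open>
  The element whose denominator is the primitive imaginary root \<open>\<delta>\<close>, namely \<open>(1, 1)\<close>, \<open>(1, 2)\<close>
  and \<open>(2, 1)\<close> for \<open>(b, c) = (2, 2)\<close>, \<open>(1, 4)\<close> and \<open>(4, 1)\<close>. It takes the same value in all
  clusters and is the coefficient of the linear recurrence satisfied by the cluster variables
  (by those with even index only if \<open>b = 1\<close>, and with odd index only if \<open>b = 4\<close>).
\<close>

definition delta_elem :: "nat \<Rightarrow> nat \<Rightarrow> 'a::field \<Rightarrow> 'a \<Rightarrow> 'a" where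
  "delta_elem b c u v =
    (if b = 2 then (u ^ 2 + v ^ 2 + 1) / (u * v)
     else if b = 1 then ((u + 1) ^ 2 + v ^ 4) / (u * v ^ 2)
     else ((v + 1) ^ 2 + u ^ 4) / (u ^ 2 * v))"

text \<open>
  By the exchange relation \<open>Y 1 * Y 3 = Y 2 ^ c + 1\<close> the numerator of the invariant is divisible by
  a power of \<open>Y 1\<close>. What remains is symmetric in \<open>Y 1\<close> and \<open>Y 3\<close>, hence also equals the
  expression for the next cluster.
\<close>

lemma delta_elem_via_neighbours:
  assumes Y: "exchange_seq b c Y" and bc: "b * c = 4"
  shows "delta_elem b c (Y 1) (Y 2) =
      (if b = 2 then (Y 1 + Y 3) / Y 2
       else if b = 1 then (Y 1 + Y 3 + 2) / Y 2 ^ 2 else (Y 1 ^ 2 + Y 3 ^ 2) / Y 2)" (is ?A)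
    and "delta_elem c b (Y 2) (Y 3) = delta_elem b c (Y 1) (Y 2)" (is ?B)
proof -
  define u v w where "u = Y 1" and "v = Y 2" and "w = Y 3"
  have nz: "u \<noteq> 0" "v \<noteq> 0" "w \<noteq> 0"
    using Y by (auto simp: u_def v_def w_def exchange_seq_nonzero)
  have "u * w = v ^ c + 1"
    using exchange_seq_rel[OF Y, of 2] by (simp add: u_def v_def w_def exch_exp_def)
  then have vc: "v ^ c = u * w - 1" by simp
  have "?A \<and> ?B"
    using bc
  proof (cases rule: affine_type_cases)
    case 1
    have v2: "v ^ 2 = u * w - 1" using vc 1 by simp
    have "u ^ 2 + v ^ 2 + 1 = u * (u + w)" "v ^ 2 + w ^ 2 + 1 = w * (u + w)"
      unfolding v2 by (simp_all add: power2_eq_square algebra_simps)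
    then show ?thesis using 1 nz by (simp add: delta_elem_def flip: u_def v_def w_def)
  next
    case 2
    have v4: "v ^ 4 = u * w - 1" using vc 2 by simp
    have "(u + 1) ^ 2 + v ^ 4 = u * (u + w + 2)" "(w + 1) ^ 2 + v ^ 4 = w * (u + w + 2)"
      unfolding v4 by (simp_all add: power2_eq_square algebra_simps)
    then show ?thesis using 2 nz by (simp add: delta_elem_def flip: u_def v_def w_def)
  next
    case 3
    have v1: "v + 1 = u * w" using vc 3 by simp
    have "(v + 1) ^ 2 + u ^ 4 = u ^ 2 * (u ^ 2 + w ^ 2)" "(v + 1) ^ 2 + w ^ 4 = w ^ 2 * (u ^ 2 + w ^ 2)"
      unfolding v1 by algebra+
    then show ?thesis using 3 nz by (simp add: delta_elem_def mult.commute[of v] flip: u_def v_def w_def)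
  qed
  then show ?A ?B by auto
qed

lemma delta_elem_shift:
  assumes Y: "exchange_seq b c Y" and bc: "b * c = 4"
  shows "delta_elem (exch_exp b c m) (exch_exp b c (m - 1)) (Y m) (Y (m + 1)) =
    delta_elem b c (Y 1) (Y 2)"
proof -
  define f where "f m = delta_elem (exch_exp b c m) (exch_exp b c (m - 1)) (Y m) (Y (m + 1))" for m
  have step: "f (m + 1) = f m" for m
  proof -
    have "exchange_seq (exch_exp b c m) (exch_exp b c (m - 1)) (\<lambda>j. Y (j + (m - 1)))"
      using exchange_seq_shift[OF Y, of "m - 1"] by simp
    from delta_elem_via_neighbours(2)[OF this]
    show ?thesis using bc exch_exp_shift_mult[of b c m]
      by (simp add: f_def mult.commute exch_exp_def algebra_simps)
  qed
  have "f m = f 1"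
  proof (cases "m \<ge> 1")
    case True
    then show ?thesis by (induction m rule: int_ge_induct) (use step in auto)
  next
    case False
    then have "m \<le> 1" by simp
    then show ?thesis
    proof (induction m rule: int_le_induct)
      case (step i)
      have "f i = f (i - 1)" using \<open>\<And>m. f (m + 1) = f m\<close>[of "i - 1"] by simp
      then show ?case using step by simp
    qed simp
  qed
  then show ?thesis by (simp add: f_def exch_exp_def)
qed

lemma delta_elem_swap:
  assumes "b * c = 4"
  shows "delta_elem b c u v = delta_elem c b v u"
  using assms
  by (cases rule: affine_type_cases) (auto simp: delta_elem_def algebra_simps)

lemma affine_recurrence_22:
  assumes Y: "exchange_seq 2 2 Y"
  shows "Y (m + 1) + Y (m - 1) = delta_elem 2 2 (Y 1) (Y 2) * Y m"
proof -
  have "exchange_seq 2 2 (\<lambda>j. Y (j + (m - 2)))"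
    using exchange_seq_shift[OF Y, of "m - 2"] by (simp add: exch_exp_def)
  from delta_elem_via_neighbours(1)[OF this] delta_elem_shift[OF Y, of "m - 1"]
  show ?thesis using exchange_seq_nonzero[OF Y, of m]
    by (simp add: exch_exp_def field_simps)
qed

lemma affine_recurrence_14:
  assumes Y: "exchange_seq 1 4 Y" and "even m"
  shows "Y (m + 2) + Y (m - 2) = delta_elem 1 4 (Y 1) (Y 2) * Y m"
proof -
  have sh: "exchange_seq 1 4 (\<lambda>j. Y (j + (m - 2)))"
    using exchange_seq_shift[OF Y, of "m - 2"] \<open>even m\<close> by (simp add: exch_exp_def)
  have nz: "Y m \<noteq> 0" by (rule exchange_seq_nonzero[OF Y])
  have "delta_elem 1 4 (Y 1) (Y 2) = (Y (m - 1) + Y (m + 1) + 2) / Y m ^ 2"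
    using delta_elem_via_neighbours(1)[OF sh] delta_elem_shift[OF Y, of "m - 1"] \<open>even m\<close>
    by (simp add: exch_exp_def algebra_simps)
  moreover have "Y (m + 2) = (Y (m + 1) + 1) / Y m" "Y (m - 2) = (Y (m - 1) + 1) / Y m"
    using exchange_seq_near(2,5)[OF sh] by (simp_all add: algebra_simps)
  ultimately show ?thesis using nz by (simp add: power2_eq_square flip: add_divide_distrib)
qed

text \<open>
  If \<open>z = \<lambda> + \<lambda>\<inverse>\<close> then \<open>cheb z n = \<lambda> ^ n + (\<lambda>\<inverse>) ^ n\<close>; this is
  \<open>2 * T n (z / 2)\<close> for the Chebyshev polynomials \<open>T n\<close> of the first kind.
\<close>

fun cheb :: "'a::field \<Rightarrow> nat \<Rightarrow> 'a" where
  "cheb z 0 = 2"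
| "cheb z (Suc 0) = z"
| "cheb z (Suc (Suc n)) = z * cheb z (Suc n) - cheb z n"

lemma cheb_linear_recurrence:
  fixes w :: "int \<Rightarrow> 'a::field"
  assumes rec: "\<And>n. w (n + 1) + w (n - 1) = z * w n"
  shows "w (k + int n) + w (k - int n) = cheb z n * w k"
proof (induction n rule: induct_nat_012)
  case 1
  then show ?case using rec[of k] by simp
next
  case (ge2 n)
  have "w (k + int (Suc (Suc n))) = z * w (k + int (Suc n)) - w (k + int n)"
    using rec[of "k + int (Suc n)"] by (simp add: algebra_simps)
  moreover have "w (k - int (Suc (Suc n))) = z * w (k - int (Suc n)) - w (k - int n)"
    using rec[of "k - int (Suc n)"] by (simp add: algebra_simps)
  ultimately have "w (k + int (Suc (Suc n))) + w (k - int (Suc (Suc n))) =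
      z * (w (k + int (Suc n)) + w (k - int (Suc n))) - (w (k + int n) + w (k - int n))"
    by (simp add: algebra_simps)
  then show ?case unfolding ge2 by (simp add: algebra_simps)
qed simp

section \<open>Positivity along a linear recurrence\<close>

text \<open>
  The quotients \<open>w (n + 1) / w 1\<close> are the lower right entries of the powers of the matrix with
  rows \<open>(w 0 / w 1, \<kappa>)\<close> and \<open>(1, w 2 / w 1)\<close>, which has determinant \<open>1\<close> and trace \<open>z\<close>. Passing
  from the recurrence to this matrix removes the minus sign, so positivity of the four entries
  suffices for positivity of all powers. The element \<open>q\<close> is the lower left entry.
\<close>

lemma linear_recurrence_step:
  fixes w :: "int \<Rightarrow> 'a::field"
  assumes rec: "w (n + 2) + w n = z * w (n + 1)" "w 2 + w 0 = z * w 1" and nz: "w 1 \<noteq> 0"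
    and \<kappa>: "\<kappa> = (w 0 * w 2 - w 1 ^ 2) / w 1 ^ 2"
    and q: "w (n + 1) / w 1 = \<kappa> * q + (w 2 / w 1) * (w n / w 1)"
  shows "w (n + 2) / w 1 = \<kappa> * ((w 0 / w 1) * q + w n / w 1) + (w 2 / w 1) * (w (n + 1) / w 1)"
proof -
  define a d s t where "a = w 0 / w 1" and "d = w 2 / w 1" and "s = w n / w 1" and "t = w (n + 1) / w 1"
  have k: "\<kappa> = a * d - 1" unfolding \<kappa> a_def d_def using nz by (simp add: field_simps power2_eq_square)
  have z: "z = a + d" using rec(2) nz unfolding a_def d_def by (simp add: field_simps)
  have "w (n + 2) = z * w (n + 1) - w n" using rec(1) by (simp add: algebra_simps)
  then have "w (n + 2) / w 1 = z * t - s" by (simp add: s_def t_def diff_divide_distrib)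
  also have "\<dots> = \<kappa> * (a * q + s) + d * t"
  proof -
    have t: "t = \<kappa> * q + d * s" using q by (simp add: s_def t_def d_def)
    have "\<kappa> * (a * q + s) + d * t = a * (\<kappa> * q + d * s) + d * t - s"
      unfolding k by algebra
    then show ?thesis unfolding t[symmetric] z by algebra
  qed
  finally show ?thesis by (simp add: a_def d_def s_def t_def)
qed

lemma linear_recurrence_pos:
  fixes w :: "int \<Rightarrow> 'a::field"
  assumes uv: "u \<noteq> 0" "v \<noteq> 0" and rec: "\<And>n. w (n + 1) + w (n - 1) = z * w n" and nz: "w 1 \<noteq> 0"
    and \<kappa>: "\<kappa> = (w 0 * w 2 - w 1 ^ 2) / w 1 ^ 2"
    and pos: "w 0 / w 1 \<in> pos_laurent u v" "w 2 / w 1 \<in> pos_laurent u v" "\<kappa> \<in> pos_laurent u v"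
  shows "w (int n + 1) / w 1 \<in> pos_laurent u v"
proof -
  have "w (int n + 1) / w 1 \<in> pos_laurent u v \<and> (\<exists>q\<in>pos_laurent u v.
    w (int n + 2) / w 1 = \<kappa> * q + (w 2 / w 1) * (w (int n + 1) / w 1))"
  proof (induction n)
    case 0
    show ?case using nz by (auto intro!: bexI[of _ 0] pos_laurent_1 pos_laurent.zero)
  next
    case (Suc n)
    then obtain q where q: "q \<in> pos_laurent u v"
      "w (int n + 2) / w 1 = \<kappa> * q + (w 2 / w 1) * (w (int n + 1) / w 1)" by blast
    then have q2: "w (int n + 1 + 1) / w 1 = \<kappa> * q + (w 2 / w 1) * (w (int n + 1) / w 1)"
      by (simp add: add.assoc)
    have "w (int n + 1 + 2) / w 1 = \<kappa> * ((w 0 / w 1) * q + w (int n + 1) / w 1)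
        + (w 2 / w 1) * (w (int n + 1 + 1) / w 1)"
      by (rule linear_recurrence_step[OF _ _ nz \<kappa> q2, of z])
        (use rec[of "int n + 2"] rec[of 1] in \<open>simp_all add: add.commute\<close>)
    moreover have "(w 0 / w 1) * q + w (int n + 1) / w 1 \<in> pos_laurent u v"
      by (intro pos_laurent_add pos_laurent_mult) (use Suc q pos uv in auto)
    moreover have "w (int n + 2) / w 1 \<in> pos_laurent u v"
    proof -
      have "\<kappa> * q + (w 2 / w 1) * (w (int n + 1) / w 1) \<in> pos_laurent u v"
        by (intro pos_laurent_add pos_laurent_mult) (use Suc q(1) pos uv in auto)
      then show ?thesis by (simp only: q(2))
    qed
    moreover have "int (Suc n) + 1 = int n + 2" "int (Suc n) + 2 = int n + 1 + 2"
      "int n + 1 + 1 = int n + 2" by simp_all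
    ultimately show ?case by metis
  qed
  then show ?thesis ..
qed

text \<open>
  A product \<open>w (n + 1) * w (n + 2)\<close> of consecutive terms contains the constant term \<open>1\<close>: the first
  factor contains \<open>w 1 * \<mu> ^ n\<close>, coming from the path through the lower right entry only, and the
  second one contains its inverse, coming from the path that uses the upper left entry in all but
  its first and last step.
\<close>

lemma linear_recurrence_product_pos:
  fixes w :: "int \<Rightarrow> 'a::field"
  assumes uv: "u \<noteq> 0" "v \<noteq> 0" and rec: "\<And>n. w (n + 1) + w (n - 1) = z * w n" and nz: "w 1 \<noteq> 0"
    and \<kappa>: "\<kappa> = (w 0 * w 2 - w 1 ^ 2) / w 1 ^ 2"
    and w1: "w 1 \<in> pos_laurent u v" "1 / w 1 \<in> pos_laurent u v"
    and \<mu>: "\<mu> \<noteq> 0" "\<mu> \<in> pos_laurent u v" "1 / \<mu> \<in> pos_laurent u v"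
    and pos: "w 0 / w 1 - 1 / \<mu> \<in> pos_laurent u v" "w 2 / w 1 - \<mu> \<in> pos_laurent u v"
      "\<kappa> - 1 / \<mu> / w 1 ^ 2 \<in> pos_laurent u v"
  shows "w (int n + 2) * w (int n + 3) - 1 \<in> pos_laurent u v"
proof -
  let ?P = "pos_laurent u v"
  have m2: "1 / \<mu> / w 1 ^ 2 \<in> ?P" using pos_laurent_mult[OF uv \<mu>(3) pos_laurent_power[OF uv w1(2), of 2]]
    by (simp add: power_one_over)
  have pos': "w 0 / w 1 \<in> ?P" "w 2 / w 1 \<in> ?P" "\<kappa> \<in> ?P"
    using pos_laurent_add[OF pos(1) \<mu>(3)] pos_laurent_add[OF pos(2) \<mu>(2)] pos_laurent_add[OF pos(3) m2]
    by simp_all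
  have s: "w (int n + 1) / w 1 \<in> ?P" for n
    by (rule linear_recurrence_pos[OF uv rec nz \<kappa> pos'])
  have \<mu>n: "\<mu> ^ n \<in> ?P" "1 / \<mu> ^ n \<in> ?P" for n
    using pos_laurent_power[OF uv \<mu>(2), of n] pos_laurent_power[OF uv \<mu>(3), of n]
    by (simp_all add: power_one_over)
  have "w (int n + 2) / w 1 - \<mu> ^ (n + 1) \<in> ?P \<and> (\<exists>q\<in>?P. q - 1 / \<mu> ^ n \<in> ?P \<and>
    w (int n + 3) / w 1 = \<kappa> * q + (w 2 / w 1) * (w (int n + 2) / w 1))" for n
  proof (induction n)
    case 0
    have "w (1 + 2) / w 1 = \<kappa> * ((w 0 / w 1) * 0 + w 1 / w 1) + (w 2 / w 1) * (w (1 + 1) / w 1)"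
      by (rule linear_recurrence_step[OF _ _ nz \<kappa>, of _ z])
        (use rec[of 2] rec[of 1] nz in \<open>simp_all add: add.commute\<close>)
    then show ?case using nz pos by (auto intro!: bexI[of _ 1] pos_laurent_1 pos_laurent.zero)
  next
    case (Suc n)
    then obtain q where q: "q \<in> ?P" "q - 1 / \<mu> ^ n \<in> ?P"
      "w (int n + 3) / w 1 = \<kappa> * q + (w 2 / w 1) * (w (int n + 2) / w 1)" by blast
    then have q3: "w (int n + 2 + 1) / w 1 = \<kappa> * q + (w 2 / w 1) * (w (int n + 2) / w 1)"
      by (simp add: add.assoc)
    define q' where "q' = (w 0 / w 1) * q + w (int n + 2) / w 1"
    have "w (int n + 2 + 2) / w 1 = \<kappa> * q' + (w 2 / w 1) * (w (int n + 2 + 1) / w 1)"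
      unfolding q'_def
      by (rule linear_recurrence_step[OF _ _ nz \<kappa> q3, of z])
        (use rec[of "int n + 3"] rec[of 1] in \<open>simp_all add: add.commute\<close>)
    moreover have s2: "w (int n + 2) / w 1 \<in> ?P" using s[of "n + 1"] by (simp add: add.commute)
    moreover have "q' \<in> ?P" unfolding q'_def
      by (intro pos_laurent_add pos_laurent_mult) (use s2 q pos' uv in auto)
    moreover have "q' - 1 / \<mu> ^ Suc n \<in> ?P"
      unfolding q'_def using pos_laurent_term_add[OF pos_laurent_term_mult[OF uv pos(1) q(2) \<mu>(3) \<mu>n(2)] s2]
      by simp
    moreover have "w (int n + 3) / w 1 - \<mu> ^ (Suc n + 1) \<in> ?P"
    proof -
      have "(w 2 / w 1) * (w (int n + 2) / w 1) + \<kappa> * q - \<mu> * \<mu> ^ (n + 1) \<in> ?P"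
        by (intro pos_laurent_term_add pos_laurent_term_mult)
          (use Suc pos pos' uv \<mu> \<mu>n(1)[of "n + 1"] q pos_laurent_mult[OF uv] in simp_all)
      then show ?thesis unfolding q(3) by (simp add: add.commute)
    qed
    moreover have "int (Suc n) + 2 = int n + 3" "int (Suc n) + 3 = int n + 2 + 2"
      "int n + 2 + 1 = int n + 3" by simp_all
    ultimately show ?case by metis
  qed
  then obtain q where q: "q \<in> ?P" "q - 1 / \<mu> ^ n \<in> ?P" "w (int n + 2) / w 1 - \<mu> ^ (n + 1) \<in> ?P"
      "w (int n + 3) / w 1 = \<kappa> * q + (w 2 / w 1) * (w (int n + 2) / w 1)" by blast
  have s2: "w (int n + 2) / w 1 \<in> ?P" using s[of "n + 1"] by (simp add: add.commute)
  have "w (int n + 3) / w 1 - 1 / \<mu> / w 1 ^ 2 * (1 / \<mu> ^ n) \<in> ?P"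
    unfolding q(4)
    by (rule pos_laurent_term_add[OF pos_laurent_term_mult[OF uv pos(3) q(2) m2 \<mu>n(2)]
        pos_laurent_mult[OF uv pos'(2) s2]])
  then have "w (int n + 2) / w 1 * (w (int n + 3) / w 1) - \<mu> ^ (n + 1) * (1 / \<mu> / w 1 ^ 2 * (1 / \<mu> ^ n)) \<in> ?P"
    by (rule pos_laurent_term_mult[OF uv q(3) _ \<mu>n(1) pos_laurent_mult[OF uv m2 \<mu>n(2)]])
  then have "w 1 ^ 2 * (w (int n + 2) / w 1 * (w (int n + 3) / w 1) - \<mu> ^ (n + 1) * (1 / \<mu> / w 1 ^ 2 * (1 / \<mu> ^ n))) \<in> ?P"
    by (intro pos_laurent_mult pos_laurent_power uv w1) 
  also have "w 1 ^ 2 * (w (int n + 2) / w 1 * (w (int n + 3) / w 1) - \<mu> ^ (n + 1) * (1 / \<mu> / w 1 ^ 2 * (1 / \<mu> ^ n))) =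
     w (int n + 2) * w (int n + 3) - 1"
    using nz \<mu>(1) by (simp add: field_simps power2_eq_square)
  finally show ?thesis .
qed

section \<open>Positivity of cluster variables in every cluster\<close>

text \<open>
  Up to two steps away from the cluster, the exchange relation divides by \<open>Y 1\<close> and \<open>Y 2\<close> only.
  This accounts for all variables in types \<open>A2\<close> and \<open>B2\<close> and for six of the eight in type \<open>G2\<close>.
\<close>

lemma positive_near:
  assumes Y: "exchange_seq b c Y" and k: "k \<in> {-1..4}"
  shows "Y k \<in> pos_laurent (Y 1) (Y 2)"
proof -
  have nz: "Y 1 \<noteq> 0" "Y 2 \<noteq> 0" using exchange_seq_nonzero[OF Y] by auto
  note near = exchange_seq_near[OF Y]
  have "Y 3 \<in> pos_laurent (Y 1) (Y 2)" "Y 0 \<in> pos_laurent (Y 1) (Y 2)"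
    unfolding near by (intro pos_laurent_intros nz)+
  then have "Y 4 \<in> pos_laurent (Y 1) (Y 2)" "Y (-1) \<in> pos_laurent (Y 1) (Y 2)"
    unfolding near(2,6) by (auto intro!: pos_laurent_intros nz)
  moreover from k have "k = -1 \<or> k = 0 \<or> k = 1 \<or> k = 2 \<or> k = 3 \<or> k = 4" by auto
  ultimately show ?thesis using \<open>Y 3 \<in> _\<close> \<open>Y 0 \<in> _\<close> by (auto intro: pos_laurent_vars)
qed

lemma positive_finite:
  assumes Y: "exchange_seq 1 c Y" and c: "c \<in> {1, 2, 3}"
  shows "Y k \<in> pos_laurent (Y 1) (Y 2)"
proof -
  have nz: "Y 1 \<noteq> 0" "Y 2 \<noteq> 0" using exchange_seq_nonzero[OF Y] by auto
  define N where "N = finite_period 1 c"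
  define r where "r = (k + 2) mod N - 2"
  have k: "k = r + ((k + 2) div N) * N" by (simp add: r_def minus_mod_eq_div_mult [symmetric])
  have kr: "Y k = Y r" using exchange_seq_period_multiple[OF Y, of r "(k + 2) div N"] c k
    by (auto simp: N_def)
  have "N = 5 \<or> N = 6 \<or> (N = 8 \<and> c = 3)" using c by (auto simp: N_def finite_period_def)
  then have "r \<in> {-2..5}" by (auto simp: r_def)
  moreover have "Y (-2) \<in> pos_laurent (Y 1) (Y 2)"
  proof (cases "c = 3")
    case True
    then show ?thesis using near_values_G2(2)[of Y] Y by (auto intro!: pos_laurent_intros nz)
  next
    case False
    then have "-2 + N \<in> {-1..4}" using c by (auto simp: N_def finite_period_def)
    with positive_near[OF Y this] exchange_seq_period[OF Y, of "-2"] c show ?thesis by (auto simp: N_def)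
  qed
  moreover have "Y 5 \<in> pos_laurent (Y 1) (Y 2)"
  proof (cases "c = 3")
    case True
    then show ?thesis using near_values_G2(1)[of Y] Y by (auto intro!: pos_laurent_intros nz)
  next
    case False
    then have "5 - N \<in> {-1..4}" using c by (auto simp: N_def finite_period_def)
    with positive_near[OF Y this] exchange_seq_period[OF Y, of "5 - N"] c show ?thesis by (auto simp: N_def)
  qed
  ultimately have "Y r \<in> pos_laurent (Y 1) (Y 2)"
    using positive_near[OF Y, of r] by (cases "r = -2 \<or> r = 5") auto
  then show ?thesis by (simp add: kr)
qed

lemma positive_affine_22:
  assumes Y: "exchange_seq 2 2 Y"
  shows "Y k / Y 2 \<in> pos_laurent (Y 1) (Y 2)"
proof -
  define u v where "u = Y 1" and "v = Y 2"
  have nz: "u \<noteq> 0" "v \<noteq> 0" using exchange_seq_nonzero[OF Y] by (auto simp: u_def v_def)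
  have Y3: "Y 3 = (v ^ 2 + 1) / u" using exchange_seq_near(1)[OF Y] by (simp add: u_def v_def)
  define z where "z = delta_elem 2 2 u v"
  have rec: "Y (n + 1) + Y (n - 1) = z * Y n" for n
    using affine_recurrence_22[OF Y] by (simp add: z_def u_def v_def)
  have p3: "Y 3 / v \<in> pos_laurent u v" and p1: "u / v \<in> pos_laurent u v"
    unfolding Y3 by (auto intro!: pos_laurent_intros nz)
  have "(u * Y 3 - v ^ 2) / v ^ 2 = 1 / v ^ 2" unfolding Y3 using nz by simp
  moreover have "1 / v ^ 2 \<in> pos_laurent u v" by (intro pos_laurent_intros nz)
  ultimately have pk: "(u * Y 3 - v ^ 2) / v ^ 2 \<in> pos_laurent u v" by (simp only:)
  have rec1: "Y (n + 1 + 1) + Y (n - 1 + 1) = z * Y (n + 1)" for n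
    using rec[of "n + 1"] by simp
  have up: "Y (int n + 2) / v \<in> pos_laurent u v" for n
    using linear_recurrence_pos[OF nz, of "\<lambda>n. Y (n + 1)" z _ n, OF rec1 _ refl] p1 p3 pk nz
    by (simp add: u_def v_def add.commute)
  have rec2: "Y (3 - (n + 1)) + Y (3 - (n - 1)) = z * Y (3 - n)" for n
    using rec[of "3 - n"] by (simp add: algebra_simps)
  have down: "Y (2 - int n) / v \<in> pos_laurent u v" for n
    using linear_recurrence_pos[OF nz, of "\<lambda>n. Y (3 - n)" z _ n, OF rec2 _ refl] p1 p3 pk nz
    by (simp add: u_def v_def mult.commute)
  show ?thesis using up[of "nat (k - 2)"] down[of "nat (2 - k)"]
    by (cases "k \<ge> 2") (auto simp: u_def v_def)
qed

text \<open>
  The variables with even index satisfy a linear recurrence. Those with odd index are of the form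
  \<open>Y (2 * k) * Y (2 * k + 2) - 1\<close>, where the subtraction cancels against a constant term of the
  product. To the right this term comes from \<open>\<mu> = v\<^sup>2 / u\<close>, to the left from \<open>\<mu> = u / v\<^sup>2\<close>.
\<close>

lemma positive_affine_14:
  assumes Y: "exchange_seq 1 4 Y"
  shows "Y (2 * k) / Y 2 \<in> pos_laurent (Y 1) (Y 2)" (is ?even)
    and "Y (2 * k + 1) \<in> pos_laurent (Y 1) (Y 2)" (is ?odd)
proof -
  define u v where "u = Y 1" and "v = Y 2"
  have nz: "u \<noteq> 0" "v \<noteq> 0" using exchange_seq_nonzero[OF Y] by (auto simp: u_def v_def)
  note near = exchange_seq_near[OF Y, folded u_def v_def]
  define z where "z = delta_elem 1 4 u v"
  have z: "z = u / v ^ 2 + v ^ 2 / u + (2 / v ^ 2 + 1 / (u * v ^ 2))"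
    using nz by (simp add: z_def delta_elem_def field_simps power2_eq_square power4_eq_xxxx)
  have rec: "Y (2 * (n + 1)) + Y (2 * (n - 1)) = z * Y (2 * n)" for n
    using affine_recurrence_14[OF Y, of "2 * n"] by (simp add: z_def u_def v_def algebra_simps)
  have y0: "Y 0 / v = u / v ^ 2 + 1 / v ^ 2" and y4: "Y 4 / v = v ^ 2 / u + (1 / v ^ 2 + 1 / (u * v ^ 2))"
    unfolding near(2,5) near(1) using nz by (simp_all add: field_simps power2_eq_square power4_eq_xxxx)
  have k: "(Y 0 * Y 4 - v ^ 2) / v ^ 2 = u / v ^ 2 / v ^ 2 + (v ^ 2 / u) / v ^ 2 + (2 / v ^ 2 + 1 / (u * v ^ 2)) / v ^ 2"
  proof -
    have "(Y 0 * Y 4 - v ^ 2) / v ^ 2 = (Y 0 / v) * (Y 4 / v) - 1"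
      using nz by (simp add: field_simps power2_eq_square)
    also have "\<dots> = u / v ^ 2 * (1 / v ^ 2) + v ^ 2 / u * (1 / v ^ 2)
        + (2 * (1 / v ^ 2) + 1 / (u * v ^ 2)) * (1 / v ^ 2)"
    proof -
      have "u / v ^ 2 * (v ^ 2 / u) = 1" "u / v ^ 2 * (1 / (u * v ^ 2)) = (1 / v ^ 2) ^ 2"
        using nz by (simp_all add: power2_eq_square)
      then show ?thesis unfolding y0 y4 by algebra
    qed
    finally show ?thesis by (simp add: add_divide_distrib)
  qed
  have p0: "Y 0 / v \<in> pos_laurent u v" and p4: "Y 4 / v \<in> pos_laurent u v"
    and pk: "(Y 0 * Y 4 - v ^ 2) / v ^ 2 \<in> pos_laurent u v"
    unfolding y0 y4 k by (auto intro!: pos_laurent_intros nz)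
  have rec2: "Y (2 * (2 - (n + 1))) + Y (2 * (2 - (n - 1))) = z * Y (2 * (2 - n))" for n
    using rec[of "2 - n"] by (simp add: algebra_simps)
  have up: "Y (2 * (int n + 1)) / v \<in> pos_laurent u v" for n
    using linear_recurrence_pos[OF nz, of "\<lambda>n. Y (2 * n)" z _ n, OF rec _ refl] p0 p4 pk nz
    by (simp add: v_def)
  have down: "Y (2 * (1 - int n)) / v \<in> pos_laurent u v" for n
    using linear_recurrence_pos[OF nz, of "\<lambda>n. Y (2 * (2 - n))" z _ n, OF rec2 _ refl] p0 p4 pk nz
    by (simp add: v_def mult.commute)
  show ?even using up[of "nat (k - 1)"] down[of "nat (1 - k)"]
    by (cases "k \<ge> 1") (auto simp: u_def v_def)
  have odd: "Y (2 * n + 1) = Y (2 * n) * Y (2 * n + 2) - 1" for n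
    using exchange_seq_rel[OF Y, of "2 * n + 1"] by (simp add: exch_exp_def add.commute)
  have up': "Y (2 * int n + 5) \<in> pos_laurent u v" for n
  proof -
    have "Y (2 * (int n + 2)) * Y (2 * (int n + 3)) - 1 \<in> pos_laurent u v"
      by (rule linear_recurrence_product_pos[OF nz, of "\<lambda>n. Y (2 * n)" z "(Y 0 * Y 4 - v ^ 2) / v ^ 2" "v ^ 2 / u"])
        (use nz rec in \<open>auto simp: y0 y4 k simp flip: v_def intro!: pos_laurent_intros\<close>)
    moreover have "2 * (int n + 2) + 1 = 2 * int n + 5" "2 * (int n + 2) + 2 = 2 * (int n + 3)"
      by simp_all
    ultimately show ?thesis using odd[of "int n + 2"] by metis
  qed
  have down': "Y (- 2 * int n - 1) \<in> pos_laurent u v" for n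
  proof -
    have "Y (2 * (2 - (int n + 2))) * Y (2 * (2 - (int n + 3))) - 1 \<in> pos_laurent u v"
      by (rule linear_recurrence_product_pos[OF nz, of "\<lambda>n. Y (2 * (2 - n))" z "(Y 0 * Y 4 - v ^ 2) / v ^ 2" "u / v ^ 2"])
        (use nz rec2 in \<open>auto simp: y0 y4 k mult.commute[of "Y 4" "Y 0"] simp flip: v_def intro!: pos_laurent_intros\<close>)
    moreover have "2 * (- int n - 1) + 1 = - 2 * int n - 1"
      "2 * (2 - (int n + 2)) = 2 * (- int n - 1) + 2" "2 * (2 - (int n + 3)) = 2 * (- int n - 1)"
      by simp_all
    ultimately show ?thesis using odd[of "- int n - 1"] by (metis mult.commute)
  qed
  consider "k \<ge> 2" | "k = 0 \<or> k = 1" | "k \<le> -1" by linarith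
  then show ?odd
  proof cases
    case 1
    then show ?thesis using up'[of "nat (k - 2)"] by (simp add: u_def v_def add.commute)
  next
    case 2
    then show ?thesis using positive_near[OF Y, of "2 * k + 1"] by auto
  next
    case 3
    then show ?thesis using down'[of "nat (- k - 1)"] by (simp add: u_def v_def add.commute)
  qed
qed

text \<open>
  The trace of a matrix power: it is the sum of \<open>Y (2 + n) / Y 2\<close> and \<open>Y (2 - n) / Y 2\<close>, the two
  diagonal entries.
\<close>

lemma cheb_positive_22:
  assumes Y: "exchange_seq 2 2 Y"
  shows "cheb (delta_elem 2 2 (Y 1) (Y 2)) n \<in> pos_laurent (Y 1) (Y 2)"
proof -
  have "Y (2 + int n) / Y 2 + Y (2 - int n) / Y 2 \<in> pos_laurent (Y 1) (Y 2)"
    by (intro pos_laurent_add positive_affine_22 Y)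
  moreover have "Y (2 + int n) + Y (2 - int n) = cheb (delta_elem 2 2 (Y 1) (Y 2)) n * Y 2"
    by (rule cheb_linear_recurrence) (rule affine_recurrence_22[OF Y])
  ultimately show ?thesis using exchange_seq_nonzero[OF Y, of 2]
    by (simp add: add_divide_distrib[symmetric])
qed

lemma cheb_positive_14:
  assumes Y: "exchange_seq 1 4 Y"
  shows "cheb (delta_elem 1 4 (Y 1) (Y 2)) n \<in> pos_laurent (Y 1) (Y 2)"
proof -
  have "Y (2 * (1 + int n)) / Y 2 + Y (2 * (1 - int n)) / Y 2 \<in> pos_laurent (Y 1) (Y 2)"
    by (intro pos_laurent_add positive_affine_14 Y)
  moreover have "Y (2 * (1 + int n)) + Y (2 * (1 - int n)) = cheb (delta_elem 1 4 (Y 1) (Y 2)) n * Y (2 * 1)"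
    by (rule cheb_linear_recurrence[of "\<lambda>n. Y (2 * n)"])
      (use affine_recurrence_14[OF Y, of "2 * _"] in \<open>simp add: algebra_simps\<close>)
  ultimately show ?thesis using exchange_seq_nonzero[OF Y, of 2]
    by (simp add: add_divide_distrib[symmetric])
qed

theorem exchange_seq_positive_at_one:
  assumes Y: "exchange_seq b c Y" and bc: "b > 0" "c > 0" "b * c \<le> 4"
  shows "Y k \<in> pos_laurent (Y 1) (Y 2)"
proof -
  have one: "Y k \<in> pos_laurent (Y 1) (Y 2)"
    if "exchange_seq 1 c Y" "c \<in> {1, 2, 3, 4}" for c k and Y :: "int \<Rightarrow> 'a"
  proof (cases "c = 4")
    case True
    with that have Y: "exchange_seq 1 4 Y" by simp
    have nz: "Y 1 \<noteq> 0" "Y 2 \<noteq> 0" using exchange_seq_nonzero[OF Y] by auto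
    have "Y (2 * j) \<in> pos_laurent (Y 1) (Y 2)" for j
      using pos_laurent_mult[OF nz positive_affine_14(1)[OF Y, of j] pos_laurent_vars(2)] nz by simp
    then show ?thesis using positive_affine_14(2)[OF Y]
      by (cases "even k") (auto elim!: evenE oddE)
  next
    case False
    with that show ?thesis using positive_finite[of c Y k] by auto
  qed
  show ?thesis
    using bc
  proof (cases rule: exchange_type_cases)
    case 1
    then show ?thesis using one Y by blast
  next
    case 2
    have "exchange_seq 1 b (\<lambda>m. Y (3 - m))" using exchange_seq_reflect[OF Y] 2 by simp
    from one[OF this 2(2), of "3 - k"] show ?thesis by (simp add: pos_laurent_sym)
  next
    case 3
    then have Y: "exchange_seq 2 2 Y" using Y by simp
    have nz: "Y 1 \<noteq> 0" "Y 2 \<noteq> 0" using exchange_seq_nonzero[OF Y] by auto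
    show ?thesis
      using pos_laurent_mult[OF nz positive_affine_22[OF Y, of k] pos_laurent_vars(2)] nz by simp
  qed
qed

theorem exchange_seq_positive:
  assumes Y: "exchange_seq b c Y" and bc: "b > 0" "c > 0" "b * c \<le> 4"
  shows "Y k \<in> pos_laurent (Y m) (Y (m + 1))"
  using exchange_seq_positive_at_one[OF exchange_seq_shift[OF Y, of "m - 1"], of "k - m + 1"]
    bc exch_exp_shift_mult[of b c m] by (simp add: exch_exp_pos add.commute mult.commute)

theorem cheb_delta_positive:
  assumes Y: "exchange_seq b c Y" and bc: "b * c = 4"
  shows "cheb (delta_elem b c (Y 1) (Y 2)) n \<in> pos_laurent (Y m) (Y (m + 1))"
proof -
  have one: "cheb (delta_elem b c (Y 1) (Y 2)) n \<in> pos_laurent (Y 1) (Y 2)"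
    if Y: "exchange_seq b c Y" and bc: "b * c = 4" for b c and Y :: "int \<Rightarrow> 'a"
    using bc
  proof (cases rule: affine_type_cases)
    case 1
    then show ?thesis using cheb_positive_22 Y by auto
  next
    case 2
    then show ?thesis using cheb_positive_14 Y by auto
  next
    case 3
    have "exchange_seq 1 4 (\<lambda>m. Y (3 - m))" using exchange_seq_reflect[OF Y] 3 by simp
    from cheb_positive_14[OF this, of n] show ?thesis
      using delta_elem_swap[of b c "Y 1" "Y 2"] 3 by (simp add: pos_laurent_sym)
  qed
  from one[OF exchange_seq_shift[OF Y, of "m - 1"]] delta_elem_shift[OF Y bc, of m]
  show ?thesis using bc exch_exp_shift_mult[of b c m] by (simp add: add.commute mult.commute)
qed

section \<open>Coefficients of Laurent expansions\<close>

abbreviation coeff_at :: "(int \<times> int \<Rightarrow>\<^sub>0 int) \<Rightarrow> int \<times> int \<Rightarrow> int" where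
  "coeff_at \<equiv> Poly_Mapping.lookup"

lemma laurent_eval_superset:
  assumes "finite K" "Poly_Mapping.keys f \<subseteq> K"
  shows "laurent_eval f u v = (\<Sum>k\<in>K. of_int (coeff_at f k) * u powi fst k * v powi snd k)"
  unfolding laurent_eval_def
  by (rule sum.mono_neutral_cong_left) (use assms in \<open>auto simp: in_keys_iff\<close>)

lemma laurent_eval_add: "laurent_eval (f + g) u v = laurent_eval f u v + laurent_eval g u v"
proof -
  let ?K = "Poly_Mapping.keys f \<union> Poly_Mapping.keys g"
  have "Poly_Mapping.keys (f + g) \<subseteq> ?K" by (rule Poly_Mapping.keys_add)
  then show ?thesis
    by (simp add: laurent_eval_superset[of ?K] lookup_add algebra_simps sum.distrib)
qed

lemma laurent_eval_frag_cmul: "laurent_eval (frag_cmul k f) u v = of_int k * laurent_eval f u v"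
proof -
  have "Poly_Mapping.keys (frag_cmul k f) \<subseteq> Poly_Mapping.keys f" by (auto simp: in_keys_iff)
  then show ?thesis
    by (simp add: laurent_eval_superset[of "Poly_Mapping.keys f"] sum_distrib_left algebra_simps)
qed

lemma laurent_eval_zero [simp]: "laurent_eval 0 u v = 0"
  by (simp add: laurent_eval_def)

lemma laurent_eval_uminus: "laurent_eval (- f) u v = - laurent_eval f u v"
  using laurent_eval_frag_cmul[of "-1" f u v] by simp

lemma laurent_eval_diff: "laurent_eval (f - g) u v = laurent_eval f u v - laurent_eval g u v"
  using laurent_eval_add[of f "- g" u v] by (simp add: laurent_eval_uminus)

lemma laurent_eval_sum: "laurent_eval (\<Sum>i\<in>I. f i) u v = (\<Sum>i\<in>I. laurent_eval (f i) u v)"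
  by (induction I rule: infinite_finite_induct) (simp_all add: laurent_eval_add)

lemma laurent_eval_single:
  "laurent_eval (Poly_Mapping.single (i, j) k) u v = of_int k * u powi i * v powi j"
  by (simp add: laurent_eval_superset[of "{(i, j)}"])

lemma pos_laurent_expansion:
  assumes "x \<in> pos_laurent u v"
  shows "\<exists>f. x = laurent_eval f u v \<and> (\<forall>k. coeff_at f k \<ge> 0)"
  using assms
proof induction
  case zero
  show ?case by (intro exI[of _ 0]) simp
next
  case (add_monomial x i j)
  then obtain f where "x = laurent_eval f u v" "\<forall>k. coeff_at f k \<ge> 0" by blast
  then show ?case
    by (intro exI[of _ "f + Poly_Mapping.single (i, j) 1"])
      (simp add: laurent_eval_add laurent_eval_single lookup_add lookup_single when_def)
qed

section \<open>Evaluation at positive points and uniqueness of expansions\<close>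

text \<open>
  A relation, since a fraction has a value at a point only if some representation of it has a
  denominator that does not vanish there.
\<close>

definition has_value :: "rat \<Rightarrow> rat \<Rightarrow> ratfun2 \<Rightarrow> rat \<Rightarrow> bool" where
  "has_value r1 r2 x t \<longleftrightarrow>
    (\<exists>p q. x = Fract p q \<and> poly (poly q [:r2:]) r1 \<noteq> 0 \<and>
      t = poly (poly p [:r2:]) r1 / poly (poly q [:r2:]) r1)"

lemma has_value_unique:
  assumes "has_value r1 r2 x t" "has_value r1 r2 x t'"
  shows "t = t'"
proof -
  let ?e = "\<lambda>p. poly (poly p [:r2:]) r1"
  obtain p q p' q' where x: "x = Fract p q" "x = Fract p' q'" and nz: "?e q \<noteq> 0" "?e q' \<noteq> 0"
    and t: "t = ?e p / ?e q" "t' = ?e p' / ?e q'"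
    using assms unfolding has_value_def by blast
  have "q \<noteq> 0" "q' \<noteq> 0" using nz by auto
  then have "p * q' = p' * q" using x by (simp add: eq_fract)
  then have "?e (p * q') = ?e (p' * q)" by simp
  then show ?thesis using nz by (simp add: t field_simps)
qed

lemma has_value_add:
  assumes "has_value r1 r2 x t" "has_value r1 r2 y s"
  shows "has_value r1 r2 (x + y) (t + s)"
proof -
  let ?e = "\<lambda>p. poly (poly p [:r2:]) r1"
  obtain p q p' q' where *: "x = Fract p q" "y = Fract p' q'" "?e q \<noteq> 0" "?e q' \<noteq> 0"
    "t = ?e p / ?e q" "s = ?e p' / ?e q'"
    using assms unfolding has_value_def by blast
  then have "q \<noteq> 0" "q' \<noteq> 0" by auto
  with * show ?thesis unfolding has_value_def
    by (intro exI[of _ "p * q' + p' * q"] exI[of _ "q * q'"]) (simp add: add_frac_eq)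
qed

lemma has_value_mult:
  assumes "has_value r1 r2 x t" "has_value r1 r2 y s"
  shows "has_value r1 r2 (x * y) (t * s)"
proof -
  let ?e = "\<lambda>p. poly (poly p [:r2:]) r1"
  obtain p q p' q' where *: "x = Fract p q" "y = Fract p' q'" "?e q \<noteq> 0" "?e q' \<noteq> 0"
    "t = ?e p / ?e q" "s = ?e p' / ?e q'"
    using assms unfolding has_value_def by blast
  then show ?thesis unfolding has_value_def
    by (intro exI[of _ "p * p'"] exI[of _ "q * q'"]) simp
qed

lemma has_value_inverse:
  assumes "has_value r1 r2 x t" "t \<noteq> 0"
  shows "has_value r1 r2 (inverse x) (inverse t)"
proof -
  let ?e = "\<lambda>p. poly (poly p [:r2:]) r1"
  obtain p q where *: "x = Fract p q" "?e q \<noteq> 0" "t = ?e p / ?e q"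
    using assms unfolding has_value_def by blast
  with assms(2) show ?thesis unfolding has_value_def
    by (intro exI[of _ q] exI[of _ p]) auto
qed

lemma has_value_divide:
  assumes "has_value r1 r2 x t" "has_value r1 r2 y s" "s \<noteq> 0"
  shows "has_value r1 r2 (x / y) (t / s)"
  using has_value_mult[OF assms(1) has_value_inverse[OF assms(2,3)]] by (simp add: divide_inverse)

lemma has_value_1: "has_value r1 r2 1 1"
  unfolding has_value_def by (intro exI[of _ 1]) (simp add: One_fract_def)

lemma has_value_0: "has_value r1 r2 0 0"
  unfolding has_value_def by (intro exI[of _ 0] exI[of _ 1]) (simp add: Zero_fract_def)

lemma has_value_uminus: "has_value r1 r2 x t \<Longrightarrow> has_value r1 r2 (- x) (- t)"
proof -
  have "has_value r1 r2 (- 1) (- 1)"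
    unfolding has_value_def by (intro exI[of _ "- 1"] exI[of _ 1]) (simp add: One_fract_def)
  then show "has_value r1 r2 x t \<Longrightarrow> has_value r1 r2 (- x) (- t)"
    using has_value_mult[of r1 r2 "- 1" "- 1" x t] by simp
qed

lemma has_value_of_int: "has_value r1 r2 (of_int k) (of_int k)"
proof -
  have nat: "has_value r1 r2 (of_nat n) (of_nat n)" for n
    by (induction n) (auto simp: has_value_0 has_value_1 has_value_add)
  show ?thesis
  proof (cases "k \<ge> 0")
    case True
    then show ?thesis using nat[of "nat k"] by simp
  next
    case False
    then show ?thesis using has_value_uminus[OF nat[of "nat (- k)"]] by simp
  qed
qed

lemma has_value_power: "has_value r1 r2 x t \<Longrightarrow> has_value r1 r2 (x ^ n) (t ^ n)"
  by (induction n) (auto intro: has_value_1 has_value_mult)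

lemma has_value_power_int:
  "has_value r1 r2 x t \<Longrightarrow> t \<noteq> 0 \<Longrightarrow> has_value r1 r2 (x powi n) (t powi n)"
  unfolding power_int_def by (auto intro: has_value_power has_value_inverse)

lemma has_value_sum:
  assumes "\<And>i. i \<in> I \<Longrightarrow> has_value r1 r2 (x i) (t i)"
  shows "has_value r1 r2 (\<Sum>i\<in>I. x i) (\<Sum>i\<in>I. t i)"
  using assms
  by (induction I rule: infinite_finite_induct) (auto intro: has_value_0 has_value_add)

lemma has_value_Y1: "has_value r1 r2 Y1 r1"
  unfolding has_value_def by (rule exI[of _ "[:[:0, 1:]:]"], rule exI[of _ 1]) (simp add: Y1_def to_fract_def)

lemma has_value_Y2: "has_value r1 r2 Y2 r2"
  unfolding has_value_def by (rule exI[of _ "[:0, 1:]"], rule exI[of _ 1]) (simp add: Y2_def to_fract_def)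

lemma has_value_cluster_var:
  assumes s: "exchange_seq b c s"
  shows "has_value (s 1) (s 2) (cluster_var b c m) (s m)"
  using s
proof (induction b c m rule: cluster_var.induct)
  case (1 b c m)
  note Y = exchange_seq_cluster_var[of b c]
  consider "m = 1" | "m = 2" | "m > 2" | "m < 1" by linarith
  then show ?case
  proof cases
    case 3
    have "cluster_var b c m = (cluster_var b c (m - 1) ^ exch_exp b c (m - 1) + 1) / cluster_var b c (m - 2)"
      "s m = (s (m - 1) ^ exch_exp b c (m - 1) + 1) / s (m - 2)"
      using exchange_seq_next[OF Y, of "m - 1"] exchange_seq_next[OF 1(5), of "m - 1"] by simp_all
    with 1 3 show ?thesis
      by (auto intro!: has_value_divide has_value_add has_value_power has_value_1
        simp: exchange_seq_nonzero)
  next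
    case 4
    have "cluster_var b c m = (cluster_var b c (m + 1) ^ exch_exp b c (m + 1) + 1) / cluster_var b c (m + 2)"
      "s m = (s (m + 1) ^ exch_exp b c (m + 1) + 1) / s (m + 2)"
      using exchange_seq_prev[OF Y, of "m + 1"] exchange_seq_prev[OF 1(5), of "m + 1"]
      by (simp_all add: add.assoc)
    with 1 4 show ?thesis
      by (auto intro!: has_value_divide has_value_add has_value_power has_value_1
        simp: exchange_seq_nonzero)
  qed (simp_all add: has_value_Y1 has_value_Y2)
qed

lemma has_value_laurent_eval:
  assumes s: "exchange_seq b c s"
  shows "has_value (s 1) (s 2) (laurent_eval f (cluster_var b c m) (cluster_var b c l))
    (\<Sum>k\<in>Poly_Mapping.keys f. of_int (coeff_at f k) * s m powi fst k * s l powi snd k)"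
  unfolding laurent_eval_superset[OF finite_keys subset_refl]
  by (intro has_value_sum has_value_mult has_value_of_int has_value_power_int
      has_value_cluster_var exchange_seq_nonzero[OF s] s)

text \<open>
  The substitution \<open>u = T\<close>, \<open>v = T ^ N\<close> with \<open>N\<close> large sends distinct exponent pairs to distinct
  powers of \<open>T\<close>, which reduces the statement to univariate polynomials.
\<close>

lemma laurent_sum_zero_imp_zero:
  fixes f :: "int \<times> int \<Rightarrow>\<^sub>0 int"
  assumes zero: "\<And>a d :: rat. a > 0 \<Longrightarrow> d > 0 \<Longrightarrow>
    (\<Sum>k\<in>Poly_Mapping.keys f. of_int (coeff_at f k) * a powi fst k * d powi snd k) = 0"
  shows "f = 0"
proof (rule ccontr)
  assume "f \<noteq> 0"
  then obtain k0 where k0: "k0 \<in> Poly_Mapping.keys f" by (metis keys_eq_empty ex_in_conv)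
  let ?K = "Poly_Mapping.keys f"
  define M where "M = Max ((\<lambda>k. max \<bar>fst k\<bar> \<bar>snd k\<bar>) ` ?K)"
  have bound: "\<bar>fst k\<bar> \<le> M" "\<bar>snd k\<bar> \<le> M" if "k \<in> ?K" for k
  proof -
    have "max \<bar>fst k\<bar> \<bar>snd k\<bar> \<le> M" unfolding M_def by (rule Max_ge) (use that in auto)
    then show "\<bar>fst k\<bar> \<le> M" "\<bar>snd k\<bar> \<le> M" by simp_all
  qed
  have M0: "M \<ge> 0" using bound[OF k0] by linarith
  define N where "N = 2 * M + 1"
  define L where "L = M + N * M"
  define d where "d k = nat (fst k + N * snd k + L)" for k :: "int \<times> int"
  have nonneg: "fst k + N * snd k + L \<ge> 0" if "k \<in> ?K" for k
  proof -
    have "N * (- M) \<le> N * snd k" using bound[OF that] M0 by (intro mult_left_mono) (auto simp: N_def)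
    then show ?thesis using bound[OF that] by (simp add: L_def)
  qed
  have inj: "k = l" if "k \<in> ?K" "l \<in> ?K" "d k = d l" for k l
  proof -
    have eq: "fst k - fst l = N * (snd l - snd k)"
      using that nonneg[OF that(1)] nonneg[OF that(2)] by (simp add: d_def algebra_simps)
    have "snd l - snd k = 0"
    proof (rule ccontr)
      assume "\<not> ?thesis"
      then have "N * 1 \<le> \<bar>N\<bar> * \<bar>snd l - snd k\<bar>" using M0 by (intro mult_mono) (auto simp: N_def)
      also have "\<dots> = \<bar>fst k - fst l\<bar>" by (simp add: eq abs_mult)
      also have "\<dots> \<le> 2 * M" using bound[OF that(1)] bound[OF that(2)] by linarith
      finally show False by (simp add: N_def)
    qed
    with eq show ?thesis by (simp add: prod_eq_iff)
  qed
  define p :: "rat poly" where "p = (\<Sum>k\<in>?K. monom (of_int (coeff_at f k)) (d k))"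
  have root: "poly p T = 0" if T: "T > 0" for T
  proof -
    have "poly p T = (\<Sum>k\<in>?K. of_int (coeff_at f k) * T ^ d k)"
      by (simp add: p_def poly_sum poly_monom)
    also have "\<dots> = (\<Sum>k\<in>?K. T powi L * (of_int (coeff_at f k) * T powi fst k * (T powi N) powi snd k))"
    proof (rule sum.cong[OF refl])
      fix k assume k: "k \<in> ?K"
      have "T ^ d k = T powi (fst k + N * snd k + L)"
        using nonneg[OF k] by (simp add: d_def power_int_nonneg_exp)
      also have "\<dots> = T powi L * (T powi fst k * (T powi N) powi snd k)"
        using T by (simp add: power_int_add power_int_mult)
      finally show "of_int (coeff_at f k) * T ^ d k =
        T powi L * (of_int (coeff_at f k) * T powi fst k * (T powi N) powi snd k)" by simp
    qed
    also have "\<dots> = 0"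
      using zero[of T "T powi N"] T by (simp flip: sum_distrib_left)
    finally show ?thesis .
  qed
  have "p = 0"
  proof (rule ccontr)
    assume "p \<noteq> 0"
    then have "finite {x. poly p x = 0}" by (rule poly_roots_finite)
    moreover have "{0<..} \<subseteq> {x. poly p x = 0}" using root by auto
    ultimately have "finite {0::rat<..}" by (rule rev_finite_subset)
    then show False using infinite_Ioi[of "0::rat"] by simp
  qed
  have "coeff p (d k0) = (\<Sum>k\<in>?K. if k = k0 then of_int (coeff_at f k) else 0)"
    unfolding p_def coeff_sum using inj[OF _ k0] by (intro sum.cong) auto
  then have "coeff_at f k0 = 0" using k0 \<open>p = 0\<close> by simp
  with k0 show False by (simp add: in_keys_iff)
qed

text \<open>
  The two variables of a cluster can be given arbitrary positive values simultaneously, so a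
  vanishing expansion vanishes identically on the positive quadrant.
\<close>

theorem laurent_expansion_unique:
  assumes "laurent_eval f (cluster_var b c m) (cluster_var b c (m + 1)) =
    laurent_eval g (cluster_var b c m) (cluster_var b c (m + 1))"
  shows "f = g"
proof -
  have "f - g = 0"
  proof (rule laurent_sum_zero_imp_zero)
    fix a d :: rat assume "a > 0" "d > 0"
    then obtain s where s: "exchange_seq b c s" "\<And>m. s m > 0" "s m = a" "s (m + 1) = d"
      using exchange_seq_exists by metis
    have "laurent_eval (f - g) (cluster_var b c m) (cluster_var b c (m + 1)) = 0"
      using assms by (simp add: laurent_eval_diff)
    then show "(\<Sum>k\<in>Poly_Mapping.keys (f - g). of_int (coeff_at (f - g) k) * a powi fst k * d powi snd k) = 0"
      using has_value_laurent_eval[OF s(1), of "f - g" m "m + 1"] has_value_unique[OF _ has_value_0]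
      by (auto simp: s)
  qed
  then show ?thesis by simp
qed

lemma laurent_term_le_value:
  assumes s: "exchange_seq b c s" "\<And>m. s m > 0"
    and f: "\<And>k. coeff_at f k \<ge> 0" "coeff_at f k0 \<noteq> 0"
    and val: "has_value (s 1) (s 2) (laurent_eval f (cluster_var b c m) (cluster_var b c l)) t"
  shows "s m powi fst k0 * s l powi snd k0 \<le> t"
proof -
  let ?T = "\<lambda>k. of_int (coeff_at f k) * s m powi fst k * s l powi snd k"
  have t: "t = (\<Sum>k\<in>Poly_Mapping.keys f. ?T k)"
    by (rule has_value_unique[OF val has_value_laurent_eval[OF s(1)]])
  have pos: "s m powi fst k * s l powi snd k > 0" for k using s(2) by simp
  have "coeff_at f k0 \<ge> 1" using f(1)[of k0] f(2) by linarith
  then have "1 * (s m powi fst k0 * s l powi snd k0) \<le> of_int (coeff_at f k0) * (s m powi fst k0 * s l powi snd k0)"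
    using pos by (intro mult_right_mono) (auto simp: less_imp_le)
  also have "\<dots> = (\<Sum>k\<in>{k0}. ?T k)" by simp
  also have "\<dots> \<le> (\<Sum>k\<in>Poly_Mapping.keys f. ?T k)"
    using f pos by (intro sum_mono2) (auto simp: in_keys_iff mult.assoc less_imp_le)
  finally show ?thesis by (simp add: t)
qed

section \<open>Denominators\<close>

lemma map_poly_add_hom:
  assumes "f 0 = 0" "\<And>x y. f (x + y) = f x + f y"
  shows "map_poly f (p + q) = map_poly f p + map_poly f q"
  by (rule poly_eqI) (simp add: coeff_map_poly assms)

lemma map_poly_mult_hom:
  assumes f: "f 0 = 0" "\<And>x y. f (x + y) = f x + f y" "\<And>x y. f (x * y) = f x * f y"
  shows "map_poly f (p * q) = map_poly f p * map_poly f q"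
proof (rule poly_eqI)
  fix n
  have sum: "f (sum g I) = (\<Sum>i\<in>I. f (g i))" for g and I :: "nat set"
    by (induction I rule: infinite_finite_induct) (simp_all add: f)
  show "coeff (map_poly f (p * q)) n = coeff (map_poly f p * map_poly f q) n"
    by (simp add: coeff_map_poly f coeff_mult sum)
qed

lemma eval2_add: "eval2 (M + N) u v = eval2 M u v + eval2 N u v"
  and eval2_mult: "eval2 (M * N) u v = eval2 M u v * eval2 N u v"
proof -
  let ?h = "\<lambda>p. poly (map_poly of_int p) u"
  have h: "?h 0 = 0" "?h (p + q) = ?h p + ?h q" "?h (p * q) = ?h p * ?h q" for p q
    by (simp_all add: map_poly_add_hom map_poly_mult_hom)
  show "eval2 (M + N) u v = eval2 M u v + eval2 N u v" "eval2 (M * N) u v = eval2 M u v * eval2 N u v"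
    unfolding eval2_def using map_poly_add_hom[of ?h M N, OF h(1,2)] map_poly_mult_hom[of ?h M N, OF h]
    by simp_all
qed

lemma eval2_pCons: "eval2 (pCons p N) u v = poly (map_poly of_int p) u + v * eval2 N u v"
  by (simp add: eval2_def map_poly_pCons)

text \<open>
  The polynomials in \<open>u\<close> and \<open>v\<close> with integer coefficients, paired with their constant terms. In
  contrast to \<open>eval2\<close> this description is symmetric in the two variables, as the reflection of
  exchange sequences requires.
\<close>

inductive numerator :: "ratfun2 \<Rightarrow> ratfun2 \<Rightarrow> int \<Rightarrow> ratfun2 \<Rightarrow> bool" for u v where
  const: "numerator u v k (of_int k)"
| var1: "numerator u v 0 u"
| var2: "numerator u v 0 v"
| add: "numerator u v k x \<Longrightarrow> numerator u v l y \<Longrightarrow> numerator u v (k + l) (x + y)"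
| mult: "numerator u v k x \<Longrightarrow> numerator u v l y \<Longrightarrow> numerator u v (k * l) (x * y)"

lemma numerator_sym: "numerator u v k x \<Longrightarrow> numerator v u k x"
  by (induction rule: numerator.induct) (auto intro: numerator.intros)

lemma numerator_eval2:
  assumes "numerator u v k x"
  shows "\<exists>N. coeff (coeff N 0) 0 = k \<and> x = eval2 N u v"
  using assms
proof induction
  case (const k)
  show ?case by (intro exI[of _ "[:[:k:]:]"]) (simp add: eval2_def map_poly_pCons)
next
  case var1
  show ?case by (intro exI[of _ "[:[:0, 1:]:]"]) (simp add: eval2_def map_poly_pCons)
next
  case var2
  show ?case by (intro exI[of _ "[:0, 1:]"]) (simp add: eval2_def map_poly_pCons)
next
  case (add k x l y)
  then show ?case by (metis eval2_add coeff_add)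
next
  case (mult k x l y)
  then obtain M N where "coeff (coeff M 0) 0 = k" "x = eval2 M u v"
    "coeff (coeff N 0) 0 = l" "y = eval2 N u v" by blast
  then show ?case by (intro exI[of _ "M * N"]) (simp add: eval2_mult coeff_mult)
qed

lemma numerator_uminus: "numerator u v k x \<Longrightarrow> numerator u v (- k) (- x)"
  using numerator.mult[OF numerator.const[of u v "-1"], of k x] by simp

lemma numerator_power: "numerator u v k x \<Longrightarrow> numerator u v (k ^ n) (x ^ n)"
proof (induction n)
  case 0
  show ?case using numerator.const[of u v 1] by simp
qed (auto intro: numerator.mult)

text \<open>
  For \<open>k = 1\<close> this is \<open>has_denominator\<close> with an arbitrary pair of variables. The case \<open>k = 0\<close> serves
  for summands that do not contribute to the corner term.
\<close>

definition has_corner :: "ratfun2 \<Rightarrow> ratfun2 \<Rightarrow> int \<Rightarrow> int \<Rightarrow> int \<Rightarrow> ratfun2 \<Rightarrow> bool" where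
  "has_corner u v k a1 a2 x \<longleftrightarrow> (\<exists>n. numerator u v k n \<and> x = n / (u powi a1 * v powi a2))"

lemma has_corner_sym: "has_corner u v k a1 a2 x \<Longrightarrow> has_corner v u k a2 a1 x"
  unfolding has_corner_def using numerator_sym by (metis mult.commute)

lemma has_corner_imp_has_denominator:
  "has_corner Y1 Y2 1 a1 a2 x \<Longrightarrow> has_denominator (a1, a2) x"
  unfolding has_corner_def has_denominator_def using numerator_eval2 by fastforce

lemma has_corner_add:
  "has_corner u v k a1 a2 x \<Longrightarrow> has_corner u v l a1 a2 y \<Longrightarrow> has_corner u v (k + l) a1 a2 (x + y)"
  unfolding has_corner_def by (metis numerator.add add_divide_distrib)

lemma has_corner_uminus: "has_corner u v k a1 a2 x \<Longrightarrow> has_corner u v (- k) a1 a2 (- x)"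
  unfolding has_corner_def by (metis numerator_uminus minus_divide_left)

lemma has_corner_mult:
  assumes "u \<noteq> 0" "v \<noteq> 0" "has_corner u v k a1 a2 x" "has_corner u v l b1 b2 y"
  shows "has_corner u v (k * l) (a1 + b1) (a2 + b2) (x * y)"
proof -
  obtain n m where *: "numerator u v k n" "x = n / (u powi a1 * v powi a2)"
    "numerator u v l m" "y = m / (u powi b1 * v powi b2)"
    using assms unfolding has_corner_def by blast
  have "x * y = (n * m) / (u powi (a1 + b1) * v powi (a2 + b2))"
    using assms(1,2) by (simp add: * power_int_add)
  then show ?thesis unfolding has_corner_def using numerator.mult[OF *(1,3)] by blast
qed

lemma has_corner_1: "has_corner u v 1 0 0 1"
  unfolding has_corner_def using numerator.const[of u v 1] by (intro exI[of _ 1]) simp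

lemma has_corner_power:
  assumes "u \<noteq> 0" "v \<noteq> 0" "has_corner u v 1 a1 a2 x"
  shows "has_corner u v 1 (int n * a1) (int n * a2) (x ^ n)"
proof (induction n)
  case (Suc n)
  have "int (Suc n) * a1 = a1 + int n * a1" "int (Suc n) * a2 = a2 + int n * a2"
    by (simp_all add: algebra_simps)
  then show ?case using has_corner_mult[OF assms Suc] by simp
qed (simp add: has_corner_1)

lemma has_corner_vars:
  assumes "u \<noteq> 0" "v \<noteq> 0"
  shows "has_corner u v 1 (- 1) 0 u" "has_corner u v 1 0 (- 1) v"
    "has_corner u v 1 1 0 (1 / u)" "has_corner u v 1 0 1 (1 / v)"
  unfolding has_corner_def using numerator.const[of u v 1] assms
  by (auto intro!: exI[of _ 1] simp: power_int_minus divide_inverse)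

lemma has_corner_lower:
  assumes uv: "u \<noteq> 0" "v \<noteq> 0" and x: "has_corner u v k b1 b2 x"
    and le: "b1 \<le> a1" "b2 \<le> a2" "(b1, b2) \<noteq> (a1, a2)"
  shows "has_corner u v 0 a1 a2 x"
proof -
  obtain n where n: "numerator u v k n" "x = n / (u powi b1 * v powi b2)"
    using x unfolding has_corner_def by blast
  define i j where "i = nat (a1 - b1)" and "j = nat (a2 - b2)"
  have ij: "a1 = b1 + int i" "a2 = b2 + int j" "i > 0 \<or> j > 0" using le by (auto simp: i_def j_def)
  have "numerator u v (0 ^ i * 0 ^ j) (u ^ i * v ^ j)"
    by (intro numerator.mult numerator_power numerator.intros)
  then have "numerator u v 0 (n * (u ^ i * v ^ j))"
    using numerator.mult[OF n(1), of "0 ^ i * 0 ^ j" "u ^ i * v ^ j"] ij(3) by (auto simp: power_0_left)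
  moreover have "x = n * (u ^ i * v ^ j) / (u powi a1 * v powi a2)"
    using uv by (simp add: n(2) ij(1,2) power_int_add)
  ultimately show ?thesis unfolding has_corner_def by blast
qed

lemma has_corner_power_plus_1:
  assumes uv: "u \<noteq> 0" "v \<noteq> 0" and x: "has_corner u v 1 a1 a2 x"
    and "a1 \<ge> 0" "a2 \<ge> 0" "(a1, a2) \<noteq> (0, 0)" "n > 0"
  shows "has_corner u v 1 (int n * a1) (int n * a2) (x ^ n + 1)"
proof -
  have "has_corner u v 0 (int n * a1) (int n * a2) 1"
    by (rule has_corner_lower[OF uv has_corner_1]) (use assms in auto)
  from has_corner_add[OF has_corner_power[OF uv x, of n] this] show ?thesis by simp
qed

text \<open>
  A summand with a strictly smaller denominator does not affect the constant term of the numerator.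
\<close>

lemma has_corner_recurrence:
  assumes uv: "u \<noteq> 0" "v \<noteq> 0" and "has_corner u v 1 d1 d2 z" "has_corner u v 1 a1 a2 x"
    "has_corner u v k b1 b2 y" and le: "b1 \<le> d1 + a1" "b2 \<le> d2 + a2" "(b1, b2) \<noteq> (d1 + a1, d2 + a2)"
  shows "has_corner u v 1 (d1 + a1) (d2 + a2) (z * x - y)"
proof -
  have "has_corner u v 0 (d1 + a1) (d2 + a2) y"
    by (rule has_corner_lower[OF uv assms(5) le])
  from has_corner_add[OF has_corner_mult[OF uv assms(3,4)] has_corner_uminus[OF this]]
  show ?thesis by simp
qed

lemma laurent_eval_shift:
  assumes "u \<noteq> 0" "v \<noteq> 0"
  obtains g where "laurent_eval g u v = u powi i * v powi j * laurent_eval f u v"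
    "\<And>k. coeff_at g k = coeff_at f (fst k - i, snd k - j)"
proof -
  let ?K = "Poly_Mapping.keys f"
  define g where "g = (\<Sum>k\<in>?K. Poly_Mapping.single (fst k + i, snd k + j) (coeff_at f k))"
  have "laurent_eval g u v = u powi i * v powi j * laurent_eval f u v"
    unfolding g_def laurent_eval_sum laurent_eval_single laurent_eval_superset[OF finite_keys subset_refl, of f]
      sum_distrib_left
    using assms by (intro sum.cong) (auto simp: power_int_add)
  moreover have "coeff_at g k = coeff_at f (fst k - i, snd k - j)" for k
  proof -
    have "coeff_at g k = (\<Sum>l\<in>?K. if l = (fst k - i, snd k - j) then coeff_at f l else 0)"
      unfolding g_def lookup_sum lookup_single by (intro sum.cong) (auto simp: when_def)
    then show ?thesis by (simp add: in_keys_iff)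
  qed
  ultimately show thesis using that by blast
qed

lemma Y1_nonzero: "Y1 \<noteq> 0" and Y2_nonzero: "Y2 \<noteq> 0"
  by (simp_all add: Y1_def Y2_def)

lemma has_denominator_expansion:
  assumes "has_denominator (a1, a2) x"
  obtains f where "x = laurent_eval f Y1 Y2" "coeff_at f (- a1, - a2) = 1"
    "\<And>k. coeff_at f k \<noteq> 0 \<Longrightarrow> - a1 \<le> fst k \<and> - a2 \<le> snd k"
proof -
  have uni: "\<exists>f. poly (map_poly of_int p) Y1 = laurent_eval f Y1 Y2 \<and> coeff_at f (0, 0) = coeff p 0 \<and>
    (\<forall>k. coeff_at f k \<noteq> 0 \<longrightarrow> 0 \<le> fst k \<and> 0 \<le> snd k)" for p :: "int poly"
  proof (induction p rule: pCons_induct)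
    case 0
    show ?case by (intro exI[of _ 0]) simp
  next
    case (pCons a p)
    then obtain f where f: "poly (map_poly of_int p) Y1 = laurent_eval f Y1 Y2"
      "\<And>k. coeff_at f k \<noteq> 0 \<Longrightarrow> 0 \<le> fst k \<and> 0 \<le> snd k" by blast
    obtain g where g: "laurent_eval g Y1 Y2 = Y1 powi 1 * Y2 powi 0 * laurent_eval f Y1 Y2"
      "\<And>k. coeff_at g k = coeff_at f (fst k - 1, snd k - 0)"
      using laurent_eval_shift[OF Y1_nonzero Y2_nonzero] by blast
    have "coeff_at g (0, 0) = 0" using f(2)[of "(-1, 0)"] g(2)[of "(0, 0)"] by auto
    moreover have "0 \<le> fst k \<and> 0 \<le> snd k" if "coeff_at g k \<noteq> 0" for k
      using f(2)[of "(fst k - 1, snd k)"] g(2)[of k] that by auto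
    ultimately show ?case using f g(1)
      by (intro exI[of _ "Poly_Mapping.single (0, 0) a + g"])
        (auto simp: map_poly_pCons laurent_eval_add laurent_eval_single lookup_add lookup_single when_def split: if_splits)
  qed
  have biv: "\<exists>f. eval2 N Y1 Y2 = laurent_eval f Y1 Y2 \<and> coeff_at f (0, 0) = coeff (coeff N 0) 0 \<and>
    (\<forall>k. coeff_at f k \<noteq> 0 \<longrightarrow> 0 \<le> fst k \<and> 0 \<le> snd k)" for N
  proof (induction N rule: pCons_induct)
    case 0
    show ?case by (intro exI[of _ 0]) (simp add: eval2_def)
  next
    case (pCons p N)
    then obtain f where f: "eval2 N Y1 Y2 = laurent_eval f Y1 Y2"
      "\<And>k. coeff_at f k \<noteq> 0 \<Longrightarrow> 0 \<le> fst k \<and> 0 \<le> snd k" by blast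
    obtain g where g: "laurent_eval g Y1 Y2 = Y1 powi 0 * Y2 powi 1 * laurent_eval f Y1 Y2"
      "\<And>k. coeff_at g k = coeff_at f (fst k - 0, snd k - 1)"
      using laurent_eval_shift[OF Y1_nonzero Y2_nonzero] by blast
    have g0: "coeff_at g (0, 0) = 0" using f(2)[of "(0, -1)"] g(2)[of "(0, 0)"] by auto
    have gs: "0 \<le> fst k \<and> 0 \<le> snd k" if "coeff_at g k \<noteq> 0" for k
      using f(2)[of "(fst k, snd k - 1)"] g(2)[of k] that by auto
    obtain h where h: "poly (map_poly of_int p) Y1 = laurent_eval h Y1 Y2" "coeff_at h (0, 0) = coeff p 0"
      "\<And>k. coeff_at h k \<noteq> 0 \<Longrightarrow> 0 \<le> fst k \<and> 0 \<le> snd k" using uni[of p] by blast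
    have "0 \<le> fst k \<and> 0 \<le> snd k" if "coeff_at (h + g) k \<noteq> 0" for k
      using that h(3)[of k] gs[of k] by (cases "coeff_at h k = 0") (auto simp: lookup_add)
    then show ?case using f g(1) h g0
      by (intro exI[of _ "h + g"]) (auto simp: eval2_pCons laurent_eval_add lookup_add)
  qed
  obtain N where N: "coeff (coeff N 0) 0 = 1" "x = eval2 N Y1 Y2 / (Y1 powi a1 * Y2 powi a2)"
    using assms unfolding has_denominator_def by auto
  obtain f where f: "eval2 N Y1 Y2 = laurent_eval f Y1 Y2" "coeff_at f (0, 0) = 1"
    "\<And>k. coeff_at f k \<noteq> 0 \<Longrightarrow> 0 \<le> fst k \<and> 0 \<le> snd k" using biv[of N] N(1) by auto
  obtain g where g: "laurent_eval g Y1 Y2 = Y1 powi (- a1) * Y2 powi (- a2) * laurent_eval f Y1 Y2"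
    "\<And>k. coeff_at g k = coeff_at f (fst k - - a1, snd k - - a2)"
    using laurent_eval_shift[OF Y1_nonzero Y2_nonzero] by blast
  show thesis
  proof (rule that[of g])
    show "x = laurent_eval g Y1 Y2"
      unfolding g(1) N(2) f(1) by (simp add: power_int_minus divide_inverse)
    show "coeff_at g (- a1, - a2) = 1" using f(2) g(2) by simp
    show "- a1 \<le> fst k \<and> - a2 \<le> snd k" if "coeff_at g k \<noteq> 0" for k
      using f(3)[of "(fst k + a1, snd k + a2)"] g(2)[of k] that by auto
  qed
qed

lemma laurent_expansion_unique_Y:
  "laurent_eval f Y1 Y2 = laurent_eval g Y1 Y2 \<Longrightarrow> f = g"
  using laurent_expansion_unique[of f 1 1 1 g] by simp

lemma has_denominator_unique:
  assumes "has_denominator \<alpha> x" "has_denominator \<beta> x"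
  shows "\<alpha> = \<beta>"
proof -
  obtain a1 a2 b1 b2 where ab: "\<alpha> = (a1, a2)" "\<beta> = (b1, b2)" by (metis prod.exhaust)
  obtain f where f: "x = laurent_eval f Y1 Y2" "coeff_at f (- a1, - a2) = 1"
    "\<And>k. coeff_at f k \<noteq> 0 \<Longrightarrow> - a1 \<le> fst k \<and> - a2 \<le> snd k"
    using has_denominator_expansion assms(1) ab by metis
  obtain g where g: "x = laurent_eval g Y1 Y2" "coeff_at g (- b1, - b2) = 1"
    "\<And>k. coeff_at g k \<noteq> 0 \<Longrightarrow> - b1 \<le> fst k \<and> - b2 \<le> snd k"
    using has_denominator_expansion assms(2) ab by metis
  have "f = g" using f(1) g(1) by (intro laurent_expansion_unique_Y) simp
  then show ?thesis using f(3)[of "(- b1, - b2)"] g(3)[of "(- a1, - a2)"] f(2) g(2) ab by auto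
qed

section \<open>Standard monomials\<close>

lemma subring_generated_0: "0 \<in> subring_generated X"
  using subring_generated.diff[OF subring_generated.one subring_generated.one, of X] by simp

lemma subring_generated_uminus: "x \<in> subring_generated X \<Longrightarrow> - x \<in> subring_generated X"
  using subring_generated.diff[OF subring_generated_0, of x X] by simp

lemma subring_generated_add:
  "x \<in> subring_generated X \<Longrightarrow> y \<in> subring_generated X \<Longrightarrow> x + y \<in> subring_generated X"
  using subring_generated.diff[of x X "- y"] subring_generated_uminus[of y X] by simp

lemma subring_generated_power: "x \<in> subring_generated X \<Longrightarrow> x ^ n \<in> subring_generated X"
  by (induction n) (auto intro: subring_generated.one subring_generated.mult)

lemma subring_generated_sum:
  "(\<And>i. i \<in> I \<Longrightarrow> f i \<in> subring_generated X) \<Longrightarrow> (\<Sum>i\<in>I. f i) \<in> subring_generated X"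
  by (induction I rule: infinite_finite_induct) (auto intro: subring_generated_0 subring_generated_add)

lemma subring_generated_of_int: "of_int k \<in> subring_generated X"
proof -
  have nat: "of_nat n \<in> subring_generated X" for n
    by (induction n) (auto intro: subring_generated_0 subring_generated.one subring_generated_add)
  show ?thesis
    using nat[of "nat k"] subring_generated_uminus[OF nat[of "nat (- k)"]] by (cases "k \<ge> 0") simp_all
qed

lemma subring_generated_subset:
  assumes "X \<subseteq> subring_generated Z"
  shows "subring_generated X \<subseteq> subring_generated Z"
proof
  fix x assume "x \<in> subring_generated X"
  then show "x \<in> subring_generated Z"
    by induction (use assms in \<open>auto intro: subring_generated.intros\<close>)
qed

text \<open>
  Multiplying out \<open>Y 0 * Y 3 ^ b\<close> with both exchange relations gives \<open>Y 4\<close> up to a polynomial in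
  \<open>Y 2\<close>, so \<open>Y 4\<close> is a polynomial in its four predecessors.
\<close>

lemma fourth_in_subring:
  fixes Y :: "int \<Rightarrow> 'a::field"
  assumes Y: "exchange_seq b c Y" and c: "c > 0"
  shows "Y 4 \<in> subring_generated {Y 0, Y 1, Y 2, Y 3}" (is "_ \<in> ?R")
proof -
  have nz: "Y 2 \<noteq> 0" "Y 1 \<noteq> 0" by (simp_all add: exchange_seq_nonzero[OF Y])
  have gens: "Y 0 \<in> ?R" "Y 1 \<in> ?R" "Y 2 \<in> ?R" "Y 3 \<in> ?R" by (auto intro: subring_generated.gen)
  define x where "x = Y 2 ^ c"
  have x: "x \<in> ?R" unfolding x_def by (rule subring_generated_power[OF gens(3)])
  have "\<exists>q\<in>?R. (x + 1) ^ n - 1 = x * q" for n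
  proof (induction n)
    case (Suc n)
    then obtain q where q: "q \<in> ?R" "(x + 1) ^ n - 1 = x * q" by blast
    have "(x + 1) ^ Suc n - 1 = (x + 1) * ((x + 1) ^ n - 1) + x" by (simp add: algebra_simps)
    also have "\<dots> = x * ((x + 1) * q + 1)" unfolding q(2) by (simp add: algebra_simps)
    finally have "(x + 1) ^ Suc n - 1 = x * ((x + 1) * q + 1)" .
    moreover have "(x + 1) * q + 1 \<in> ?R"
      by (intro subring_generated_add subring_generated.mult subring_generated.one x q)
    ultimately show ?case by blast
  qed (auto intro: subring_generated_0)
  then obtain q where q: "q \<in> ?R" "(x + 1) ^ b - 1 = x * q" by blast
  have xc: "x = Y 2 * Y 2 ^ (c - 1)" using c unfolding x_def by (cases c) simp_all
  have r1: "Y 0 * Y 2 = Y 1 ^ b + 1" and r2: "Y 1 * Y 3 = x + 1" and r3: "Y 2 * Y 4 = Y 3 ^ b + 1"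
    using exchange_seq_rel[OF Y, of 1] exchange_seq_rel[OF Y, of 2] exchange_seq_rel[OF Y, of 3]
    by (simp_all add: exch_exp_def x_def)
  have "Y 2 * (Y 0 * Y 3 ^ b) = (Y 0 * Y 2) * Y 3 ^ b" by (simp add: mult_ac)
  also have "\<dots> = (Y 1 * Y 3) ^ b + Y 3 ^ b" unfolding r1 by (simp add: ring_distribs power_mult_distrib)
  also have "\<dots> = ((x + 1) ^ b - 1) + (Y 3 ^ b + 1)" unfolding r2 by simp
  also have "\<dots> = Y 2 * (Y 2 ^ (c - 1) * q + Y 4)"
    unfolding q(2) r3[symmetric] by (subst xc) (simp add: algebra_simps)
  finally have "Y 0 * Y 3 ^ b = Y 2 ^ (c - 1) * q + Y 4" using nz by (simp only: mult_cancel_left) simp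
  then have "Y 4 = Y 0 * Y 3 ^ b - Y 2 ^ (c - 1) * q" by simp
  then show ?thesis
    using gens q(1) by (auto intro: subring_generated.diff subring_generated.mult subring_generated_power)
qed

text \<open>
  By the preceding lemma and its mirror image, a window of four consecutive terms generates both
  neighbours of the window, so all windows generate the same ring.
\<close>

lemma subring_generated_four:
  fixes Y :: "int \<Rightarrow> 'a::field"
  assumes Y: "exchange_seq b c Y" and bc: "b > 0" "c > 0"
  shows "subring_generated (range Y) = subring_generated {Y 0, Y 1, Y 2, Y 3}"
proof
  define G where "G m = {Y m, Y (m + 1), Y (m + 2), Y (m + 3)}" for m
  have up: "Y (m + 4) \<in> subring_generated (G m)" for m
    using fourth_in_subring[OF exchange_seq_shift[OF Y, of m]] exch_exp_pos[OF bc]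
    by (simp add: G_def add.commute)
  have down: "Y (m - 1) \<in> subring_generated (G m)" for m
    using fourth_in_subring[OF exchange_seq_reflect[OF exchange_seq_shift[OF Y, of m]]] exch_exp_pos[OF bc]
    by (simp add: G_def add.commute insert_commute)
  have step_up: "subring_generated (G (m + 1)) \<subseteq> subring_generated (G m)" for m
    by (rule subring_generated_subset)
      (use up[of m] in \<open>auto simp: G_def add.assoc intro: subring_generated.gen\<close>)
  have "G (m - 1) = {Y (m - 1), Y m, Y (m + 1), Y (m + 2)}" for m
    by (simp add: G_def add.commute)
  then have step_down: "subring_generated (G (m - 1)) \<subseteq> subring_generated (G m)" for m
    by (intro subring_generated_subset)
      (use down[of m] in \<open>auto simp: G_def intro: subring_generated.gen\<close>)
  have "subring_generated (G m) \<subseteq> subring_generated (G 0)" for m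
  proof (cases "m \<ge> 0")
    case True
    then show ?thesis by (induction m rule: int_ge_induct) (use step_up in blast)+
  next
    case False
    then have "m \<le> 0" by simp
    then show ?thesis by (induction m rule: int_le_induct) (use step_down in blast)+
  qed
  moreover have "Y m \<in> subring_generated (G m)" for m by (auto simp: G_def intro: subring_generated.gen)
  ultimately have "range Y \<subseteq> subring_generated (G 0)" by blast
  then show "subring_generated (range Y) \<subseteq> subring_generated {Y 0, Y 1, Y 2, Y 3}"
    using subring_generated_subset by (simp add: G_def)
  show "subring_generated {Y 0, Y 1, Y 2, Y 3} \<subseteq> subring_generated (range Y)"
    by (rule subring_generated_subset) (auto intro: subring_generated.gen)
qed

text \<open>
  The monomials in \<open>Y 0\<close>, \<open>Y 1\<close>, \<open>Y 2\<close>, \<open>Y 3\<close> that contain neither \<open>Y 0 * Y 2\<close> nor \<open>Y 1 * Y 3\<close>,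
  indexed by their denominators.
\<close>

definition std_monomial :: "(int \<Rightarrow> ratfun2) \<Rightarrow> int \<times> int \<Rightarrow> ratfun2" where
  "std_monomial Y \<alpha> =
    Y 0 ^ nat (snd \<alpha>) * Y 1 ^ nat (- fst \<alpha>) * Y 2 ^ nat (- snd \<alpha>) * Y 3 ^ nat (fst \<alpha>)"

text \<open>
  Rewriting \<open>Y 0 * Y 2\<close> and \<open>Y 1 * Y 3\<close> by the exchange relations lowers the joint degree \<open>i + l\<close> in
  the two outer variables.
\<close>

lemma monomial_in_span_std:
  fixes Y :: "int \<Rightarrow> ratfun2"
  assumes Y: "exchange_seq b c Y"
  shows "Y 0 ^ i * Y 1 ^ j * Y 2 ^ k * Y 3 ^ l \<in> int_module.span (range (std_monomial Y))"
proof (induction "i + l" arbitrary: i j k l rule: less_induct)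
  case less
  let ?V = "int_module.span (range (std_monomial Y))"
  have r1: "Y 0 * Y 2 = Y 1 ^ b + 1" and r2: "Y 1 * Y 3 = Y 2 ^ c + 1"
    using exchange_seq_rel[OF Y, of 1] exchange_seq_rel[OF Y, of 2] by (simp_all add: exch_exp_def)
  consider "i > 0" "k > 0" | "j > 0" "l > 0" | "i = 0 \<or> k = 0" "j = 0 \<or> l = 0" by blast
  then show ?case
  proof cases
    case 1
    then obtain i' k' where ik: "i = Suc i'" "k = Suc k'" using gr0_implies_Suc by blast
    have "Y 0 ^ i * Y 1 ^ j * Y 2 ^ k * Y 3 ^ l = (Y 0 * Y 2) * (Y 0 ^ i' * Y 1 ^ j * Y 2 ^ k' * Y 3 ^ l)"
      by (simp add: ik mult_ac)
    also have "\<dots> = Y 0 ^ i' * Y 1 ^ (b + j) * Y 2 ^ k' * Y 3 ^ l + Y 0 ^ i' * Y 1 ^ j * Y 2 ^ k' * Y 3 ^ l"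
      unfolding r1 by (simp add: power_add algebra_simps)
    also have "\<dots> \<in> ?V"
      by (intro int_module.span_add less) (simp_all add: ik)
    finally show ?thesis .
  next
    case 2
    then obtain j' l' where jl: "j = Suc j'" "l = Suc l'" using gr0_implies_Suc by blast
    have "Y 0 ^ i * Y 1 ^ j * Y 2 ^ k * Y 3 ^ l = (Y 1 * Y 3) * (Y 0 ^ i * Y 1 ^ j' * Y 2 ^ k * Y 3 ^ l')"
      by (simp add: jl mult_ac)
    also have "\<dots> = Y 0 ^ i * Y 1 ^ j' * Y 2 ^ (c + k) * Y 3 ^ l' + Y 0 ^ i * Y 1 ^ j' * Y 2 ^ k * Y 3 ^ l'"
      unfolding r2 by (simp add: power_add algebra_simps)
    also have "\<dots> \<in> ?V"
      by (intro int_module.span_add less) (simp_all add: jl)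
    finally show ?thesis .
  next
    case 3
    then have "Y 0 ^ i * Y 1 ^ j * Y 2 ^ k * Y 3 ^ l = std_monomial Y (int l - int j, int i - int k)"
      by (auto simp: std_monomial_def)
    then show ?thesis by (auto intro: int_module.span_base)
  qed
qed

lemma span_closed_mult:
  assumes "\<And>x y. x \<in> M \<Longrightarrow> y \<in> M \<Longrightarrow> x * y \<in> int_module.span M"
    and "x \<in> int_module.span M" "y \<in> int_module.span M"
  shows "x * y \<in> int_module.span M"
proof -
  have one: "x * y \<in> int_module.span M" if "x \<in> M" "y \<in> int_module.span M" for x y
    using that(2)
  proof (induction rule: int_module.span_induct_alt)
    case (step k z w)
    have "x * (int_scale k z + w) = int_scale k (x * z) + x * w" by (simp add: algebra_simps)
    then show ?case using step assms(1)[OF that(1)]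
      by (metis int_module.span_add int_module.span_scale)
  qed (simp add: int_module.span_zero)
  show ?thesis using assms(2)
  proof (induction rule: int_module.span_induct_alt)
    case (step k z w)
    have "(int_scale k z + w) * y = int_scale k (z * y) + w * y" by (simp add: algebra_simps)
    then show ?case using step one[OF _ assms(3)]
      by (metis int_module.span_add int_module.span_scale)
  qed (simp add: int_module.span_zero)
qed

theorem subring_subset_span_std:
  fixes Y :: "int \<Rightarrow> ratfun2"
  assumes Y: "exchange_seq b c Y" and bc: "b > 0" "c > 0"
  shows "subring_generated (range Y) \<subseteq> int_module.span (range (std_monomial Y))"
proof
  define mon where "mon i j k l = Y 0 ^ i * Y 1 ^ j * Y 2 ^ k * Y 3 ^ l" for i j k l
  define M where "M = (\<lambda>(i, j, k, l). mon i j k l) ` UNIV"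
  have M: "mon i j k l \<in> M" for i j k l unfolding M_def by (rule image_eqI[of _ _ "(i, j, k, l)"]) auto
  have mult: "x * y \<in> int_module.span M" if xy: "x \<in> M" "y \<in> M" for x y
  proof -
    obtain i j k l i' j' k' l' where "x = mon i j k l" "y = mon i' j' k' l'"
      using xy unfolding M_def by auto
    then have "x * y = mon (i + i') (j + j') (k + k') (l + l')"
      by (simp add: mon_def power_add mult_ac)
    then show ?thesis using M by (auto intro: int_module.span_base)
  qed
  have "M \<subseteq> int_module.span (range (std_monomial Y))"
    using monomial_in_span_std[OF Y] by (auto simp: M_def mon_def)
  then have MV: "int_module.span M \<subseteq> int_module.span (range (std_monomial Y))"
    by (rule int_module.span_minimal) (rule int_module.subspace_span)
  fix x assume "x \<in> subring_generated (range Y)"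
  then have "x \<in> subring_generated {Y 0, Y 1, Y 2, Y 3}" using subring_generated_four[OF Y bc] by simp
  then have "x \<in> int_module.span M"
  proof induction
    case (gen x)
    then have "x \<in> {mon 1 0 0 0, mon 0 1 0 0, mon 0 0 1 0, mon 0 0 0 1}" by (simp add: mon_def)
    then show ?case using M by (auto intro: int_module.span_base)
  next
    case one
    show ?case using M[of 0 0 0 0] by (auto simp: mon_def intro: int_module.span_base)
  qed (auto intro: int_module.span_diff span_closed_mult[OF mult])
  then show "x \<in> int_module.span (range (std_monomial Y))" using MV by blast
qed

section \<open>The basis and its denominators\<close>

definition cluster_monomials :: "(int \<Rightarrow> ratfun2) \<Rightarrow> ratfun2 set" where
  "cluster_monomials Y = {Y m ^ p * Y (m + 1) ^ q | m p q. True}"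

definition cluster_basis :: "nat \<Rightarrow> nat \<Rightarrow> (int \<Rightarrow> ratfun2) \<Rightarrow> ratfun2 set" where
  "cluster_basis b c Y = cluster_monomials Y \<union>
    (if b * c = 4 then cheb (delta_elem b c (Y 1) (Y 2)) ` {1..} else {})"

lemma cluster_monomialsI: "l = m + 1 \<Longrightarrow> Y m ^ p * Y l ^ q \<in> cluster_monomials Y"
  by (auto simp: cluster_monomials_def)

lemma cluster_monomials_reflect: "cluster_monomials (\<lambda>m. Y (3 - m)) = cluster_monomials Y"
proof -
  have sub: "cluster_monomials (\<lambda>m. Y (3 - m)) \<subseteq> cluster_monomials Y" for Y
  proof
    fix x assume "x \<in> cluster_monomials (\<lambda>m. Y (3 - m))"
    then obtain m p q where "x = Y (3 - m) ^ p * Y (3 - (m + 1)) ^ q"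
      unfolding cluster_monomials_def by blast
    then have "x = Y (2 - m) ^ q * Y (3 - m) ^ p" by (simp add: mult.commute)
    then show "x \<in> cluster_monomials Y" by (auto intro: cluster_monomialsI)
  qed
  show ?thesis using sub[of Y] sub[of "\<lambda>m. Y (3 - m)"] by auto
qed

lemma cluster_basis_reflect: "cluster_basis c b (\<lambda>m. Y (3 - m)) = cluster_basis b c Y"
  using delta_elem_swap[of b c "Y 1" "Y 2"]
  by (simp add: cluster_basis_def cluster_monomials_reflect mult.commute)

lemma has_corner_cone:
  assumes uv: "u \<noteq> 0" "v \<noteq> 0"
    and x: "has_corner u v 1 x1 x2 (Y m)" and y: "has_corner u v 1 y1 y2 (Y l)" and l: "l = m + 1"
    and pq: "p \<ge> 0" "q \<ge> 0" and a: "a1 = p * x1 + q * y1" "a2 = p * x2 + q * y2"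
  shows "\<exists>x\<in>cluster_monomials Y. has_corner u v 1 a1 a2 x"
proof (rule bexI)
  show "has_corner u v 1 a1 a2 (Y m ^ nat p * Y l ^ nat q)"
    using has_corner_mult[OF uv has_corner_power[OF uv x, of "nat p"]
        has_corner_power[OF uv y, of "nat q"]] pq a by simp
  show "Y m ^ nat p * Y l ^ nat q \<in> cluster_monomials Y" using l by (rule cluster_monomialsI)
qed

lemma has_corner_near:
  assumes Y: "exchange_seq b c Y" and bc: "b > 0" "c > 0"
  shows "has_corner (Y 1) (Y 2) 1 1 0 (Y 3)" "has_corner (Y 1) (Y 2) 1 (int b) 1 (Y 4)"
    "has_corner (Y 1) (Y 2) 1 0 1 (Y 0)" "has_corner (Y 1) (Y 2) 1 1 (int c) (Y (-1))"
proof -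
  have up: "has_corner (Y 1) (Y 2) 1 1 0 (Y 3)" "has_corner (Y 1) (Y 2) 1 (int b) 1 (Y 4)"
    if Y: "exchange_seq b c Y" and bc: "b > 0" "c > 0" for b c and Y :: "int \<Rightarrow> ratfun2"
  proof -
    have uv: "Y 1 \<noteq> 0" "Y 2 \<noteq> 0" using exchange_seq_nonzero[OF Y] by auto
    note vars = has_corner_vars[OF uv]
    have "has_corner (Y 1) (Y 2) 0 0 0 (Y 2 ^ c)"
      by (rule has_corner_lower[OF uv has_corner_power[OF uv vars(2), of c]]) (use bc in auto)
    from has_corner_add[OF this has_corner_1] have "has_corner (Y 1) (Y 2) 1 0 0 (Y 2 ^ c + 1)" by simp
    from has_corner_mult[OF uv this vars(3)]
    show 3: "has_corner (Y 1) (Y 2) 1 1 0 (Y 3)" by (simp add: exchange_seq_near(1)[OF Y])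
    have "has_corner (Y 1) (Y 2) 1 (int b) 0 (Y 3 ^ b + 1)"
      using has_corner_power_plus_1[OF uv 3, of b] bc by simp
    from has_corner_mult[OF uv this vars(4)]
    show "has_corner (Y 1) (Y 2) 1 (int b) 1 (Y 4)" by (simp add: exchange_seq_near(2)[OF Y])
  qed
  show "has_corner (Y 1) (Y 2) 1 1 0 (Y 3)" "has_corner (Y 1) (Y 2) 1 (int b) 1 (Y 4)"
    using up[OF Y bc] by auto
  show "has_corner (Y 1) (Y 2) 1 0 1 (Y 0)" "has_corner (Y 1) (Y 2) 1 1 (int c) (Y (-1))"
    using up[OF exchange_seq_reflect[OF Y] bc(2,1)] has_corner_sym by auto
qed

lemma numerator_1: "numerator u v 1 1"
  using numerator.const[of u v 1] by simp

lemma numerator_numeral: "numerator u v (numeral n) (numeral n)"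
  using numerator.const[of u v "numeral n"] by simp

lemmas numerator_intros = numerator_1 numerator_numeral numerator.var1 numerator.var2
  numerator.add numerator.mult numerator_power

lemma has_corner_G2:
  assumes Y: "exchange_seq 1 3 Y"
  shows "has_corner (Y 1) (Y 2) 1 2 3 (Y 5)" "has_corner (Y 1) (Y 2) 1 1 2 (Y 6)"
proof -
  let ?n = "numerator (Y 1) (Y 2)"
  have "?n ((0 ^ 3 + 1)^2 + 3 * (0 ^ 3 + 1) * 0 + 3 * 0 ^ 2 + 0 ^ 3)
    ((Y 2 ^ 3 + 1)^2 + 3 * (Y 2 ^ 3 + 1) * Y 1 + 3 * Y 1 ^ 2 + Y 1 ^ 3)"
    by (intro numerator_intros)
  then show "has_corner (Y 1) (Y 2) 1 2 3 (Y 5)"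
    unfolding has_corner_def near_values_G2(1)[OF Y]
    by (intro exI[of _ "(Y 2 ^ 3 + 1)^2 + 3 * (Y 2 ^ 3 + 1) * Y 1 + 3 * Y 1 ^ 2 + Y 1 ^ 3"]) simp
  have "?n ((0 + 1)^2 + 0 ^ 3) ((Y 1 + 1)^2 + Y 2 ^ 3)"
    by (intro numerator_intros)
  then show "has_corner (Y 1) (Y 2) 1 1 2 (Y 6)"
    unfolding has_corner_def near_values_G2(3)[OF Y] near_values_G2(2)[OF Y]
    by (intro exI[of _ "(Y 1 + 1)^2 + Y 2 ^ 3"]) simp
qed

text \<open>
  The denominators of the variables \<open>Y 3, Y 4, \<dots>, Y (-1), Y 0\<close> run from \<open>(1, 0)\<close> to
  \<open>(0, 1)\<close> and cut the quadrant into cones. Neighbours among them form a \<open>\<int>\<close>-basis, so each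
  integer vector in a cone is the denominator of a monomial in two consecutive variables.
\<close>

lemma denominators_finite:
  assumes Y: "exchange_seq 1 c Y" and c: "c \<in> {1, 2, 3}" and a: "a1 > 0" "a2 > 0"
  shows "\<exists>x\<in>cluster_monomials Y. has_corner (Y 1) (Y 2) 1 a1 a2 x"
proof -
  have uv: "Y 1 \<noteq> 0" "Y 2 \<noteq> 0" using exchange_seq_nonzero[OF Y] by auto
  have c0: "c > 0" using c by auto
  note near = has_corner_near[OF Y _ c0, simplified]
  consider "a1 \<ge> a2" | "a2 \<ge> int c * a1" | "c = 2" "a1 < a2" "a2 < 2 * a1"
    | "c = 3" "a1 < a2" "2 * a2 \<le> 3 * a1" | "c = 3" "3 * a1 < 2 * a2" "a2 \<le> 2 * a1"
    | "c = 3" "2 * a1 < a2" "a2 < 3 * a1"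
    using c by fastforce
  then show ?thesis
  proof cases
    case 1
    show ?thesis
      by (rule has_corner_cone[where Y = Y and m = "3" and l = "4" and p = "a1 - a2" and q = "a2",
          OF uv near(1,2)]) (use 1 a in auto)
  next
    case 2
    show ?thesis
      by (rule has_corner_cone[where Y = Y and m = "-1" and l = "0" and p = "a1" and q = "a2 - int c * a1",
          OF uv near(4,3)])
        (use 2 a in \<open>auto simp: algebra_simps\<close>)
  next
    case 3
    have "Y 5 = Y (-1)" using exchange_seq_period[OF Y, of "-1"] 3 by (simp add: finite_period_def)
    then have 5: "has_corner (Y 1) (Y 2) 1 1 2 (Y 5)" using near(4) 3 by simp
    show ?thesis
      by (rule has_corner_cone[where Y = Y and m = "4" and l = "5" and p = "2 * a1 - a2" and q = "a2 - a1",
          OF uv near(2) 5])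
        (use 3 a in auto)
  next
    case 4
    then have Y3: "exchange_seq 1 3 Y" using Y by simp
    show ?thesis
      by (rule has_corner_cone[where Y = Y and m = "4" and l = "5" and p = "3 * a1 - 2 * a2" and q = "a2 - a1",
          OF uv near(2) has_corner_G2(1)[OF Y3]])
        (use 4 a in auto)
  next
    case 5
    then have Y3: "exchange_seq 1 3 Y" using Y by simp
    show ?thesis
      by (rule has_corner_cone[where Y = Y and m = "5" and l = "6" and p = "2 * a1 - a2" and q = "2 * a2 - 3 * a1",
          OF uv has_corner_G2[OF Y3]])
        (use 5 a in auto)
  next
    case 6
    then have Y3: "exchange_seq 1 3 Y" using Y by simp
    have m2: "has_corner (Y 1) (Y 2) 1 1 2 (Y (-2))"
      using has_corner_G2(2)[OF Y3] near_values_G2(3)[OF Y3] by simp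
    have m1: "has_corner (Y 1) (Y 2) 1 1 3 (Y (-1))" using near(4) 6 by simp
    show ?thesis
      by (rule has_corner_cone[where Y = Y and m = "-2" and l = "-1" and p = "3 * a1 - a2" and q = "a2 - 2 * a1",
          OF uv m2 m1])
        (use 6 a in auto)
  qed
qed

lemma has_corner_linear_recurrence:
  assumes uv: "u \<noteq> 0" "v \<noteq> 0" and z: "has_corner u v 1 d1 d2 z" and d: "d1 > 0" "d2 > 0"
    and w0: "has_corner u v k a1 a2 (w 0)" and w1: "has_corner u v 1 (a1 + d1) (a2 + d2) (w (Suc 0))"
    and rec: "\<And>n. w (Suc (Suc n)) = z * w (Suc n) - w n"
  shows "has_corner u v 1 (a1 + int (Suc n) * d1) (a2 + int (Suc n) * d2) (w (Suc n))"
proof -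
  have "has_corner u v 1 (a1 + int (Suc n) * d1) (a2 + int (Suc n) * d2) (w (Suc n)) \<and>
    (\<exists>k. has_corner u v k (a1 + int n * d1) (a2 + int n * d2) (w n))"
  proof (induction n)
    case 0
    then show ?case using w0 w1 by auto
  next
    case (Suc n)
    then obtain k where k: "has_corner u v k (a1 + int n * d1) (a2 + int n * d2) (w n)" by blast
    have "has_corner u v 1 (d1 + (a1 + int (Suc n) * d1)) (d2 + (a2 + int (Suc n) * d2)) (w (Suc (Suc n)))"
      unfolding rec
      by (rule has_corner_recurrence[OF uv z conjunct1[OF Suc] k]) (use d in \<open>auto simp: algebra_simps\<close>)
    moreover have "d1 + (a1 + int (Suc n) * d1) = a1 + int (Suc (Suc n)) * d1"
      "d2 + (a2 + int (Suc n) * d2) = a2 + int (Suc (Suc n)) * d2" by (simp_all add: algebra_simps)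
    ultimately have "has_corner u v 1 (a1 + int (Suc (Suc n)) * d1) (a2 + int (Suc (Suc n)) * d2) (w (Suc (Suc n)))"
      by (simp only:)
    then show ?case using conjunct1[OF Suc] by blast
  qed
  then show ?thesis ..
qed

lemma has_corner_cheb:
  assumes uv: "u \<noteq> 0" "v \<noteq> 0" and z: "has_corner u v 1 d1 d2 z" and d: "d1 > 0" "d2 > 0" and "n > 0"
  shows "has_corner u v 1 (int n * d1) (int n * d2) (cheb z n)"
proof -
  have "numerator u v 2 2" by (rule numerator_numeral)
  then have "has_corner u v 2 0 0 (cheb z 0)" by (auto simp: has_corner_def)
  from has_corner_linear_recurrence[where w = "cheb z", OF uv z d this, of "n - 1"] z \<open>n > 0\<close>
  show ?thesis by simp
qed

lemma has_corner_delta: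
  assumes "u \<noteq> 0" "v \<noteq> 0"
  shows "has_corner u v 1 1 1 (delta_elem 2 2 u v)" "has_corner u v 1 1 2 (delta_elem 1 4 u v)"
proof -
  have "numerator u v (0 ^ 2 + 0 ^ 2 + 1) (u ^ 2 + v ^ 2 + 1)" by (intro numerator_intros)
  then show "has_corner u v 1 1 1 (delta_elem 2 2 u v)"
    unfolding has_corner_def delta_elem_def by (intro exI[of _ "u ^ 2 + v ^ 2 + 1"]) simp
  have "numerator u v ((0 + 1) ^ 2 + 0 ^ 4) ((u + 1) ^ 2 + v ^ 4)" by (intro numerator_intros)
  then show "has_corner u v 1 1 2 (delta_elem 1 4 u v)"
    unfolding has_corner_def delta_elem_def by (intro exI[of _ "(u + 1) ^ 2 + v ^ 4"]) simp
qed

text \<open>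
  The variable \<open>Y (m + 3)\<close> has denominator \<open>(m + 1, m)\<close>. A monomial in \<open>Y (m + 3)\<close> and \<open>Y (m + 4)\<close>
  thus has total degree \<open>a1 - a2\<close>, and its exponents are found by division with remainder.
\<close>

lemma denominators_affine_22_aux:
  assumes Y: "exchange_seq 2 2 Y" and a: "a1 > a2" "a2 > 0"
  shows "\<exists>x\<in>cluster_monomials Y. has_corner (Y 1) (Y 2) 1 a1 a2 x"
proof -
  have uv: "Y 1 \<noteq> 0" "Y 2 \<noteq> 0" using exchange_seq_nonzero[OF Y] by auto
  define z where "z = delta_elem 2 2 (Y 1) (Y 2)"
  have "has_corner (Y 1) (Y 2) 1 (0 + int (Suc n) * 1) (- 1 + int (Suc n) * 1) (Y (int (Suc n) + 2))" for n
  proof (rule has_corner_linear_recurrence[OF uv _ _ _ _ _, of 1 1 z 1 0 "-1" "\<lambda>n. Y (int n + 2)" n])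
    show "has_corner (Y 1) (Y 2) 1 0 (- 1) (Y (int 0 + 2))" using has_corner_vars[OF uv] by simp
    show "has_corner (Y 1) (Y 2) 1 (0 + 1) (- 1 + 1) (Y (int (Suc 0) + 2))"
      using has_corner_near[OF Y] by simp
    show "Y (int (Suc (Suc n)) + 2) = z * Y (int (Suc n) + 2) - Y (int n + 2)" for n
      using affine_recurrence_22[OF Y, of "int (Suc n) + 2"] by (simp add: z_def algebra_simps)
  qed (use has_corner_delta(1)[OF uv] in \<open>simp_all add: z_def\<close>)
  then have corner: "has_corner (Y 1) (Y 2) 1 (int n + 1) (int n) (Y (int n + 3))" for n
    by (simp add: add.commute add.left_commute)
  define D m q where "D = a1 - a2" and "m = nat (a2 div D)" and "q = a2 mod D"
  have D: "D > 0" using a by (simp add: D_def)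
  have m: "int m = a2 div D" using D a by (simp add: m_def pos_imp_zdiv_nonneg_iff)
  have a2: "a2 = D * int m + q" unfolding m q_def by simp
  have a1: "a1 = D * int m + q + D" using a2 by (simp add: D_def)
  have q: "q \<ge> 0" "q < D" using D by (simp_all add: q_def)
  show ?thesis
    by (rule has_corner_cone[where Y = Y and m = "int m + 3" and l = "int (Suc m) + 3" and p = "D - q" and q = "q",
        OF uv corner[of m] corner[of "Suc m"]])
      (use q in \<open>simp_all add: a1 a2 algebra_simps\<close>)
qed

lemma denominators_affine_22:
  assumes Y: "exchange_seq 2 2 Y" and a: "a1 > 0" "a2 > 0"
  shows "\<exists>x\<in>cluster_basis 2 2 Y. has_corner (Y 1) (Y 2) 1 a1 a2 x"
proof -
  have uv: "Y 1 \<noteq> 0" "Y 2 \<noteq> 0" using exchange_seq_nonzero[OF Y] by auto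
  consider "a1 > a2" | "a1 < a2" | "a1 = a2" by linarith
  then show ?thesis
  proof cases
    case 1
    then show ?thesis using denominators_affine_22_aux[OF Y] a by (auto simp: cluster_basis_def)
  next
    case 2
    obtain x where "x \<in> cluster_monomials (\<lambda>m. Y (3 - m))" "has_corner (Y 2) (Y 1) 1 a2 a1 x"
      using denominators_affine_22_aux[OF exchange_seq_reflect[OF Y] 2] a by auto
    then show ?thesis
      by (auto simp: cluster_basis_def cluster_monomials_reflect intro: has_corner_sym)
  next
    case 3
    have "has_corner (Y 1) (Y 2) 1 a1 a2 (cheb (delta_elem 2 2 (Y 1) (Y 2)) (nat a1))"
      using has_corner_cheb[OF uv has_corner_delta(1)[OF uv], of "nat a1"] a 3 by simp
    then show ?thesis using a by (force simp: cluster_basis_def)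
  qed
qed

text \<open>
  The expression \<open>\<bar>2 * a1 - a2\<bar>\<close> takes the value \<open>1\<close> on the denominators of variables with even
  index, \<open>2\<close> on those with odd index and \<open>0\<close> on multiples of \<open>\<delta> = (1, 2)\<close>. Dividing \<open>a1\<close> by it
  locates the vector between two consecutive even variables, and the remainder decides on which
  side of the odd variable in between it lies.
\<close>

lemma denominators_affine_14:
  assumes Y: "exchange_seq 1 4 Y" and a: "a1 > 0" "a2 > 0"
  shows "\<exists>x\<in>cluster_basis 1 4 Y. has_corner (Y 1) (Y 2) 1 a1 a2 x"
proof -
  let ?H = "has_corner (Y 1) (Y 2) 1"
  have uv: "Y 1 \<noteq> 0" "Y 2 \<noteq> 0" using exchange_seq_nonzero[OF Y] by auto
  define z where "z = delta_elem 1 4 (Y 1) (Y 2)"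
  have z: "?H 1 2 z" using has_corner_delta(2)[OF uv] by (simp add: z_def)
  have rec: "Y (m + 2) + Y (m - 2) = z * Y m" if "even m" for m
    using affine_recurrence_14[OF Y that] by (simp add: z_def)
  note near = has_corner_near[OF Y, simplified]
  have odd: "Y (2 * n + 1) = Y (2 * n) * Y (2 * n + 2) - 1" for n
    using exchange_seq_rel[OF Y, of "2 * n + 1"] by (simp add: exch_exp_def add.commute)
  have minus_1: "?H c1 c2 (x - 1)"
    if "?H c1 c2 x" "c1 > 0" "c2 \<ge> 0" for c1 c2 x
  proof -
    have "has_corner (Y 1) (Y 2) 0 c1 c2 1"
      by (rule has_corner_lower[OF uv has_corner_1]) (use that in auto)
    from has_corner_add[OF that(1) has_corner_uminus[OF this]] show ?thesis by simp
  qed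
  have up_even: "?H (int n) (2 * int n - 1) (Y (2 * int n + 2))" for n
  proof (cases n)
    case 0
    then show ?thesis using has_corner_vars[OF uv] by simp
  next
    case (Suc k)
    have "?H (0 + int (Suc k) * 1) (- 1 + int (Suc k) * 2) (Y (2 * int (Suc k) + 2))"
    proof (rule has_corner_linear_recurrence[OF uv z, of 1 0 "-1" "\<lambda>n. Y (2 * int n + 2)" k])
      show "?H 0 (- 1) (Y (2 * int 0 + 2))" using has_corner_vars[OF uv] by simp
      show "?H (0 + 1) (- 1 + 2) (Y (2 * int (Suc 0) + 2))"
        using near by simp
      show "Y (2 * int (Suc (Suc n)) + 2) = z * Y (2 * int (Suc n) + 2) - Y (2 * int n + 2)" for n
        using rec[of "2 * int (Suc n) + 2"] by (simp add: algebra_simps)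
    qed simp_all
    then show ?thesis by (simp add: Suc mult.commute)
  qed
  have down_even: "?H (int n) (2 * int n + 1) (Y (- 2 * int n))" for n
  proof (cases n)
    case 0
    then show ?thesis using near by simp
  next
    case (Suc k)
    have "?H (0 + int (Suc k) * 1) (1 + int (Suc k) * 2) (Y (- 2 * int (Suc k)))"
    proof (rule has_corner_linear_recurrence[OF uv z, of 1 0 1 "\<lambda>n. Y (- 2 * int n)" k])
      show "?H 0 1 (Y (- 2 * int 0))" using near by simp
      have "?H (1 + 0) (2 + 1) (z * Y 0 - Y 2)"
        by (rule has_corner_recurrence[OF uv z near(3) has_corner_vars(2)[OF uv]]) auto
      moreover have "z * Y 0 - Y 2 = Y (- 2)" using rec[of 0] by (simp add: algebra_simps)
      ultimately show "?H (0 + 1) (1 + 2) (Y (- 2 * int (Suc 0)))" by simp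
      show "Y (- 2 * int (Suc (Suc n))) = z * Y (- 2 * int (Suc n)) - Y (- 2 * int n)" for n
        using rec[of "- 2 * int (Suc n)"] by (simp add: algebra_simps)
    qed simp_all
    then show ?thesis by (simp add: Suc mult.commute)
  qed
  have up_odd: "?H (2 * int n + 1) (4 * int n) (Y (2 * int n + 3))" for n
  proof -
    have "?H (2 * int n + 1) (4 * int n) (Y (2 * int n + 2) * Y (2 * int (Suc n) + 2))"
      using has_corner_mult[OF uv up_even[of n] up_even[of "Suc n"]] by (simp add: algebra_simps)
    moreover have "2 * (int n + 1) + 1 = 2 * int n + 3" "2 * (int n + 1) = 2 * int n + 2"
      "2 * (int n + 1) + 2 = 2 * int (Suc n) + 2" by simp_all
    ultimately show ?thesis using minus_1 odd[of "int n + 1"] by (simp add: add.commute)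
  qed
  have down_odd: "?H (2 * int n + 1) (4 * int n + 4) (Y (- 2 * int n - 1))" for n
  proof -
    have corner: "?H (2 * int n + 1) (4 * int n + 4) (Y (- 2 * int (Suc n)) * Y (- 2 * int n))"
      using has_corner_mult[OF uv down_even[of "Suc n"] down_even[of n]] by (simp add: algebra_simps)
    have "2 * (- int n - 1) + 1 = - 2 * int n - 1" "2 * (- int n - 1) = - 2 * int (Suc n)"
      "2 * (- int n - 1) + 2 = - 2 * int n" by simp_all
    then have "Y (- 2 * int n - 1) = Y (- 2 * int (Suc n)) * Y (- 2 * int n) - 1"
      using odd[of "- int n - 1"] by metis
    moreover have "?H (2 * int n + 1) (4 * int n + 4) (Y (- 2 * int (Suc n)) * Y (- 2 * int n) - 1)"
      by (rule minus_1[OF corner]) simp_all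
    ultimately show ?thesis by simp
  qed
  define D where "D = \<bar>2 * a1 - a2\<bar>"
  consider "D = 0" | "D > 0" "a2 = 2 * a1 - D" | "D > 0" "a2 = 2 * a1 + D"
    unfolding D_def by linarith
  then show ?thesis
  proof cases
    case 1
    have "?H a1 a2 (cheb z (nat a1))"
      using has_corner_cheb[OF uv z, of "nat a1"] a 1 by (simp add: D_def mult.commute)
    then show ?thesis using a by (force simp: cluster_basis_def z_def)
  next
    case 2
    define n r where "n = nat (a1 div D)" and "r = a1 mod D"
    have n: "int n = a1 div D" using 2 a by (simp add: n_def pos_imp_zdiv_nonneg_iff)
    have a1: "a1 = D * int n + r" unfolding n r_def by simp
    have r: "r \<ge> 0" "r < D" using 2 by (simp_all add: r_def)
    have "\<exists>x\<in>cluster_monomials Y. ?H a1 a2 x"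
    proof (cases "2 * r \<le> D")
      case True
      show ?thesis
        by (rule has_corner_cone[where Y = Y and m = "2 * int n + 2" and l = "2 * int n + 3" and p = "D - 2 * r" and q = "r",
            OF uv up_even[of n] up_odd[of n]])
          (use r True in \<open>simp_all add: a1 2(2) algebra_simps\<close>)
    next
      case False
      show ?thesis
        by (rule has_corner_cone[where Y = Y and m = "2 * int n + 3" and l = "2 * int (Suc n) + 2" and p = "D - r" and q = "2 * r - D",
            OF uv up_odd[of n] up_even[of "Suc n"]])
          (use r False in \<open>simp_all add: a1 2(2) algebra_simps\<close>)
    qed
    then show ?thesis by (auto simp: cluster_basis_def)
  next
    case 3
    define n r where "n = nat (a1 div D)" and "r = a1 mod D"
    have n: "int n = a1 div D" using 3 a by (simp add: n_def pos_imp_zdiv_nonneg_iff)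
    have a1: "a1 = D * int n + r" unfolding n r_def by simp
    have r: "r \<ge> 0" "r < D" using 3 by (simp_all add: r_def)
    have "\<exists>x\<in>cluster_monomials Y. ?H a1 a2 x"
    proof (cases "2 * r \<le> D")
      case True
      show ?thesis
        by (rule has_corner_cone[where Y = Y and m = "- 2 * int n - 1" and l = "- 2 * int n" and p = "r" and q = "D - 2 * r",
            OF uv down_odd[of n] down_even[of n]])
          (use r True in \<open>simp_all add: a1 3(2) algebra_simps\<close>)
    next
      case False
      show ?thesis
        by (rule has_corner_cone[where Y = Y and m = "- 2 * int (Suc n)" and l = "- 2 * int n - 1" and p = "2 * r - D" and q = "D - r",
            OF uv down_even[of "Suc n"] down_odd[of n]])
          (use r False in \<open>simp_all add: a1 3(2) algebra_simps\<close>)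
    qed
    then show ?thesis by (auto simp: cluster_basis_def)
  qed
qed

theorem denominators_surjective:
  assumes Y: "exchange_seq b c Y" and bc: "b > 0" "c > 0" "b * c \<le> 4" and a: "a1 > 0" "a2 > 0"
  shows "\<exists>x\<in>cluster_basis b c Y. has_corner (Y 1) (Y 2) 1 a1 a2 x"
proof -
  have one: "\<exists>x\<in>cluster_basis 1 c Y. has_corner (Y 1) (Y 2) 1 a1 a2 x"
    if "exchange_seq 1 c Y" "c \<in> {1, 2, 3, 4}" "a1 > 0" "a2 > 0" for c a1 a2 and Y :: "int \<Rightarrow> ratfun2"
  proof (cases "c = 4")
    case True
    with that show ?thesis using denominators_affine_14[of Y a1 a2] by simp
  next
    case False
    then show ?thesis using denominators_finite[of c Y a1 a2] that by (auto simp: cluster_basis_def)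
  qed
  show ?thesis
    using bc
  proof (cases rule: exchange_type_cases)
    case 1
    then show ?thesis using one Y a by blast
  next
    case 2
    have "exchange_seq 1 b (\<lambda>m. Y (3 - m))" using exchange_seq_reflect[OF Y] 2 by simp
    from one[OF this 2(2) a(2,1)] show ?thesis
      using cluster_basis_reflect[of c b Y] 2 by (auto intro: has_corner_sym)
  next
    case 3
    then show ?thesis using denominators_affine_22 Y a by blast
  qed
qed

section \<open>The basis spans the cluster algebra\<close>

lemma has_corner_std_monomial:
  assumes Y: "exchange_seq b c Y" and bc: "b > 0" "c > 0"
  shows "has_corner (Y 1) (Y 2) 1 (fst \<alpha>) (snd \<alpha>) (std_monomial Y \<alpha>)"
proof -
  have uv: "Y 1 \<noteq> 0" "Y 2 \<noteq> 0" using exchange_seq_nonzero[OF Y] by auto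
  note near = has_corner_near[OF Y bc] and vars = has_corner_vars[OF uv]
  note p = has_corner_power[OF uv]
  have "has_corner (Y 1) (Y 2) 1
    (int (nat (snd \<alpha>)) * 0 + int (nat (- fst \<alpha>)) * (- 1) + int (nat (- snd \<alpha>)) * 0 + int (nat (fst \<alpha>)) * 1)
    (int (nat (snd \<alpha>)) * 1 + int (nat (- fst \<alpha>)) * 0 + int (nat (- snd \<alpha>)) * (- 1) + int (nat (fst \<alpha>)) * 0)
    (std_monomial Y \<alpha>)"
    unfolding std_monomial_def
    using has_corner_mult[OF uv has_corner_mult[OF uv has_corner_mult[OF uv
      p[OF near(3), of "nat (snd \<alpha>)"] p[OF vars(1), of "nat (- fst \<alpha>)"]]
      p[OF vars(2), of "nat (- snd \<alpha>)"]] p[OF near(1), of "nat (fst \<alpha>)"]] by simp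
  then show ?thesis by (cases "fst \<alpha> \<ge> 0"; cases "snd \<alpha> \<ge> 0") simp_all
qed

lemma std_monomial_cluster:
  assumes "\<not> (fst \<alpha> > 0 \<and> snd \<alpha> > 0)"
  shows "std_monomial Y \<alpha> \<in> cluster_monomials Y"
proof -
  consider "fst \<alpha> \<le> 0" "snd \<alpha> \<le> 0" | "fst \<alpha> > 0" "snd \<alpha> \<le> 0" | "fst \<alpha> \<le> 0" "snd \<alpha> > 0"
    using assms by linarith
  then show ?thesis
  proof cases
    case 1
    then show ?thesis using cluster_monomialsI[of 2 1 Y] by (simp add: std_monomial_def)
  next
    case 2
    then show ?thesis using cluster_monomialsI[of 3 2 Y] by (simp add: std_monomial_def)
  next
    case 3
    then show ?thesis using cluster_monomialsI[of 1 0 Y] by (simp add: std_monomial_def)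
  qed
qed

text \<open>
  A maximal index of a combination of elements with pairwise distinct denominators contributes a
  corner term that nothing else can cancel.
\<close>

lemma pointed_combination_bound:
  fixes E :: "int \<times> int \<Rightarrow> ratfun2"
  assumes den: "\<And>\<beta>. \<beta> \<in> S \<Longrightarrow> has_denominator \<beta> (E \<beta>)" and fin: "finite S"
    and k: "\<And>\<beta>. \<beta> \<in> S \<Longrightarrow> k \<beta> \<noteq> 0"
    and eq: "(\<Sum>\<beta>\<in>S. of_int (k \<beta>) * E \<beta>) = laurent_eval g Y1 Y2" and \<beta>: "\<beta> \<in> S"
  obtains \<gamma> where "fst \<beta> \<le> fst \<gamma>" "snd \<beta> \<le> snd \<gamma>" "coeff_at g (- fst \<gamma>, - snd \<gamma>) \<noteq> 0"
proof -
  have "\<exists>f. E \<gamma> = laurent_eval f Y1 Y2 \<and> coeff_at f (- fst \<gamma>, - snd \<gamma>) = 1 \<and>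
    (\<forall>e. coeff_at f e \<noteq> 0 \<longrightarrow> - fst \<gamma> \<le> fst e \<and> - snd \<gamma> \<le> snd e)" if "\<gamma> \<in> S" for \<gamma>
    using has_denominator_expansion[of "fst \<gamma>" "snd \<gamma>" "E \<gamma>"] den[OF that] by (metis prod.collapse)
  then obtain f where f: "\<And>\<gamma>. \<gamma> \<in> S \<Longrightarrow> E \<gamma> = laurent_eval (f \<gamma>) Y1 Y2"
    "\<And>\<gamma>. \<gamma> \<in> S \<Longrightarrow> coeff_at (f \<gamma>) (- fst \<gamma>, - snd \<gamma>) = 1"
    "\<And>\<gamma> e. \<gamma> \<in> S \<Longrightarrow> coeff_at (f \<gamma>) e \<noteq> 0 \<Longrightarrow> - fst \<gamma> \<le> fst e \<and> - snd \<gamma> \<le> snd e"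
    by metis
  define T where "T = {\<gamma> \<in> S. fst \<beta> \<le> fst \<gamma> \<and> snd \<beta> \<le> snd \<gamma>}"
  have T: "finite T" "\<beta> \<in> T" using fin \<beta> by (auto simp: T_def)
  define M where "M = Max ((\<lambda>\<gamma>. fst \<gamma> + snd \<gamma>) ` T)"
  have "M \<in> (\<lambda>\<gamma>. fst \<gamma> + snd \<gamma>) ` T" unfolding M_def using T by (intro Max_in) auto
  then obtain \<gamma> where \<gamma>: "\<gamma> \<in> T" "M = fst \<gamma> + snd \<gamma>" by blast
  have max: "fst \<delta> + snd \<delta> \<le> fst \<gamma> + snd \<gamma>" if "\<delta> \<in> T" for \<delta>
  proof -
    have "fst \<delta> + snd \<delta> \<le> M" unfolding M_def using T that by (intro Max_ge) auto
    then show ?thesis using \<gamma> by simp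
  qed
  have "laurent_eval g Y1 Y2 = laurent_eval (\<Sum>\<delta>\<in>S. frag_cmul (k \<delta>) (f \<delta>)) Y1 Y2"
    unfolding eq[symmetric] laurent_eval_sum laurent_eval_frag_cmul by (intro sum.cong) (auto simp: f)
  then have g: "g = (\<Sum>\<delta>\<in>S. frag_cmul (k \<delta>) (f \<delta>))" by (rule laurent_expansion_unique_Y)
  have "coeff_at g (- fst \<gamma>, - snd \<gamma>) = (\<Sum>\<delta>\<in>S. k \<delta> * coeff_at (f \<delta>) (- fst \<gamma>, - snd \<gamma>))"
    by (simp add: g lookup_sum)
  also have "\<dots> = (\<Sum>\<delta>\<in>S. if \<delta> = \<gamma> then k \<gamma> else 0)"
  proof (rule sum.cong[OF refl])
    fix \<delta> assume \<delta>: "\<delta> \<in> S"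
    show "k \<delta> * coeff_at (f \<delta>) (- fst \<gamma>, - snd \<gamma>) = (if \<delta> = \<gamma> then k \<gamma> else 0)"
    proof (cases "coeff_at (f \<delta>) (- fst \<gamma>, - snd \<gamma>) = 0")
      case True
      then show ?thesis using f(2)[OF \<delta>] by auto
    next
      case False
      then have le: "fst \<gamma> \<le> fst \<delta>" "snd \<gamma> \<le> snd \<delta>" using f(3)[OF \<delta> False] by auto
      then have "\<delta> \<in> T" using \<gamma>(1) \<delta> by (auto simp: T_def)
      then have "\<delta> = \<gamma>" using max[of \<delta>] le by (auto simp: prod_eq_iff)
      then show ?thesis using f(2)[OF \<delta>] by simp
    qed
  qed
  also have "\<dots> = k \<gamma>" using fin \<gamma>(1) by (simp add: T_def)
  finally show thesis using that[of \<gamma>] \<gamma>(1) k[of \<gamma>] by (auto simp: T_def)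
qed

lemma span_range_combination:
  assumes inj: "inj E" and x: "x \<in> int_module.span (range E)"
  obtains S k where "finite S" "\<And>\<beta>. \<beta> \<in> S \<Longrightarrow> k \<beta> \<noteq> 0" "x = (\<Sum>\<beta>\<in>S. of_int (k \<beta>) * E \<beta>)"
proof -
  obtain t r where t: "finite t" "t \<subseteq> range E" "x = (\<Sum>a\<in>t. int_scale (r a) a)"
    using x unfolding int_module.span_explicit by blast
  define S where "S = {\<beta>. E \<beta> \<in> t \<and> r (E \<beta>) \<noteq> 0}"
  have im: "E ` S = {a \<in> t. r a \<noteq> 0}" using t(2) by (auto simp: S_def)
  have injS: "inj_on E S" using inj by (rule inj_on_subset) simp
  have "finite (E ` S)" using t(1) by (simp add: im)
  then have fin: "finite S" by (rule finite_imageD[OF _ injS])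
  have "x = (\<Sum>a\<in>E ` S. int_scale (r a) a)"
    unfolding t(3) im by (rule sum.mono_neutral_right) (use t(1) in auto)
  also have "\<dots> = (\<Sum>\<beta>\<in>S. of_int (r (E \<beta>)) * E \<beta>)"
    by (simp add: sum.reindex[OF injS])
  finally show thesis by (intro that[of S "\<lambda>\<beta>. r (E \<beta>)"] fin) (simp_all add: S_def)
qed

text \<open>
  The difference of \<open>X \<alpha>\<close> and the standard monomial with the same denominator \<open>\<alpha>\<close> has no corner
  term, so its expansion in standard monomials involves only indices strictly below \<open>\<alpha>\<close>. Outside the
  positive quadrant the two families agree, and inside it there are finitely many indices below
  \<open>\<alpha>\<close>, so an induction expresses the standard monomials through the family \<open>X\<close>.
\<close>

theorem pointed_family_spans:
  assumes bc: "b > 0" "c > 0"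
    and X: "\<And>\<alpha>. has_denominator \<alpha> (X \<alpha>)" "\<And>\<alpha>. X \<alpha> \<in> cluster_algebra b c"
    and outside: "\<And>\<alpha>. \<not> (fst \<alpha> > 0 \<and> snd \<alpha> > 0) \<Longrightarrow> X \<alpha> = std_monomial (cluster_var b c) \<alpha>"
  shows "cluster_algebra b c \<subseteq> int_module.span (range X)"
proof -
  let ?E = "std_monomial (cluster_var b c)" and ?V = "int_module.span (range X)"
  note Y = exchange_seq_cluster_var[of b c]
  have denE: "has_denominator \<alpha> (?E \<alpha>)" for \<alpha>
    using has_corner_imp_has_denominator has_corner_std_monomial[OF Y bc, of \<alpha>]
    by (metis cluster_var_1 cluster_var_2 prod.collapse)
  have injE: "inj ?E"
    by (rule injI) (metis denE has_denominator_unique)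
  have spanE: "cluster_algebra b c \<subseteq> int_module.span (range ?E)"
    unfolding cluster_algebra_def by (rule subring_subset_span_std[OF Y bc])
  have EA: "?E \<alpha> \<in> cluster_algebra b c" for \<alpha>
    unfolding std_monomial_def cluster_algebra_def
    by (intro subring_generated.mult subring_generated_power subring_generated.gen rangeI)
  have "?E \<alpha> \<in> ?V" for \<alpha>
  proof (induction "nat (fst \<alpha> + snd \<alpha>)" arbitrary: \<alpha> rule: less_induct)
    case less
    show ?case
    proof (cases "fst \<alpha> > 0 \<and> snd \<alpha> > 0")
      case False
      then show ?thesis using outside[of \<alpha>] by (metis int_module.span_base rangeI)
    next
      case True
      have "X \<alpha> - ?E \<alpha> \<in> cluster_algebra b c"
        using X(2) EA unfolding cluster_algebra_def by (rule subring_generated.diff)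
      then have "X \<alpha> - ?E \<alpha> \<in> int_module.span (range ?E)" using spanE by blast
      from span_range_combination[OF injE this]
      obtain S k where S: "finite S" "\<And>\<beta>. \<beta> \<in> S \<Longrightarrow> k \<beta> \<noteq> 0"
        "X \<alpha> - ?E \<alpha> = (\<Sum>\<beta>\<in>S. of_int (k \<beta>) * ?E \<beta>)" by blast
      obtain f where f: "X \<alpha> = laurent_eval f Y1 Y2" "coeff_at f (- fst \<alpha>, - snd \<alpha>) = 1"
        "\<And>e. coeff_at f e \<noteq> 0 \<Longrightarrow> - fst \<alpha> \<le> fst e \<and> - snd \<alpha> \<le> snd e"
        using has_denominator_expansion[of "fst \<alpha>" "snd \<alpha>"] X(1)[of \<alpha>] by (metis prod.collapse)
      obtain g where g: "?E \<alpha> = laurent_eval g Y1 Y2" "coeff_at g (- fst \<alpha>, - snd \<alpha>) = 1"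
        "\<And>e. coeff_at g e \<noteq> 0 \<Longrightarrow> - fst \<alpha> \<le> fst e \<and> - snd \<alpha> \<le> snd e"
        using has_denominator_expansion[of "fst \<alpha>" "snd \<alpha>"] denE[of \<alpha>] by (metis prod.collapse)
      have eq: "(\<Sum>\<beta>\<in>S. of_int (k \<beta>) * ?E \<beta>) = laurent_eval (f - g) Y1 Y2"
        using S(3) f(1) g(1) by (simp add: laurent_eval_diff)
      have "?E \<beta> \<in> ?V" if \<beta>: "\<beta> \<in> S" for \<beta>
      proof -
        obtain \<gamma> where \<gamma>: "fst \<beta> \<le> fst \<gamma>" "snd \<beta> \<le> snd \<gamma>" "coeff_at (f - g) (- fst \<gamma>, - snd \<gamma>) \<noteq> 0"
          by (rule pointed_combination_bound[of S ?E k "f - g" \<beta>, OF denE S(1,2) eq \<beta>])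
        have "coeff_at f (- fst \<gamma>, - snd \<gamma>) \<noteq> 0 \<or> coeff_at g (- fst \<gamma>, - snd \<gamma>) \<noteq> 0"
          using \<gamma>(3) by (auto simp: lookup_minus)
        then have le: "fst \<gamma> \<le> fst \<alpha>" "snd \<gamma> \<le> snd \<alpha>"
          using f(3)[of "(- fst \<gamma>, - snd \<gamma>)"] g(3)[of "(- fst \<gamma>, - snd \<gamma>)"] by auto
        have "\<gamma> \<noteq> \<alpha>" using \<gamma>(3) f(2) g(2) by (auto simp: lookup_minus)
        then have "fst \<gamma> \<noteq> fst \<alpha> \<or> snd \<gamma> \<noteq> snd \<alpha>" by (auto simp: prod_eq_iff)
        then have lt: "fst \<beta> + snd \<beta> < fst \<alpha> + snd \<alpha>" using \<gamma>(1,2) le by linarith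
        show ?thesis
          by (rule less) (use lt True in simp)
      qed
      then have "(\<Sum>\<beta>\<in>S. of_int (k \<beta>) * ?E \<beta>) \<in> ?V"
        by (intro int_module.span_sum int_module.span_scale)
      moreover have "X \<alpha> \<in> ?V" by (rule int_module.span_base) simp
      ultimately have "X \<alpha> - (\<Sum>\<beta>\<in>S. of_int (k \<beta>) * ?E \<beta>) \<in> ?V" by (intro int_module.span_diff)
      moreover have "X \<alpha> - (\<Sum>\<beta>\<in>S. of_int (k \<beta>) * ?E \<beta>) = ?E \<alpha>" using S(3) by (simp add: algebra_simps)
      ultimately show ?thesis by simp
    qed
  qed
  then have "int_module.span (range ?E) \<subseteq> ?V"
    by (intro int_module.span_minimal int_module.subspace_span) auto
  with spanE show ?thesis by blast
qed

lemma delta_in_subring: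
  assumes Y: "exchange_seq b c Y" and bc: "b * c = 4"
  shows "delta_elem b c (Y 1) (Y 2) \<in> subring_generated (range Y)"
proof -
  have uv: "Y 1 \<noteq> 0" "Y 2 \<noteq> 0" using exchange_seq_nonzero[OF Y] by auto
  have gen: "Y m \<in> subring_generated (range Y)" for m by (auto intro: subring_generated.gen)
  have two: "2 \<in> subring_generated (range Y)" using subring_generated_of_int[of 2 "range Y"] by simp
  have one: "delta_elem 1 4 (W 1) (W 2) = W 0 ^ 2 * W 3 - (W 1 + 2) * W 2 ^ 2"
    if W: "exchange_seq 1 4 W" for W :: "int \<Rightarrow> 'a"
  proof -
    have nz: "W 1 \<noteq> 0" "W 2 \<noteq> 0" using exchange_seq_nonzero[OF W] by auto
    define u v where "u = W 1" and "v = W 2"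
    have "W 0 ^ 2 * W 3 = (u + 1) ^ 2 * (v ^ 4 + 1) / (u * v ^ 2)"
      using exchange_seq_near(1,5)[OF W] nz by (simp add: u_def v_def power_divide)
    also have "(u + 1) ^ 2 * (v ^ 4 + 1) = ((u + 1) ^ 2 + v ^ 4) + (u + 2) * v ^ 2 * (u * v ^ 2)"
      by algebra
    also have "\<dots> / (u * v ^ 2) = delta_elem 1 4 u v + (u + 2) * v ^ 2"
      using nz by (simp add: delta_elem_def u_def v_def add_divide_distrib)
    finally show ?thesis by (simp add: u_def v_def)
  qed
  show ?thesis
    using bc
  proof (cases rule: affine_type_cases)
    case 1
    define u v where "u = Y 1" and "v = Y 2"
    have "Y 0 * Y 3 = (u ^ 2 + 1) * (v ^ 2 + 1) / (u * v)"
      using exchange_seq_near(1,5)[OF Y] 1 by (simp add: u_def v_def mult.commute)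
    also have "(u ^ 2 + 1) * (v ^ 2 + 1) = (u ^ 2 + v ^ 2 + 1) + u * v * (u * v)" by algebra
    also have "\<dots> / (u * v) = delta_elem b c u v + u * v"
      using uv 1 by (simp add: delta_elem_def u_def v_def add_divide_distrib)
    finally have "delta_elem b c (Y 1) (Y 2) = Y 0 * Y 3 - Y 1 * Y 2" by (simp add: u_def v_def)
    then show ?thesis by (simp add: gen subring_generated.diff subring_generated.mult)
  next
    case 2
    then show ?thesis using one[of Y] Y
      by (simp add: gen subring_generated.diff subring_generated.mult subring_generated_power
        subring_generated_add two)
  next
    case 3
    have "exchange_seq 1 4 (\<lambda>m. Y (3 - m))" using exchange_seq_reflect[OF Y] 3 by simp
    from one[OF this] have "delta_elem b c (Y 1) (Y 2) = Y 3 ^ 2 * Y 0 - (Y 2 + 2) * Y 1 ^ 2"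
      using delta_elem_swap[of b c "Y 1" "Y 2"] 3 by simp
    then show ?thesis
      by (simp add: gen subring_generated.diff subring_generated.mult subring_generated_power
        subring_generated_add two)
  qed
qed

lemma cheb_in_subring: "z \<in> subring_generated X \<Longrightarrow> cheb z n \<in> subring_generated X"
proof (induction z n rule: cheb.induct)
  case (1 z)
  have "(of_int 2 :: 'a) \<in> subring_generated X" by (rule subring_generated_of_int)
  then show ?case by simp
qed (auto intro: subring_generated.diff subring_generated.mult)

lemma cluster_basis_subset: "cluster_basis b c (cluster_var b c) \<subseteq> cluster_algebra b c"
proof
  fix x assume x: "x \<in> cluster_basis b c (cluster_var b c)"
  show "x \<in> cluster_algebra b c"
  proof (cases "x \<in> cluster_monomials (cluster_var b c)")
    case True
    then obtain m p q where "x = cluster_var b c m ^ p * cluster_var b c (m + 1) ^ q"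
      unfolding cluster_monomials_def by blast
    then show ?thesis unfolding cluster_algebra_def
      by (simp only:) (intro subring_generated.mult subring_generated_power subring_generated.gen rangeI)
  next
    case False
    then show ?thesis
      using x delta_in_subring[OF exchange_seq_cluster_var, of b c] unfolding cluster_algebra_def
      by (auto simp: cluster_basis_def split: if_splits intro!: cheb_in_subring)
  qed
qed

lemma span_subset_cluster_algebra:
  assumes "B \<subseteq> cluster_algebra b c"
  shows "int_module.span B \<subseteq> cluster_algebra b c"
proof
  fix x assume "x \<in> int_module.span B"
  then obtain t r where "x = (\<Sum>a\<in>t. int_scale (r a) a)" "t \<subseteq> B"
    unfolding int_module.span_explicit by blast
  then show "x \<in> cluster_algebra b c" using assms unfolding cluster_algebra_def
    by (auto intro!: subring_generated_sum subring_generated.mult subring_generated_of_int)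
qed

lemma pointed_family_exists:
  assumes bc: "b > 0" "c > 0" "b * c \<le> 4"
  shows "\<exists>X. (\<forall>\<alpha>. has_denominator \<alpha> (X \<alpha>)) \<and> (\<forall>\<alpha>. X \<alpha> \<in> cluster_basis b c (cluster_var b c)) \<and>
    cluster_algebra b c \<subseteq> int_module.span (range X)"
proof -
  let ?B = "cluster_basis b c (cluster_var b c)" and ?E = "std_monomial (cluster_var b c)"
  note Y = exchange_seq_cluster_var[of b c]
  have "\<exists>x\<in>?B. has_denominator \<alpha> x \<and> (\<not> (fst \<alpha> > 0 \<and> snd \<alpha> > 0) \<longrightarrow> x = ?E \<alpha>)" for \<alpha>
  proof (cases "fst \<alpha> > 0 \<and> snd \<alpha> > 0")
    case True
    then show ?thesis
      using denominators_surjective[OF Y bc, of "fst \<alpha>" "snd \<alpha>"] has_corner_imp_has_denominator by force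
  next
    case False
    then have "?E \<alpha> \<in> ?B" using std_monomial_cluster by (auto simp: cluster_basis_def)
    moreover have "has_denominator \<alpha> (?E \<alpha>)"
      using has_corner_imp_has_denominator has_corner_std_monomial[OF Y bc(1,2), of \<alpha>]
      by (metis cluster_var_1 cluster_var_2 prod.collapse)
    ultimately show ?thesis by blast
  qed
  then obtain X where X: "\<And>\<alpha>. X \<alpha> \<in> ?B" "\<And>\<alpha>. has_denominator \<alpha> (X \<alpha>)"
    "\<And>\<alpha>. \<not> (fst \<alpha> > 0 \<and> snd \<alpha> > 0) \<Longrightarrow> X \<alpha> = ?E \<alpha>" by metis
  have "cluster_algebra b c \<subseteq> int_module.span (range X)"
  proof (rule pointed_family_spans)
    show "X \<alpha> \<in> cluster_algebra b c" for \<alpha> using X(1) cluster_basis_subset by blast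
  qed (use bc X in blast)+
  with X(1,2) show ?thesis by blast
qed

section \<open>Expansions of cluster monomials in other clusters\<close>

lemma cluster_basis_positive:
  assumes bc: "b > 0" "c > 0" "b * c \<le> 4" and x: "x \<in> cluster_basis b c (cluster_var b c)"
  shows "x \<in> pos_laurent (cluster_var b c m) (cluster_var b c (m + 1))"
proof -
  note Y = exchange_seq_cluster_var[of b c]
  have nz: "cluster_var b c m \<noteq> 0" for m using exchange_seq_nonzero[OF Y] .
  show ?thesis
  proof (cases "x \<in> cluster_monomials (cluster_var b c)")
    case True
    then show ?thesis unfolding cluster_monomials_def
      using exchange_seq_positive[OF Y bc] by (auto intro!: pos_laurent_mult pos_laurent_power nz)
  next
    case False
    then show ?thesis using x cheb_delta_positive[OF Y] by (auto simp: cluster_basis_def split: if_splits)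
  qed
qed

lemma half_specialization_left:
  assumes bc: "b > 0" "c > 0" "b * c \<le> 4"
  obtains s :: "int \<Rightarrow> rat" where "exchange_seq b c s" "\<And>m. s m > 0" "s (k + 1) = 1 / 2" "s k = 1"
    "\<And>(Y :: int \<Rightarrow> 'a::field) m. exchange_seq b c Y \<Longrightarrow> Y m \<noteq> Y (k + 1) \<Longrightarrow> s m \<ge> 1"
proof -
  obtain s :: "int \<Rightarrow> rat" where s: "exchange_seq c b s" "\<And>m. s m > 0" "s (2 - k) = 1 / 2" "s (2 - k + 1) = 1"
    "\<And>(Y :: int \<Rightarrow> 'a) m. exchange_seq c b Y \<Longrightarrow> Y m \<noteq> Y (2 - k) \<Longrightarrow> s m \<ge> 1"
    using half_specialization[OF bc(2,1), of "2 - k", where 'a = 'a] bc(3) by (metis mult.commute)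
  show thesis
  proof (rule that[of "\<lambda>m. s (3 - m)"])
    show "exchange_seq b c (\<lambda>m. s (3 - m))" using exchange_seq_reflect[OF s(1)] .
    show "s (3 - (k + 1)) = 1 / 2" using s(3) by (simp add: algebra_simps)
    show "s (3 - k) = 1" using s(4) by (simp add: algebra_simps)
    show "1 \<le> s (3 - m)" if "exchange_seq b c Y" "Y m \<noteq> Y (k + 1)" for Y :: "int \<Rightarrow> 'a" and m
      using s(5)[OF exchange_seq_reflect[OF that(1)], of "3 - m"] that(2) by (simp add: algebra_simps)
  qed (rule s(2))
qed

text \<open>
  An expansion with non-negative coefficients that contains a monomial with non-negative exponents
  has value at least \<open>1\<close> wherever both variables of the cluster do. If \<open>x\<close> involved a variable
  outside this cluster, giving that variable the value \<open>1/2\<close> would make the value of \<open>x\<close> smaller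
  than \<open>1\<close> while both variables of the cluster stay at least \<open>1\<close>.
\<close>

lemma cluster_monomial_proper:
  assumes bc: "b > 0" "c > 0" "b * c \<le> 4" and x: "x \<in> cluster_monomials (cluster_var b c)"
    and f: "x = laurent_eval f (cluster_var b c m) (cluster_var b c (m + 1))" "\<And>k. coeff_at f k \<ge> 0"
    and e: "coeff_at f e \<noteq> 0" "fst e \<ge> 0" "snd e \<ge> 0"
  shows "\<exists>p q. x = cluster_var b c m ^ p * cluster_var b c (m + 1) ^ q"
proof -
  let ?y = "cluster_var b c"
  note Y = exchange_seq_cluster_var[of b c]
  obtain l r t where x: "x = ?y l ^ r * ?y (l + 1) ^ t" using x unfolding cluster_monomials_def by blast
  have small: "\<not> (s l ^ r * s (l + 1) ^ t < 1 \<and> s m \<ge> 1 \<and> s (m + 1) \<ge> 1)"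
    if s: "exchange_seq b c s" "\<And>m. s m > 0" for s :: "int \<Rightarrow> rat"
  proof
    assume *: "s l ^ r * s (l + 1) ^ t < 1 \<and> s m \<ge> 1 \<and> s (m + 1) \<ge> 1"
    have "has_value (s 1) (s 2) x (s l ^ r * s (l + 1) ^ t)"
      unfolding x by (intro has_value_mult has_value_power has_value_cluster_var s(1))
    then have "s m powi fst e * s (m + 1) powi snd e \<le> s l ^ r * s (l + 1) ^ t"
      using laurent_term_le_value[OF s f(2) e(1)] f(1) by simp
    moreover have "1 * 1 \<le> s m powi fst e * s (m + 1) powi snd e"
      using * e by (intro mult_mono) auto
    ultimately show False using * by simp
  qed
  have "r = 0 \<or> ?y l \<in> {?y m, ?y (m + 1)}"
  proof (rule ccontr)
    assume *: "\<not> ?thesis"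
    obtain s :: "int \<Rightarrow> rat" where s: "exchange_seq b c s" "\<And>m. s m > 0" "s l = 1 / 2" "s (l + 1) = 1"
      "\<And>(Y :: int \<Rightarrow> ratfun2) m. exchange_seq b c Y \<Longrightarrow> Y m \<noteq> Y l \<Longrightarrow> s m \<ge> 1"
      using half_specialization[OF bc, of l, where 'a = ratfun2] by metis
    have "s m \<ge> 1" "s (m + 1) \<ge> 1" using s(5)[OF Y, of m] s(5)[OF Y, of "m + 1"] * by auto
    moreover have "s l ^ r * s (l + 1) ^ t < 1" using * by (simp add: s power_less_one_iff power_divide)
    ultimately show False using small[OF s(1,2)] by blast
  qed
  moreover have "t = 0 \<or> ?y (l + 1) \<in> {?y m, ?y (m + 1)}"
  proof (rule ccontr)
    assume *: "\<not> ?thesis"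
    obtain s :: "int \<Rightarrow> rat" where s: "exchange_seq b c s" "\<And>m. s m > 0" "s (l + 1) = 1 / 2" "s l = 1"
      "\<And>(Y :: int \<Rightarrow> ratfun2) m. exchange_seq b c Y \<Longrightarrow> Y m \<noteq> Y (l + 1) \<Longrightarrow> s m \<ge> 1"
      using half_specialization_left[OF bc, of l, where 'a = ratfun2] by metis
    have "s m \<ge> 1" "s (m + 1) \<ge> 1" using s(5)[OF Y, of m] s(5)[OF Y, of "m + 1"] * by auto
    moreover have "s l ^ r * s (l + 1) ^ t < 1" using * by (simp add: s power_less_one_iff power_divide)
    ultimately show False using small[OF s(1,2)] by blast
  qed
  moreover have mono: "\<exists>p q. w ^ n = ?y m ^ p * ?y (m + 1) ^ q" if "n = 0 \<or> w \<in> {?y m, ?y (m + 1)}" for w n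
    using that
  proof (elim disjE insertE emptyE)
    assume "n = 0"
    then show ?thesis by (intro exI[of _ 0]) simp
  next
    assume "w = ?y m"
    then show ?thesis by (intro exI[of _ n] exI[of _ 0]) simp
  next
    assume "w = ?y (m + 1)"
    then show ?thesis by (intro exI[of _ 0] exI[of _ n]) simp
  qed
  ultimately obtain p q p' q' where "?y l ^ r = ?y m ^ p * ?y (m + 1) ^ q" "?y (l + 1) ^ t = ?y m ^ p' * ?y (m + 1) ^ q'"
    by metis
  then have "x = ?y m ^ (p + p') * ?y (m + 1) ^ (q + q')" by (simp add: x power_add mult_ac)
  then show ?thesis by blast
qed

section \<open>Leading terms of the elements with imaginary denominators\<close>

definition laurent_deg_le :: "int \<times> int \<Rightarrow> ratfun2 \<Rightarrow> ratfun2 \<Rightarrow> int \<Rightarrow> ratfun2 set" where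
  "laurent_deg_le \<omega> u v d = {x. \<exists>g. x = laurent_eval g u v \<and>
    (\<forall>k. coeff_at g k \<noteq> 0 \<longrightarrow> fst \<omega> * fst k + snd \<omega> * snd k \<le> d)}"

lemma laurent_deg_le_monomial:
  "fst \<omega> * i + snd \<omega> * j \<le> d \<Longrightarrow> u powi i * v powi j \<in> laurent_deg_le \<omega> u v d"
  unfolding laurent_deg_le_def
  by (rule CollectI, rule exI[of _ "Poly_Mapping.single (i, j) 1"])
    (auto simp: laurent_eval_single lookup_single when_def)

lemma laurent_deg_le_diff:
  assumes "x \<in> laurent_deg_le \<omega> u v d" "y \<in> laurent_deg_le \<omega> u v d"
  shows "x - y \<in> laurent_deg_le \<omega> u v d"
proof -
  obtain f g where fg: "x = laurent_eval f u v" "\<And>k. coeff_at f k \<noteq> 0 \<Longrightarrow> fst \<omega> * fst k + snd \<omega> * snd k \<le> d"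
    "y = laurent_eval g u v" "\<And>k. coeff_at g k \<noteq> 0 \<Longrightarrow> fst \<omega> * fst k + snd \<omega> * snd k \<le> d"
    using assms unfolding laurent_deg_le_def by auto
  have "fst \<omega> * fst k + snd \<omega> * snd k \<le> d" if "coeff_at (f - g) k \<noteq> 0" for k
    using that fg(2)[of k] fg(4)[of k] by (cases "coeff_at f k = 0") (auto simp: lookup_minus)
  then show ?thesis unfolding laurent_deg_le_def
    by (intro CollectI exI[of _ "f - g"]) (simp add: fg laurent_eval_diff)
qed

lemma laurent_deg_le_0: "0 \<in> laurent_deg_le \<omega> u v d"
  unfolding laurent_deg_le_def by (intro CollectI exI[of _ 0]) simp

lemma laurent_deg_le_add:
  assumes "x \<in> laurent_deg_le \<omega> u v d" "y \<in> laurent_deg_le \<omega> u v d"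
  shows "x + y \<in> laurent_deg_le \<omega> u v d"
  using laurent_deg_le_diff[OF assms(1) laurent_deg_le_diff[OF laurent_deg_le_0 assms(2)]] by simp

lemma laurent_deg_le_mult:
  assumes uv: "u \<noteq> 0" "v \<noteq> 0" and x: "x \<in> laurent_deg_le \<omega> u v d" and y: "y \<in> laurent_deg_le \<omega> u v d'"
  shows "x * y \<in> laurent_deg_le \<omega> u v (d + d')"
proof -
  obtain f where f: "x = laurent_eval f u v" "\<And>k. coeff_at f k \<noteq> 0 \<Longrightarrow> fst \<omega> * fst k + snd \<omega> * snd k \<le> d"
    using x unfolding laurent_deg_le_def by auto
  obtain g where g: "y = laurent_eval g u v" "\<And>k. coeff_at g k \<noteq> 0 \<Longrightarrow> fst \<omega> * fst k + snd \<omega> * snd k \<le> d'"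
    using y unfolding laurent_deg_le_def by auto
  have summand: "of_int (coeff_at f k) * u powi fst k * v powi snd k * y \<in> laurent_deg_le \<omega> u v (d + d')"
    if k: "k \<in> Poly_Mapping.keys f" for k
  proof -
    obtain h where h: "laurent_eval h u v = u powi fst k * v powi snd k * laurent_eval g u v"
      "\<And>l. coeff_at h l = coeff_at g (fst l - fst k, snd l - snd k)"
      using laurent_eval_shift[OF uv] by blast
    have fk: "fst \<omega> * fst k + snd \<omega> * snd k \<le> d" using f(2) k by (simp add: in_keys_iff)
    have "fst \<omega> * fst l + snd \<omega> * snd l \<le> d + d'" if "coeff_at h l \<noteq> 0" for l
      using g(2)[of "(fst l - fst k, snd l - snd k)"] that h(2)[of l] fk by (simp add: algebra_simps)
    then show ?thesis unfolding laurent_deg_le_def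
      by (intro CollectI exI[of _ "frag_cmul (coeff_at f k) h"])
        (auto simp: laurent_eval_frag_cmul h(1) g(1) mult_ac)
  qed
  have "(\<Sum>k\<in>K. of_int (coeff_at f k) * u powi fst k * v powi snd k * y) \<in> laurent_deg_le \<omega> u v (d + d')"
    if "K \<subseteq> Poly_Mapping.keys f" for K
    using finite_subset[OF that finite_keys] that
    by (induction K rule: finite_induct) (auto intro: laurent_deg_le_0 laurent_deg_le_add summand)
  then show ?thesis
    unfolding f(1) laurent_eval_superset[OF finite_keys subset_refl] sum_distrib_right by blast
qed

text \<open>
  For the degree with these weights, the invariant has two terms \<open>t\<close> and \<open>inverse t\<close> of degree \<open>0\<close>
  and otherwise terms of negative degree. The direction is the exponent of \<open>t\<close>.
\<close>

definition delta_weight :: "nat \<Rightarrow> int \<times> int" where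
  "delta_weight b = (if b = 2 then (1, 1) else if b = 1 then (2, 1) else (1, 2))"

definition delta_direction :: "nat \<Rightarrow> int \<times> int" where
  "delta_direction b = (snd (delta_weight b), - fst (delta_weight b))"

text \<open>
  The exponent of \<open>inverse t ^ n\<close>.
\<close>

definition delta_exponent :: "nat \<Rightarrow> nat \<Rightarrow> int \<times> int" where
  "delta_exponent b n = (- (int n * fst (delta_direction b)), - (int n * snd (delta_direction b)))"

lemma delta_elem_leading_terms:
  assumes uv: "u \<noteq> 0" "v \<noteq> 0" and bc: "b * c = 4"
  defines "t \<equiv> u powi fst (delta_direction b) * v powi snd (delta_direction b)"
  obtains s where "s \<in> laurent_deg_le (delta_weight b) u v (- 1)" "delta_elem b c u v = t + inverse t + s"
proof -
  define s where "s = delta_elem b c u v - t - inverse t"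
  have mon: "u powi i * v powi j \<in> laurent_deg_le (delta_weight b) u v (- 1)"
    if "fst (delta_weight b) * i + snd (delta_weight b) * j \<le> - 1" for i j
    by (rule laurent_deg_le_monomial[OF that])
  have "s \<in> laurent_deg_le (delta_weight b) u v (- 1)"
    using bc
  proof (cases rule: affine_type_cases)
    case 1
    have "s = u powi (- 1) * v powi (- 1)"
      using uv 1 by (simp add: s_def t_def delta_elem_def delta_direction_def delta_weight_def
        power_int_minus field_simps power2_eq_square)
    then show ?thesis using 1 mon[of "-1" "-1"] by (simp add: delta_weight_def)
  next
    case 2
    have "s = u powi 0 * v powi (- 2) + u powi 0 * v powi (- 2) + u powi (- 1) * v powi (- 2)"
      using uv 2 by (simp add: s_def t_def delta_elem_def delta_direction_def delta_weight_def
        power_int_minus field_simps power2_eq_square power4_eq_xxxx)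
    also have "\<dots> \<in> laurent_deg_le (delta_weight b) u v (- 1)"
      by (intro laurent_deg_le_add mon) (simp_all add: 2 delta_weight_def)
    finally show ?thesis .
  next
    case 3
    have "s = u powi (- 2) * v powi 0 + u powi (- 2) * v powi 0 + u powi (- 2) * v powi (- 1)"
      using uv 3 by (simp add: s_def t_def delta_elem_def delta_direction_def delta_weight_def
        power_int_minus field_simps power2_eq_square power4_eq_xxxx)
    also have "\<dots> \<in> laurent_deg_le (delta_weight b) u v (- 1)"
      by (intro laurent_deg_le_add mon) (simp_all add: 3 delta_weight_def)
    finally show ?thesis .
  qed
  then show thesis by (rule that) (simp add: s_def)
qed

text \<open>
  Modulo terms of negative degree the invariant is \<open>t + inverse t\<close>, and \<open>cheb (t + inverse t) n\<close>
  equals \<open>t ^ n + inverse t ^ n\<close>.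
\<close>

lemma cheb_leading_terms:
  assumes uv: "u \<noteq> 0" "v \<noteq> 0" and bc: "b * c = 4"
  defines "t \<equiv> u powi fst (delta_direction b) * v powi snd (delta_direction b)"
  shows "cheb (delta_elem b c u v) n - t ^ n - inverse t ^ n \<in> laurent_deg_le (delta_weight b) u v (- 1)"
proof -
  let ?L = "laurent_deg_le (delta_weight b) u v"
  obtain s where s: "s \<in> ?L (- 1)" and z: "delta_elem b c u v = t + inverse t + s"
    using delta_elem_leading_terms[OF uv bc] unfolding t_def by blast
  have t0: "t \<noteq> 0" using uv by (simp add: t_def)
  have w0: "fst (delta_weight b) * fst (delta_direction b) + snd (delta_weight b) * snd (delta_direction b) = 0"
    by (simp add: delta_direction_def)
  have t: "t \<in> ?L 0" unfolding t_def by (rule laurent_deg_le_monomial) (use w0 in simp)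
  have "inverse t = u powi (- fst (delta_direction b)) * v powi (- snd (delta_direction b))"
    by (simp add: t_def power_int_minus)
  also have "\<dots> \<in> ?L 0" by (rule laurent_deg_le_monomial) (use w0 in \<open>simp add: algebra_simps\<close>)
  finally have it: "inverse t \<in> ?L 0" .
  have one: "1 \<in> ?L 0" using laurent_deg_le_monomial[of "delta_weight b" 0 0 0 u v] by simp
  have pow: "x ^ n \<in> ?L 0" if "x \<in> ?L 0" for x n
    by (induction n) (use one laurent_deg_le_mult[OF uv that, of _ 0] in auto)
  have sub: "x \<in> ?L 0" if "x \<in> ?L (- 1)" for x
    using that unfolding laurent_deg_le_def by force
  have expand: "(p + i + s) * (R1 + p * A + i * B) - (R0 + A + B) - p * (p * A) - i * (i * B) =
      s * (p * A + i * B) + (p + i + s) * R1 - R0" if "p * i = 1" for p i A B R0 R1 :: ratfun2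
    using that by algebra
  define R where "R n = cheb (delta_elem b c u v) n - t ^ n - inverse t ^ n" for n
  have "R n \<in> ?L (- 1)"
  proof (induction n rule: induct_nat_012)
    case 0
    show ?case by (simp add: R_def laurent_deg_le_0)
  next
    case 1
    show ?case using s by (simp add: R_def z)
  next
    case (ge2 n)
    have ti: "t * inverse t = 1" using t0 by simp
    have "R (Suc (Suc n)) = s * (t ^ Suc n + inverse t ^ Suc n) + (t + inverse t + s) * R (Suc n) - R n"
    proof -
      have c2: "cheb (delta_elem b c u v) (Suc (Suc n)) =
          (t + inverse t + s) * (R (Suc n) + t ^ Suc n + inverse t ^ Suc n) - (R n + t ^ n + inverse t ^ n)"
        by (simp add: R_def z)
      show ?thesis
        unfolding R_def[of "Suc (Suc n)"] c2 power_Suc by (rule expand[OF ti])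
    qed
    moreover have "s * (t ^ Suc n + inverse t ^ Suc n) \<in> ?L (- 1)"
      using laurent_deg_le_mult[OF uv s laurent_deg_le_add[OF pow[OF t, of "Suc n"] pow[OF it, of "Suc n"]]]
      by simp
    moreover have "(t + inverse t + s) * R (Suc n) \<in> ?L (- 1)"
      using laurent_deg_le_mult[OF uv laurent_deg_le_add[OF laurent_deg_le_add[OF t it] sub[OF s]] ge2(2)] by simp
    ultimately show ?case using ge2(1) by (simp add: laurent_deg_le_add laurent_deg_le_diff)
  qed
  then show ?thesis by (simp add: R_def)
qed

lemma cheb_coefficients:
  assumes uv: "u \<noteq> 0" "v \<noteq> 0" and bc: "b * c = 4" and n: "n > 0"
  obtains f where "cheb (delta_elem b c u v) n = laurent_eval f u v"
    "\<And>l. l > 0 \<Longrightarrow> coeff_at f (delta_exponent b l) = (if l = n then 1 else 0)"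
    "\<And>e. fst e \<ge> 0 \<Longrightarrow> snd e \<ge> 0 \<Longrightarrow> coeff_at f e = 0"
proof -
  define d1 d2 where "d1 = fst (delta_direction b)" and "d2 = snd (delta_direction b)"
  define t where "t = u powi d1 * v powi d2"
  obtain g where g: "cheb (delta_elem b c u v) n - t ^ n - inverse t ^ n = laurent_eval g u v"
    "\<And>k. coeff_at g k \<noteq> 0 \<Longrightarrow> fst (delta_weight b) * fst k + snd (delta_weight b) * snd k \<le> - 1"
    using cheb_leading_terms[OF uv bc, of n] unfolding laurent_deg_le_def t_def d1_def d2_def by blast
  define f where "f = Poly_Mapping.single (int n * d1, int n * d2) 1 +
    Poly_Mapping.single (- (int n * d1), - (int n * d2)) 1 + g"
  have w: "fst (delta_weight b) > 0" "snd (delta_weight b) > 0" by (simp_all add: delta_weight_def)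
  then have d: "d1 > 0" "d2 < 0" by (simp_all add: d1_def d2_def delta_direction_def)
  have tn: "t ^ n = u powi (int n * d1) * v powi (int n * d2)"
    by (simp add: t_def power_mult_distrib power_int_power' mult.commute)
  have itn: "inverse t ^ n = u powi (- (int n * d1)) * v powi (- (int n * d2))"
    by (simp add: power_inverse tn power_int_minus)
  have "cheb (delta_elem b c u v) n = laurent_eval f u v"
    unfolding f_def laurent_eval_add laurent_eval_single g(1)[symmetric] tn itn by simp
  moreover have "coeff_at f (- (int l * d1), - (int l * d2)) = (if l = n then 1 else 0)" if l: "l > 0" for l
  proof -
    have "coeff_at g (- (int l * d1), - (int l * d2)) = 0"
    proof (rule ccontr)
      assume "\<not> ?thesis"
      from g(2)[OF this] show False by (simp add: d1_def d2_def delta_direction_def algebra_simps)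
    qed
    moreover have "int n * d1 \<noteq> - (int l * d1)" using d n l
      by (metis add.inverse_inverse mult_pos_pos neg_0_less_iff_less of_nat_0_less_iff order_less_not_sym)
    moreover have "- (int n * d1) = - (int l * d1) \<longleftrightarrow> l = n" using d by auto
    ultimately show ?thesis by (auto simp: f_def lookup_add lookup_single when_def)
  qed
  moreover have "coeff_at f e = 0" if e: "fst e \<ge> 0" "snd e \<ge> 0" for e
  proof -
    have "coeff_at g e = 0"
    proof (rule ccontr)
      assume "\<not> ?thesis"
      from g(2)[OF this] have "fst (delta_weight b) * fst e + snd (delta_weight b) * snd e \<le> - 1" .
      moreover have "fst (delta_weight b) * fst e \<ge> 0" "snd (delta_weight b) * snd e \<ge> 0" using w e by simp_all
      ultimately show False by linarith
    qed
    moreover have "int n * d2 < 0" "- (int n * d1) < 0" using d n by (simp_all add: mult_pos_neg)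
    ultimately show ?thesis using e by (auto simp: f_def lookup_add lookup_single when_def)
  qed
  ultimately show thesis using that unfolding delta_exponent_def d1_def d2_def by blast
qed

section \<open>Recovering coefficients from expansions\<close>

text \<open>
  A cluster monomial other than \<open>1\<close> can be given a value below \<open>1\<close> by setting one variable to
  \<open>1/2\<close> and the next one to \<open>1\<close>. Since the sequence then grows to the right, the monomials
  \<open>inverse t ^ n\<close> of all later clusters have values at least \<open>1\<close>, so they cannot occur.
\<close>

lemma cluster_monomial_avoids_direction:
  assumes bc: "b * c = 4" and x: "x \<in> cluster_monomials (cluster_var b c)" and n: "n > 0"
  shows "\<exists>M. \<forall>m f. m \<ge> M \<longrightarrow> x = laurent_eval f (cluster_var b c m) (cluster_var b c (m + 1)) \<longrightarrow>
    (\<forall>k. coeff_at f k \<ge> 0) \<longrightarrow>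
    coeff_at f (delta_exponent (exch_exp b c m) n) = 0"
proof -
  let ?y = "cluster_var b c"
  obtain l0 r0 t0 where x0: "x = ?y l0 ^ r0 * ?y (l0 + 1) ^ t0" using x unfolding cluster_monomials_def by blast
  have "\<exists>l r t. x = ?y l ^ r * ?y (l + 1) ^ t \<and> (r > 0 \<or> t = 0)"
  proof (cases "r0 > 0")
    case True
    then show ?thesis using x0 by blast
  next
    case False
    then have "x = ?y (l0 + 1) ^ t0 * ?y (l0 + 1 + 1) ^ 0" using x0 by simp
    then show ?thesis by blast
  qed
  then obtain l r t where xl: "x = ?y l ^ r * ?y (l + 1) ^ t" and rt: "r > 0 \<or> t = 0" by blast
  obtain s :: "int \<Rightarrow> rat" where s: "exchange_seq b c s" "\<And>m. s m > 0" "s l = 1 / 2" "s (l + 1) = 1"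
    using exchange_seq_exists[of "1 / 2 :: rat" 1 b c l] half_gt_zero[OF zero_less_one] zero_less_one
    by metis
  have start: "s (l + 1) \<ge> 1" "s (l + 1) ^ 2 \<ge> s (l + 1 - 1) ^ exch_exp b c (l + 1 - 1)"
    by (simp_all add: s power_le_one)
  show ?thesis
  proof (rule exI[of _ "l + 1"], intro allI impI)
    fix m f
    assume m: "m \<ge> l + 1" and f: "x = laurent_eval f (?y m) (?y (m + 1))" "\<forall>k. coeff_at f k \<ge> 0"
    define e where "e = exch_exp b c m"
    define k where "k = delta_exponent e n"
    have "coeff_at f k = 0"
    proof (cases "r > 0")
      case False
      then have "x = laurent_eval (Poly_Mapping.single (0, 0) 1) (?y m) (?y (m + 1))"
        using xl rt by (simp add: laurent_eval_single)
      then have "f = Poly_Mapping.single (0, 0) 1"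
        using f(1) by (intro laurent_expansion_unique[of _ b c m]) simp
      moreover have "k \<noteq> (0, 0)" using n by (simp add: k_def delta_exponent_def delta_direction_def delta_weight_def)
      ultimately show ?thesis by (auto simp: lookup_single when_def)
    next
      case True
      show ?thesis
      proof (rule ccontr)
        assume k0: "coeff_at f k \<noteq> 0"
        have "has_value (s 1) (s 2) x (s l ^ r * s (l + 1) ^ t)"
          unfolding xl by (intro has_value_mult has_value_power has_value_cluster_var s(1))
        then have "s m powi fst k * s (m + 1) powi snd k \<le> s l ^ r * s (l + 1) ^ t"
          using laurent_term_le_value[OF s(1,2) _ k0] f by simp
        also have "\<dots> < 1" using True by (simp add: s power_less_one_iff power_divide)
        finally have lt: "s m powi fst k * s (m + 1) powi snd k < 1" .
        have grow: "s (m + 1) ^ 2 \<ge> s m ^ e"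
          using affine_growth[OF s(1,2) bc start, of "m + 1"] m by (simp add: e_def)
        have pos: "s m > 0" "s (m + 1) > 0" using s(2) by auto
        define q where "q = s m powi (- fst (delta_direction e)) * s (m + 1) powi (- snd (delta_direction e))"
        have "e = 1 \<or> e = 2 \<or> e = 4"
          using bc by (cases rule: affine_type_cases) (auto simp: e_def exch_exp_def)
        then have "q \<ge> 1"
        proof (elim disjE)
          assume "e = 1"
          then show ?thesis using grow pos
            by (simp add: q_def delta_direction_def delta_weight_def power_int_minus field_simps)
        next
          assume e: "e = 2"
          have "s m \<le> s (m + 1)" by (rule power2_le_imp_le) (use grow e pos in auto)
          then show ?thesis using e pos
            by (simp add: q_def delta_direction_def delta_weight_def power_int_minus field_simps)
        next
          assume e: "e = 4"
          have "(s m ^ 2) ^ 2 \<le> s (m + 1) ^ 2" using grow e by (simp flip: power_mult)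
          then have "s m ^ 2 \<le> s (m + 1)" by (rule power2_le_imp_le) (use pos in auto)
          then show ?thesis using e pos
            by (simp add: q_def delta_direction_def delta_weight_def power_int_minus field_simps)
        qed
        then have "1 \<le> q ^ n" by simp
        also have "q ^ n = s m powi fst k * s (m + 1) powi snd k"
          by (simp add: q_def k_def delta_exponent_def power_mult_distrib power_int_power' mult.commute)
        finally show False using lt by simp
      qed
    qed
    then show "coeff_at f (delta_exponent (exch_exp b c m) n) = 0" by (simp add: k_def e_def)
  qed
qed

lemma cheb_delta_coefficients:
  assumes bc: "b * c = 4" and n: "n > 0"
    and f: "cheb (delta_elem b c Y1 Y2) n = laurent_eval f (cluster_var b c m) (cluster_var b c (m + 1))"
  shows "l > 0 \<Longrightarrow> coeff_at f (delta_exponent (exch_exp b c m) l) = (if l = n then 1 else 0)"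
    and "fst e \<ge> 0 \<Longrightarrow> snd e \<ge> 0 \<Longrightarrow> coeff_at f e = 0"
proof -
  note Y = exchange_seq_cluster_var[of b c]
  have bc': "exch_exp b c m * exch_exp b c (m - 1) = 4"
    using exch_exp_shift_mult[of b c m] bc by (simp add: mult.commute)
  have nz: "cluster_var b c k \<noteq> 0" for k using exchange_seq_nonzero[OF Y] .
  obtain g where g: "cheb (delta_elem (exch_exp b c m) (exch_exp b c (m - 1)) (cluster_var b c m) (cluster_var b c (m + 1))) n =
      laurent_eval g (cluster_var b c m) (cluster_var b c (m + 1))"
    "\<And>l. l > 0 \<Longrightarrow> coeff_at g (delta_exponent (exch_exp b c m) l) = (if l = n then 1 else 0)"
    "\<And>e. fst e \<ge> 0 \<Longrightarrow> snd e \<ge> 0 \<Longrightarrow> coeff_at g e = 0"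
    using cheb_coefficients[OF nz nz bc' n] by blast
  have "f = g"
    using f g(1) delta_elem_shift[OF Y bc, of m] by (intro laurent_expansion_unique[of _ b c m]) simp
  then show "l > 0 \<Longrightarrow> coeff_at f (delta_exponent (exch_exp b c m) l) = (if l = n then 1 else 0)"
    "fst e \<ge> 0 \<Longrightarrow> snd e \<ge> 0 \<Longrightarrow> coeff_at f e = 0"
    using g(2,3) by auto
qed

lemma cluster_basis_cases:
  assumes "x \<in> cluster_basis b c (cluster_var b c)"
  obtains "x \<in> cluster_monomials (cluster_var b c)"
  | n where "b * c = 4" "n > 0" "x = cheb (delta_elem b c Y1 Y2) n" "x \<notin> cluster_monomials (cluster_var b c)"
proof (cases "x \<in> cluster_monomials (cluster_var b c)")
  case False
  then have "b * c = 4 \<and> (\<exists>n>0. x = cheb (delta_elem b c Y1 Y2) n)"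
    using assms by (auto simp: cluster_basis_def image_iff Suc_le_eq split: if_splits)
  then show thesis using that(2) False by blast
qed (rule that(1))

text \<open>
  For a cluster monomial take a cluster in which it is a monomial with non-negative exponents: no
  other basis element contains this monomial there. For \<open>cheb z n\<close> take \<open>inverse t ^ n\<close> in a cluster
  far to the right of all cluster monomials in \<open>S\<close>; this is why \<open>S\<close> has to be finite.
\<close>

theorem dual_monomial:
  assumes bc: "b > 0" "c > 0" "b * c \<le> 4"
    and S: "finite S" "S \<subseteq> cluster_basis b c (cluster_var b c)" and \<beta>: "\<beta> \<in> S"
  shows "\<exists>m e. \<forall>\<gamma>\<in>S. \<forall>f. \<gamma> = laurent_eval f (cluster_var b c m) (cluster_var b c (m + 1)) \<longrightarrow>
    coeff_at f e = (if \<gamma> = \<beta> then 1 else 0)"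
proof -
  let ?y = "cluster_var b c"
  have nonneg: "coeff_at f k \<ge> 0" if \<gamma>: "\<gamma> \<in> S" "\<gamma> = laurent_eval f (?y m) (?y (m + 1))" for \<gamma> f m k
  proof -
    have "\<gamma> \<in> pos_laurent (?y m) (?y (m + 1))"
      by (rule cluster_basis_positive[OF bc]) (use S(2) \<gamma>(1) in blast)
    then obtain g where g: "\<gamma> = laurent_eval g (?y m) (?y (m + 1))" "\<forall>k. coeff_at g k \<ge> 0"
      using pos_laurent_expansion by blast
    have "f = g" by (rule laurent_expansion_unique[of _ b c m]) (use \<gamma>(2) g(1) in simp)
    then show ?thesis using g(2) by blast
  qed
  from \<beta> S(2) have "\<beta> \<in> cluster_basis b c ?y" by blast
  then show ?thesis
  proof (cases rule: cluster_basis_cases)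
    case 1
    then obtain m p q where \<beta>m: "\<beta> = ?y m ^ p * ?y (m + 1) ^ q" unfolding cluster_monomials_def by blast
    have single: "f = Poly_Mapping.single (int p', int q') 1"
      if "?y m ^ p' * ?y (m + 1) ^ q' = laurent_eval f (?y m) (?y (m + 1))" for f p' q'
      using that by (intro laurent_expansion_unique[of _ b c m]) (simp add: laurent_eval_single)
    have "coeff_at f (int p, int q) = (if \<gamma> = \<beta> then 1 else 0)"
      if \<gamma>: "\<gamma> \<in> S" and f: "\<gamma> = laurent_eval f (?y m) (?y (m + 1))" for \<gamma> f
    proof (cases "\<gamma> = \<beta>")
      case True
      then show ?thesis using single[of p q f] f \<beta>m by simp
    next
      case False
      have "coeff_at f (int p, int q) = 0"
      proof (rule ccontr)
        assume c0: "\<not> ?thesis"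
        from \<gamma> S(2) have "\<gamma> \<in> cluster_basis b c ?y" by blast
        then show False
        proof (cases rule: cluster_basis_cases)
          case 1
          obtain p' q' where \<gamma>m: "\<gamma> = ?y m ^ p' * ?y (m + 1) ^ q'"
            using cluster_monomial_proper[OF bc 1 f nonneg[OF \<gamma> f] c0] by auto
          then have "f = Poly_Mapping.single (int p', int q') 1" using single f by simp
          then have "p' = p \<and> q' = q" using c0 by (auto simp: lookup_single when_def split: if_splits)
          with \<gamma>m \<beta>m False show False by simp
        next
          case (2 n)
          then show False using cheb_delta_coefficients(2)[of b c n f m "(int p, int q)"] f c0 by simp
        qed
      qed
      then show ?thesis using False by simp
    qed
    then show ?thesis by blast
  next
    case (2 n)
    have "\<exists>M. \<forall>\<gamma>\<in>S. \<gamma> \<in> cluster_monomials ?y \<longrightarrow> (\<forall>m f. m \<ge> M \<longrightarrow> \<gamma> = laurent_eval f (?y m) (?y (m + 1)) \<longrightarrow>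
      coeff_at f (delta_exponent (exch_exp b c m) n) = 0)"
    proof -
      have "\<exists>M. \<forall>m f. m \<ge> M \<longrightarrow> \<gamma> = laurent_eval f (?y m) (?y (m + 1)) \<longrightarrow>
        coeff_at f (delta_exponent (exch_exp b c m) n) = 0"
        if "\<gamma> \<in> S" "\<gamma> \<in> cluster_monomials ?y" for \<gamma>
        using cluster_monomial_avoids_direction[OF 2(1) that(2) 2(2)] nonneg[OF that(1)] by meson
      then obtain M where M: "\<And>\<gamma> m f. \<gamma> \<in> S \<Longrightarrow> \<gamma> \<in> cluster_monomials ?y \<Longrightarrow> m \<ge> M \<gamma> \<Longrightarrow>
        \<gamma> = laurent_eval f (?y m) (?y (m + 1)) \<Longrightarrow>
        coeff_at f (delta_exponent (exch_exp b c m) n) = 0"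
        by metis
      have "M \<gamma> \<le> Max (M ` S)" if "\<gamma> \<in> S" for \<gamma> using S(1) that by simp
      with M show ?thesis by (intro exI[of _ "Max (M ` S)"]) (meson order_trans)
    qed
    then obtain m where m: "\<And>\<gamma> f. \<gamma> \<in> S \<Longrightarrow> \<gamma> \<in> cluster_monomials ?y \<Longrightarrow>
        \<gamma> = laurent_eval f (?y m) (?y (m + 1)) \<Longrightarrow>
        coeff_at f (delta_exponent (exch_exp b c m) n) = 0"
      by (meson order_refl)
    define e where "e = (delta_exponent (exch_exp b c m) n)"
    have "coeff_at f e = (if \<gamma> = \<beta> then 1 else 0)"
      if \<gamma>: "\<gamma> \<in> S" and f: "\<gamma> = laurent_eval f (?y m) (?y (m + 1))" for \<gamma> f
    proof -
      from \<gamma> S(2) have "\<gamma> \<in> cluster_basis b c ?y" by blast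
      then show ?thesis
      proof (cases rule: cluster_basis_cases)
        case 1
        then show ?thesis using m[OF \<gamma> 1 f] 2(4) by (auto simp: e_def)
      next
        case g: (2 l)
        have fl: "coeff_at f e = (if n = l then 1 else 0)"
          using cheb_delta_coefficients(1)[of b c l f m n] g f 2 by (simp add: e_def)
        moreover have "n = l" if "\<gamma> = \<beta>"
        proof -
          have "coeff_at f e = 1"
            using cheb_delta_coefficients(1)[of b c n f m n] f 2 that by (simp add: e_def)
          then show ?thesis using fl by (simp split: if_splits)
        qed
        moreover have "\<gamma> = \<beta>" if "n = l" using g(3) 2(3) that by simp
        ultimately show ?thesis using fl by auto
      qed
    qed
    then show ?thesis by blast
  qed
qed

lemma coefficient_recovery:
  assumes bc: "b > 0" "c > 0" "b * c \<le> 4"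
    and S: "finite S" "S \<subseteq> cluster_basis b c (cluster_var b c)" and \<beta>: "\<beta> \<in> S"
  shows "\<exists>m e. \<forall>r f. (\<Sum>\<gamma>\<in>S. int_scale (r \<gamma>) \<gamma>) = laurent_eval f (cluster_var b c m) (cluster_var b c (m + 1)) \<longrightarrow>
    coeff_at f e = r \<beta>"
proof -
  let ?y = "cluster_var b c"
  obtain m e where dual: "\<And>\<gamma> f. \<gamma> \<in> S \<Longrightarrow> \<gamma> = laurent_eval f (?y m) (?y (m + 1)) \<Longrightarrow>
    coeff_at f e = (if \<gamma> = \<beta> then 1 else 0)"
    using dual_monomial[OF bc S \<beta>] by blast
  have "\<exists>g. \<gamma> = laurent_eval g (?y m) (?y (m + 1))" if "\<gamma> \<in> S" for \<gamma>
  proof -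
    have "\<gamma> \<in> pos_laurent (?y m) (?y (m + 1))"
      by (rule cluster_basis_positive[OF bc]) (use S(2) that in blast)
    then show ?thesis using pos_laurent_expansion by blast
  qed
  then obtain g where g: "\<And>\<gamma>. \<gamma> \<in> S \<Longrightarrow> \<gamma> = laurent_eval (g \<gamma>) (?y m) (?y (m + 1))" by metis
  have "coeff_at f e = r \<beta>" if f: "(\<Sum>\<gamma>\<in>S. int_scale (r \<gamma>) \<gamma>) = laurent_eval f (?y m) (?y (m + 1))" for r f
  proof -
    have "laurent_eval f (?y m) (?y (m + 1)) = laurent_eval (\<Sum>\<gamma>\<in>S. frag_cmul (r \<gamma>) (g \<gamma>)) (?y m) (?y (m + 1))"
      unfolding f[symmetric] laurent_eval_sum laurent_eval_frag_cmul by (intro sum.cong) (auto simp flip: g)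
    then have "f = (\<Sum>\<gamma>\<in>S. frag_cmul (r \<gamma>) (g \<gamma>))" by (rule laurent_expansion_unique)
    then have "coeff_at f e = (\<Sum>\<gamma>\<in>S. r \<gamma> * coeff_at (g \<gamma>) e)" by (simp add: lookup_sum)
    also have "\<dots> = (\<Sum>\<gamma>\<in>S. if \<gamma> = \<beta> then r \<beta> else 0)"
    proof (rule sum.cong[OF refl])
      fix \<gamma> assume \<gamma>: "\<gamma> \<in> S"
      show "r \<gamma> * coeff_at (g \<gamma>) e = (if \<gamma> = \<beta> then r \<beta> else 0)"
        using dual[OF \<gamma> g[OF \<gamma>]] by simp
    qed
    also have "\<dots> = r \<beta>" using S(1) \<beta> by simp
    finally show ?thesis .
  qed
  then show ?thesis by blast
qed

section \<open>The canonical basis\<close>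

lemma cluster_basis_independent:
  assumes bc: "b > 0" "c > 0" "b * c \<le> 4"
  shows "int_module.independent (cluster_basis b c (cluster_var b c))"
  unfolding int_module.independent_explicit_module
proof (intro allI impI)
  fix t u v
  assume t: "finite t" "t \<subseteq> cluster_basis b c (cluster_var b c)" "(\<Sum>v\<in>t. int_scale (u v) v) = 0" "v \<in> t"
  obtain m e where "\<forall>r f. (\<Sum>\<gamma>\<in>t. int_scale (r \<gamma>) \<gamma>) = laurent_eval f (cluster_var b c m) (cluster_var b c (m + 1)) \<longrightarrow>
    coeff_at f e = r v"
    using coefficient_recovery[OF bc t(1,2,4)] by blast
  from this[rule_format, of u 0] t(3) show "u v = 0" by simp
qed

lemma cluster_basis_is_basis:
  assumes bc: "b > 0" "c > 0" "b * c \<le> 4"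
  shows "is_int_basis (cluster_basis b c (cluster_var b c)) (cluster_algebra b c)"
proof -
  from pointed_family_exists[OF bc]
  obtain X where X: "(\<forall>\<alpha>. has_denominator \<alpha> (X \<alpha>)) \<and>
      (\<forall>\<alpha>. X \<alpha> \<in> cluster_basis b c (cluster_var b c)) \<and>
      cluster_algebra b c \<subseteq> int_module.span (range X)" ..
  have "int_module.span (range X) \<subseteq> int_module.span (cluster_basis b c (cluster_var b c))"
    using X by (intro int_module.span_mono) auto
  then show ?thesis unfolding is_int_basis_def
    using cluster_basis_independent[OF bc] X span_subset_cluster_algebra[OF cluster_basis_subset]
    by auto
qed

lemma pos_laurent_sum:
  assumes "u \<noteq> 0" "v \<noteq> 0" and x: "\<And>x. x \<in> S \<Longrightarrow> x \<in> pos_laurent u v" and k: "\<And>x. x \<in> S \<Longrightarrow> k x > 0"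
  shows "(\<Sum>x\<in>S. int_scale (k x) x) \<in> pos_laurent u v"
  using x k
proof (induction S rule: infinite_finite_induct)
  case (insert x S)
  have "of_nat n \<in> pos_laurent u v" for n
    by (induction n) (auto intro: pos_laurent.zero pos_laurent_add pos_laurent_1)
  from this[of "nat (k x)"] have "(of_int (k x) :: ratfun2) \<in> pos_laurent u v"
    using insert.prems(2)[of x] by simp
  then show ?case using insert assms(1,2) by (auto intro!: pos_laurent_add pos_laurent_mult)
qed (auto intro: pos_laurent.zero)

theorem cluster_basis_is_canonical:
  assumes bc: "b > 0" "c > 0" "b * c \<le> 4"
  shows "is_canonical_basis b c (cluster_basis b c (cluster_var b c))"
proof -
  let ?B = "cluster_basis b c (cluster_var b c)" and ?y = "cluster_var b c"
  note Y = exchange_seq_cluster_var[of b c]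
  have nz: "?y k \<noteq> 0" for k using exchange_seq_nonzero[OF Y] .
  note basis = cluster_basis_is_basis[OF bc, unfolded is_int_basis_def]
  have "positive b c x" if x: "x \<in> pos_combinations ?B" for x
  proof -
    obtain S k where S: "finite S" "S \<noteq> {}" "S \<subseteq> ?B" "\<forall>x\<in>S. k x > 0" "x = (\<Sum>x\<in>S. int_scale (k x) x)"
      using x unfolding pos_combinations_def by blast
    obtain \<beta> where \<beta>: "\<beta> \<in> S" using S(2) by blast
    have "x \<noteq> 0"
    proof
      assume "x = 0"
      then have "(\<Sum>x\<in>S. int_scale (k x) x) = 0" by (simp flip: S(5))
      then have "k \<beta> = 0" by (rule int_module.independentD[OF conjunct1[OF basis] S(1,3) _ \<beta>])
      with S(4) \<beta> show False by auto
    qed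
    moreover have "x \<in> cluster_algebra b c"
    proof -
      have "x \<in> int_module.span ?B" unfolding int_module.span_explicit using S by blast
      then show ?thesis using basis by blast
    qed
    moreover have "\<exists>f. x = laurent_eval f (?y m) (?y (m + 1)) \<and> (\<forall>k\<in>Poly_Mapping.keys f. coeff_at f k > 0)" for m
    proof -
      have "x \<in> pos_laurent (?y m) (?y (m + 1))"
        unfolding S(5) using S(3,4) cluster_basis_positive[OF bc] by (intro pos_laurent_sum nz) auto
      then obtain f where f: "x = laurent_eval f (?y m) (?y (m + 1))" "\<forall>k. coeff_at f k \<ge> 0"
        using pos_laurent_expansion by blast
      have "coeff_at f k > 0" if "k \<in> Poly_Mapping.keys f" for k
        using f(2) that by (metis in_keys_iff order_le_imp_less_or_eq)
      with f(1) show ?thesis by blast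
    qed
    ultimately show ?thesis unfolding positive_def by blast
  qed
  moreover have "x \<in> pos_combinations ?B" if x: "positive b c x" for x
  proof -
    have "x \<in> int_module.span ?B" using x basis unfolding positive_def by blast
    then obtain t r where t: "finite t" "t \<subseteq> ?B" "x = (\<Sum>a\<in>t. int_scale (r a) a)"
      unfolding int_module.span_explicit by blast
    define S where "S = {a \<in> t. r a \<noteq> 0}"
    have S: "finite S" "S \<subseteq> ?B" using t by (auto simp: S_def)
    have xS: "x = (\<Sum>a\<in>S. int_scale (r a) a)"
      unfolding t(3) S_def by (rule sum.mono_neutral_right) (use t(1) in auto)
    have "S \<noteq> {}" using x xS unfolding positive_def by auto
    moreover have "r \<beta> > 0" if \<beta>: "\<beta> \<in> S" for \<beta>
    proof -
      obtain m e where rec: "\<forall>r f. (\<Sum>\<gamma>\<in>S. int_scale (r \<gamma>) \<gamma>) = laurent_eval f (?y m) (?y (m + 1)) \<longrightarrow>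
        coeff_at f e = r \<beta>"
        using coefficient_recovery[OF bc S \<beta>] by blast
      obtain f where f: "x = laurent_eval f (?y m) (?y (m + 1))" "\<forall>k\<in>Poly_Mapping.keys f. coeff_at f k > 0"
        using x unfolding positive_def by blast
      have "coeff_at f e = r \<beta>" using rec f(1) xS by simp
      moreover have "r \<beta> \<noteq> 0" using \<beta> by (simp add: S_def)
      ultimately show ?thesis using f(2) by (metis in_keys_iff)
    qed
    ultimately show ?thesis unfolding pos_combinations_def using S xS by blast
  qed
  ultimately show ?thesis
    unfolding is_canonical_basis_def using cluster_basis_is_basis[OF bc] by blast
qed

lemma representation_combination:
  assumes B: "int_module.independent B" and S: "finite S" "S \<subseteq> B"
  shows "int_module.representation B (\<Sum>x\<in>S. int_scale (k x) x) = (\<lambda>x. if x \<in> S then k x else 0)"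
proof (rule int_module.representation_eqI[OF B])
  show "(\<Sum>x\<in>S. int_scale (k x) x) \<in> int_module.span B"
    by (intro int_module.span_sum int_module.span_scale int_module.span_base) (use S in auto)
  show "finite {x. (if x \<in> S then k x else 0) \<noteq> 0}" using S(1) by (rule rev_finite_subset) auto
  show "(\<Sum>x | (if x \<in> S then k x else 0) \<noteq> 0. int_scale (if x \<in> S then k x else 0) x) =
    (\<Sum>x\<in>S. int_scale (k x) x)"
    by (rule sum.mono_neutral_cong_left) (use S in auto)
qed (use S in \<open>auto split: if_splits\<close>)

text \<open>
  A basis is determined by its positive combinations. If an element \<open>\<beta>\<close> of one basis is a positive
  combination of elements of the other one, then these have non-negative coordinates in the first
  basis, so there is no cancellation and all of them are multiples of \<open>\<beta>\<close>; comparing the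
  coordinate at \<open>\<beta>\<close> leaves only \<open>\<beta>\<close> itself.
\<close>

lemma positive_basis_subset:
  assumes B: "is_int_basis B A" and B': "is_int_basis B' A" and eq: "pos_combinations B = pos_combinations B'"
  shows "B \<subseteq> B'"
proof
  fix \<beta> assume \<beta>: "\<beta> \<in> B"
  have ind: "int_module.independent B" using B by (simp add: is_int_basis_def)
  let ?r = "int_module.representation B"
  have base: "x \<in> pos_combinations C" if "x \<in> C" for x C
    unfolding pos_combinations_def using that by (intro CollectI exI[of _ "{x}"] exI[of _ "\<lambda>_. 1"]) auto
  have "\<beta> \<in> pos_combinations B'" using base[OF \<beta>] eq by simp
  then obtain S k where S: "finite S" "S \<noteq> {}" "S \<subseteq> B'" "\<And>x. x \<in> S \<Longrightarrow> k x > 0" "\<beta> = (\<Sum>x\<in>S. int_scale (k x) x)"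
    unfolding pos_combinations_def by blast
  have rep: "\<exists>T l. finite T \<and> T \<noteq> {} \<and> T \<subseteq> B \<and> (\<forall>y\<in>T. l y > 0) \<and> x = (\<Sum>y\<in>T. int_scale (l y) y)" if "x \<in> S" for x
  proof -
    have "x \<in> pos_combinations B" using base[of x B'] S(3) that eq by auto
    then show ?thesis unfolding pos_combinations_def by blast
  qed
  have nonneg: "?r x y \<ge> 0" and some: "\<exists>y\<in>B. ?r x y > 0" if "x \<in> S" for x y
  proof -
    obtain T l where T: "finite T" "T \<noteq> {}" "T \<subseteq> B" "\<forall>y\<in>T. l y > 0" "x = (\<Sum>y\<in>T. int_scale (l y) y)"
      using rep[OF \<open>x \<in> S\<close>] by blast
    have r: "?r x = (\<lambda>y. if y \<in> T then l y else 0)" unfolding T(5) by (rule representation_combination[OF ind T(1,3)])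
    show "?r x y \<ge> 0" using T(4) by (auto simp: r less_imp_le)
    show "\<exists>y\<in>B. ?r x y > 0" using T(2-4) by (auto simp: r)
  qed
  have inspan: "x \<in> int_module.span B" if "x \<in> S" for x
    using B B' S(3) that int_module.span_base[of x B'] by (auto simp: is_int_basis_def)
  have coord: "(if y = \<beta> then 1 else 0) = (\<Sum>x\<in>S. k x * ?r x y)" for y
  proof -
    have "?r \<beta> = (\<lambda>y. \<Sum>x\<in>S. ?r (int_scale (k x) x) y)"
      unfolding S(5) by (rule int_module.representation_sum[OF ind]) (auto intro: int_module.span_scale inspan)
    then have "?r \<beta> y = (\<Sum>x\<in>S. k x * ?r x y)"
      using int_module.representation_scale[OF ind inspan] by simp
    then show ?thesis using int_module.representation_basis[OF ind \<beta>] by simp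
  qed
  have term_le: "k x * ?r x y \<le> (if y = \<beta> then 1 else 0)" if "x \<in> S" for x y
    unfolding coord by (rule member_le_sum) (use that S(1,4) nonneg in \<open>auto simp: less_imp_le\<close>)
  obtain x where x: "x \<in> S" using S(2) by blast
  have kx: "k x \<ge> 1" using S(4)[OF x] by simp
  have bound: "?r x y \<le> (if y = \<beta> then 1 else 0)" for y
  proof -
    have "1 * ?r x y \<le> k x * ?r x y" using kx nonneg[OF x] by (intro mult_right_mono) auto
    then show ?thesis using term_le[OF x, of y] by simp
  qed
  obtain y where y: "?r x y > 0" using some[OF x] by blast
  then have "y = \<beta>" using bound[of y] by (simp split: if_splits)
  have "?r x = ?r \<beta>"
  proof
    fix w
    show "?r x w = ?r \<beta> w"
      using bound[of w] nonneg[OF x, of w] y \<open>y = \<beta>\<close> int_module.representation_basis[OF ind \<beta>]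
      by (cases "w = \<beta>") auto
  qed
  have "x = (\<Sum>y | ?r x y \<noteq> 0. int_scale (?r x y) y)"
    by (rule int_module.sum_nonzero_representation_eq[OF ind inspan[OF x], symmetric])
  also have "\<dots> = \<beta>"
    unfolding \<open>?r x = ?r \<beta>\<close>
    by (rule int_module.sum_nonzero_representation_eq[OF ind int_module.span_base[OF \<beta>]])
  finally have "x = \<beta>" .
  then show "\<beta> \<in> B'" using x S(3) by blast
qed

lemma canonical_basis_eq:
  assumes bc: "b > 0" "c > 0" "b * c \<le> 4"
  shows "canonical_basis b c = cluster_basis b c (cluster_var b c)"
  unfolding canonical_basis_def
proof (rule the_equality)
  show "is_canonical_basis b c (cluster_basis b c (cluster_var b c))"
    by (rule cluster_basis_is_canonical[OF bc])
next
  fix B assume B: "is_canonical_basis b c B"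
  note can = cluster_basis_is_canonical[OF bc]
  show "B = cluster_basis b c (cluster_var b c)"
    using positive_basis_subset[of B "cluster_algebra b c" "cluster_basis b c (cluster_var b c)"]
      positive_basis_subset[of "cluster_basis b c (cluster_var b c)" "cluster_algebra b c" B]
      B can unfolding is_canonical_basis_def by auto
qed

theorem theorem2p4:
  fixes b c :: nat
  assumes "b > 0" and "c > 0" and "b * c \<le> 4"
  shows "(\<forall>\<alpha> :: int \<times> int. \<exists>!x. x \<in> canonical_basis b c \<and> has_denominator \<alpha> x) \<and>
    bij_betw (canonical_elem b c) (UNIV :: (int \<times> int) set) (canonical_basis b c)"
proof -
  define B where "B = canonical_basis b c"
  have Beq: "B = cluster_basis b c (cluster_var b c)" unfolding B_def by (rule canonical_basis_eq[OF assms])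
  from pointed_family_exists[OF assms, folded Beq]
  obtain X where X': "(\<forall>\<alpha>. has_denominator \<alpha> (X \<alpha>)) \<and> (\<forall>\<alpha>. X \<alpha> \<in> B) \<and>
    cluster_algebra b c \<subseteq> int_module.span (range X)" ..
  have X: "has_denominator \<alpha> (X \<alpha>)" "X \<alpha> \<in> B" "cluster_algebra b c \<subseteq> int_module.span (range X)" for \<alpha>
    using X' by blast+
  have ind: "int_module.independent B" unfolding Beq by (rule cluster_basis_independent[OF assms])
  \<comment> \<open>An element of the basis outside \<open>range X\<close> would lie in the span of the other ones. Hence no
    two basis elements can share a denominator.\<close>
  have "B \<subseteq> range X"
  proof
    fix x assume x: "x \<in> B"
    show "x \<in> range X"
    proof (rule ccontr)
      assume "x \<notin> range X"
      then have "range X \<subseteq> B - {x}" using X(2) by auto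
      then have "int_module.span (range X) \<subseteq> int_module.span (B - {x})" by (rule int_module.span_mono)
      moreover have "x \<in> cluster_algebra b c" using x cluster_basis_subset unfolding Beq by blast
      ultimately have "x \<in> int_module.span (B - {x})" using X(3) by blast
      then obtain t r where t: "finite t" "t \<subseteq> B - {x}" "x = (\<Sum>a\<in>t. int_scale (r a) a)"
        unfolding int_module.span_explicit by blast
      have "x \<notin> t" using t(2) by blast
      then have "(\<Sum>a\<in>insert x t. int_scale (if a = x then - 1 else r a) a) = - x + (\<Sum>a\<in>t. int_scale (r a) a)"
        using t(1) by (auto intro!: sum.cong)
      then have "(\<Sum>a\<in>insert x t. int_scale (if a = x then - 1 else r a) a) = 0" using t(3) by simp
      then have "(if x = x then - 1 else r x) = 0"
        by (rule int_module.independentD[OF ind, rotated 2]) (use t x in auto)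
      then show False by simp
    qed
  qed
  then have range: "range X = B" using X(2) by blast
  have ex1: "\<exists>!x. x \<in> B \<and> has_denominator \<alpha> x" for \<alpha>
  proof (rule ex1I[of _ "X \<alpha>"])
    fix x assume x: "x \<in> B \<and> has_denominator \<alpha> x"
    then obtain \<beta> where "x = X \<beta>" using range by blast
    then show "x = X \<alpha>" using has_denominator_unique[OF X(1)] x by blast
  qed (use X in blast)
  have elem: "canonical_elem b c \<alpha> = X \<alpha>" for \<alpha>
    unfolding canonical_elem_def by (rule the1_equality) (use ex1 X in \<open>auto simp: B_def\<close>)
  have "inj X" by (rule injI) (metis X(1) has_denominator_unique)
  then have "bij_betw (canonical_elem b c) UNIV B"
    unfolding bij_betw_def using elem range by (metis ext)
  with ex1 show ?thesis unfolding B_def by blast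
qed

end
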